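(* Let $E$ be a locally complete complex locally convex Hausdorff space, $-\infty<a\le b<\infty$ and $K:=[a,b]$. Then the Fourier transform $$\mathcal{F}\colon bv_{K}(E)\to\mathcal{FO}_{K}(E),\quad \mathcal{F}([F])(\zeta):=\int_{\gamma_K}F(z)e^{-iz\zeta}\,dz,\quad\zeta\in\mathbb{C},$$ is a topological isomorphism.
   Context: $\mathbb{N}=\{1,2,\dots\}$. $E$ carries a directed system of seminorms $(p_\alpha)_{\alpha\in\mathfrak{A}}$ generating its topology; $E$ is locally complete if every closed (bounded, absolutely convex) disk in $E$ is a Banach disk. $\mathcal{O}(\Omega,E)$ is the space of $E$-valued holomorphic functions on an open set $\Omega\subset\mathbb{C}$. For compact $K\subset\mathbb{R}$ and $c>0$ put $U_{1/c}(K):=\{z\in\mathbb{C}\mid d(z,K)<c\}$ ($d$ the Euclidean distance, $U_{1/c}(\emptyset)=\emptyset$) and for $n\in\mathbb{N}$ put $S_n(K):=(\mathbb{C}\setminus\overline{U_n(K)})\cap\{z\mid|\operatorname{Im}z|<n\}$, where $U_n(K)$ is $U_{1/c}(K)$ with $c=1/n$. $\mathcal{O}^{exp}(\overline{\mathbb{C}}\setminus K,E)$ is the space of all $f\in\mathcal{O}(\mathbb{C}\setminus K,E)$ with $\sup_{z\in S_n(K)}p_\alpha(f(z))e^{-\frac1n|\operatorname{Re}z|}<\infty$ for all $n\in\mathbb{N}$, $\alpha\in\mathfrak{A}$, topologised by these seminorms; $\mathcal{O}^{exp}(\overline{\mathbb{C}},E)$ is the case $K=\emptyset$; and $bv_K(E):=\mathcal{O}^{exp}(\overline{\mathbb{C}}\setminus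 K,E)/\mathcal{O}^{exp}(\overline{\mathbb{C}},E)$ with the quotient topology. $\mathcal{FO}_{[a,b]}(E)$ is the space of all $f\in\mathcal{O}(\mathbb{C},E)$ such that for all $k\in\mathbb{N}$, $\alpha\in\mathfrak{A}$ $$\sup_{z\in\mathbb{C}}p_\alpha(f(z))e^{-\frac1k|z|-H_{[a,b]}(\operatorname{Im}z)}<\infty,\qquad H_{[a,b]}(\eta):=\sup_{x\in[a,b]}x\eta=\max(a\eta,b\eta),$$ topologised by these seminorms. $\gamma_K$ is the path along the boundary of $U_{1/c}(K)$ with clockwise orientation, $c>0$ arbitrary. The integral is a Pettis integral; it does not depend on the choice of $c$ or of the representative $F$. *)

theory Defs
  imports
    "HOL-Complex_Analysis.Complex_Analysis"
    "HOL-Library.Function_Algebras"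
    "HOL-Library.Set_Algebras"
begin

section \<open>Topologies\<close>

definition seminorm_topology :: "'v::minus set \<Rightarrow> 'i set \<Rightarrow> ('i \<Rightarrow> 'v \<Rightarrow> real) \<Rightarrow> 'v topology" where
  "seminorm_topology X I q =
     topology_generated_by {{y \<in> X. q i (y - x) < \<epsilon>} | x i \<epsilon>. x \<in> X \<and> i \<in> I \<and> 0 < \<epsilon>}"

lemma topspace_seminorm_topology:
  assumes "I \<noteq> {}" and "\<And>x i. x \<in> X \<Longrightarrow> i \<in> I \<Longrightarrow> q i (x - x) = 0"
  shows "topspace (seminorm_topology X I q) = X"
proof
  obtain i where "i \<in> I" using assms(1) by blast
  show "X \<subseteq> topspace (seminorm_topology X I q)"
  proof
    fix x assume "x \<in> X"
    then have "x \<in> {y \<in> X. q i (y - x) < 1}" using assms(2) \<open>i \<in> I\<close> by simp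
    then show "x \<in> topspace (seminorm_topology X I q)"
      unfolding seminorm_topology_def topology_generated_by_topspace
      using \<open>x \<in> X\<close> \<open>i \<in> I\<close> zero_less_one[where 'a=real] by blast
  qed
qed (auto simp: seminorm_topology_def)

definition quotient_topology :: "'v topology \<Rightarrow> ('v \<Rightarrow> 'w) \<Rightarrow> 'w topology" where
  "quotient_topology X q =
     topology (\<lambda>U. U \<subseteq> q ` topspace X \<and> openin X {x \<in> topspace X. q x \<in> U})"

lemma openin_quotient_topology:
  "openin (quotient_topology X q) U \<longleftrightarrow>
     U \<subseteq> q ` topspace X \<and> openin X {x \<in> topspace X. q x \<in> U}"
proof -
  have "istopology (\<lambda>U. U \<subseteq> q ` topspace X \<and> openin X {x \<in> topspace X. q x \<in> U})"
    unfolding istopology_def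
  proof (intro conjI allI impI)
    fix S T
    assume S: "S \<subseteq> q ` topspace X \<and> openin X {x \<in> topspace X. q x \<in> S}"
      and T: "T \<subseteq> q ` topspace X \<and> openin X {x \<in> topspace X. q x \<in> T}"
    have "{x \<in> topspace X. q x \<in> S \<inter> T} =
        {x \<in> topspace X. q x \<in> S} \<inter> {x \<in> topspace X. q x \<in> T}" by auto
    then show "openin X {x \<in> topspace X. q x \<in> S \<inter> T}" using S T by (simp add: openin_Int)
    show "S \<inter> T \<subseteq> q ` topspace X" using S by blast
  next
    fix \<K>
    assume K: "\<forall>S\<in>\<K>. S \<subseteq> q ` topspace X \<and> openin X {x \<in> topspace X. q x \<in> S}"
    have "{x \<in> topspace X. q x \<in> \<Union>\<K>} = (\<Union>S\<in>\<K>. {x \<in> topspace X. q x \<in> S})" by auto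
    then show "openin X {x \<in> topspace X. q x \<in> \<Union>\<K>}" using K by auto
    show "\<Union>\<K> \<subseteq> q ` topspace X" using K by blast
  qed
  then show ?thesis by (simp add: quotient_topology_def topology_inverse')
qed

lemma quotient_map_quotient_topology: "quotient_map X (quotient_topology X q) q"
proof -
  have "{x \<in> topspace X. q x \<in> q ` topspace X} = topspace X" by auto
  then have "openin (quotient_topology X q) (q ` topspace X)"
    by (simp add: openin_quotient_topology)
  then have "topspace (quotient_topology X q) = q ` topspace X"
    by (meson openin_quotient_topology openin_subset openin_topspace subset_antisym)
  then show ?thesis by (auto simp: quotient_map_def openin_quotient_topology)
qed


section \<open>Locally convex spaces\<close>

text \<open>
  The seminorms are indexed by a whole type, which is an arbitrary nonempty index set
  because the type is arbitrary.
\<close>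

locale locally_convex_space = vector_space smul
  for smul :: "complex \<Rightarrow> 'e::ab_group_add \<Rightarrow> 'e" +
  fixes p :: "'i \<Rightarrow> 'e \<Rightarrow> real"
  assumes seminorm_triangle: "p \<alpha> (x + y) \<le> p \<alpha> x + p \<alpha> y"
    and seminorm_scale: "p \<alpha> (smul c x) = cmod c * p \<alpha> x"
    and directed: "\<exists>\<gamma> C. \<forall>x. max (p \<alpha> x) (p \<beta> x) \<le> C * p \<gamma> x"

abbreviation lc_topology :: "('i \<Rightarrow> 'e::ab_group_add \<Rightarrow> real) \<Rightarrow> 'e topology" where
  "lc_topology p \<equiv> seminorm_topology UNIV UNIV p"

definition disk :: "(complex \<Rightarrow> 'e::ab_group_add \<Rightarrow> 'e) \<Rightarrow> ('i \<Rightarrow> 'e \<Rightarrow> real) \<Rightarrow> 'e set \<Rightarrow> bool" where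
  "disk smul p D \<longleftrightarrow> D \<noteq> {} \<and> (\<forall>\<alpha>. bdd_above (p \<alpha> ` D)) \<and>
     (\<forall>x\<in>D. \<forall>y\<in>D. \<forall>s t. cmod s + cmod t \<le> 1 \<longrightarrow> smul s x + smul t y \<in> D)"

definition minkowski :: "(complex \<Rightarrow> 'e::ab_group_add \<Rightarrow> 'e) \<Rightarrow> 'e set \<Rightarrow> 'e \<Rightarrow> real" where
  "minkowski smul D x = Inf {t. 0 < t \<and> x \<in> smul (complex_of_real t) ` D}"

text \<open>
  The span of \<open>D\<close> with the Minkowski functional is a Banach space. For a disk the functional is
  always a seminorm on the span, so only definiteness and completeness have to be demanded.
\<close>

definition banach_disk ::
    "(complex \<Rightarrow> 'e::ab_group_add \<Rightarrow> 'e) \<Rightarrow> ('i \<Rightarrow> 'e \<Rightarrow> real) \<Rightarrow> 'e set \<Rightarrow> bool" where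
  "banach_disk smul p D \<longleftrightarrow> disk smul p D \<and>
     (\<forall>x\<in>module.span smul D. minkowski smul D x = 0 \<longrightarrow> x = 0) \<and>
     (\<forall>u::nat \<Rightarrow> 'e. range u \<subseteq> module.span smul D \<and>
        (\<forall>\<epsilon>>0. \<exists>N. \<forall>m\<ge>N. \<forall>n\<ge>N. minkowski smul D (u m - u n) < \<epsilon>) \<longrightarrow>
        (\<exists>l\<in>module.span smul D. (\<lambda>n. minkowski smul D (u n - l)) \<longlonglongrightarrow> 0))"

definition locally_complete ::
    "(complex \<Rightarrow> 'e::ab_group_add \<Rightarrow> 'e) \<Rightarrow> ('i \<Rightarrow> 'e \<Rightarrow> real) \<Rightarrow> bool" where
  "locally_complete smul p \<longleftrightarrow>
     (\<forall>D. disk smul p D \<and> closedin (lc_topology p) D \<longrightarrow> banach_disk smul p D)"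

definition lc_dual ::
    "(complex \<Rightarrow> 'e::ab_group_add \<Rightarrow> 'e) \<Rightarrow> ('i \<Rightarrow> 'e \<Rightarrow> real) \<Rightarrow> ('e \<Rightarrow> complex) set" where
  "lc_dual smul p =
     {\<phi>. Vector_Spaces.linear smul (*) \<phi> \<and> continuous_map (lc_topology p) euclidean \<phi>}"


section \<open>Pettis integrals\<close>

definition has_pettis_integral ::
    "(complex \<Rightarrow> 'e::ab_group_add \<Rightarrow> 'e) \<Rightarrow> ('i \<Rightarrow> 'e \<Rightarrow> real) \<Rightarrow>
     'x measure \<Rightarrow> ('x \<Rightarrow> 'e) \<Rightarrow> 'e \<Rightarrow> bool" where
  "has_pettis_integral smul p M f e \<longleftrightarrow>
     (\<forall>\<phi>\<in>lc_dual smul p. integrable M (\<lambda>t. \<phi> (f t)) \<and> \<phi> e = (LINT t|M. \<phi> (f t)))"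

definition has_pettis_contour_integral ::
    "(complex \<Rightarrow> 'e::ab_group_add \<Rightarrow> 'e) \<Rightarrow> ('i \<Rightarrow> 'e \<Rightarrow> real) \<Rightarrow>
     (real \<Rightarrow> complex) \<Rightarrow> (complex \<Rightarrow> 'e) \<Rightarrow> 'e \<Rightarrow> bool" where
  "has_pettis_contour_integral smul p g f e \<longleftrightarrow>
     has_pettis_integral smul p (lebesgue_on {0..1})
       (\<lambda>t. smul (vector_derivative g (at t within {0..1})) (f (g t))) e"


section \<open>Vector-valued holomorphic functions of infra-exponential growth\<close>

definition lc_holomorphic_on ::
    "(complex \<Rightarrow> 'e::ab_group_add \<Rightarrow> 'e) \<Rightarrow> ('i \<Rightarrow> 'e \<Rightarrow> real) \<Rightarrow>
     (complex \<Rightarrow> 'e) \<Rightarrow> complex set \<Rightarrow> bool" where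
  "lc_holomorphic_on smul p f \<Omega> \<longleftrightarrow>
     (\<forall>z\<in>\<Omega>. \<exists>l. limitin (lc_topology p) (\<lambda>h. smul (inverse h) (f (z + h) - f z)) l (at 0))"

text \<open>\<open>U_nbhd K c\<close> is $U_{1/c}(K)$; \<open>infdist z {} = 0\<close>, hence the case distinction.\<close>

definition U_nbhd :: "real set \<Rightarrow> real \<Rightarrow> complex set" where
  "U_nbhd K c = (if K = {} then {} else {z. infdist z (complex_of_real ` K) < c})"

definition S_strip :: "real set \<Rightarrow> nat \<Rightarrow> complex set" where
  "S_strip K n = (- closure (U_nbhd K (1 / real n))) \<inter> {z. \<bar>Im z\<bar> < real n}"

definition Oexp_weighted :: "('i \<Rightarrow> 'e \<Rightarrow> real) \<Rightarrow> (complex \<Rightarrow> 'e) \<Rightarrow> nat \<times> 'i \<Rightarrow> complex \<Rightarrow> real" where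
  "Oexp_weighted p f = (\<lambda>(n, \<alpha>) z. p \<alpha> (f z) * exp (- (1 / real n) * \<bar>Re z\<bar>))"

definition Oexp_seminorm ::
    "('i \<Rightarrow> 'e \<Rightarrow> real) \<Rightarrow> real set \<Rightarrow> nat \<times> 'i \<Rightarrow> (complex \<Rightarrow> 'e) \<Rightarrow> real" where
  "Oexp_seminorm p K i f = (SUP z\<in>S_strip K (fst i). Oexp_weighted p f i z)"

text \<open>
  A function on the complement of \<open>K\<close> is represented by its extension by zero to the whole
  plane, so that the vector space operations are the pointwise ones.
\<close>

definition Oexp ::
    "(complex \<Rightarrow> 'e::ab_group_add \<Rightarrow> 'e) \<Rightarrow> ('i \<Rightarrow> 'e \<Rightarrow> real) \<Rightarrow> real set \<Rightarrow> (complex \<Rightarrow> 'e) set" where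
  "Oexp smul p K =
     {f. (\<forall>z\<in>complex_of_real ` K. f z = 0) \<and>
         lc_holomorphic_on smul p f (- complex_of_real ` K) \<and>
         (\<forall>n\<ge>1. \<forall>\<alpha>. bdd_above (Oexp_weighted p f (n, \<alpha>) ` S_strip K n))}"

definition Oexp_topology ::
    "(complex \<Rightarrow> 'e::ab_group_add \<Rightarrow> 'e) \<Rightarrow> ('i \<Rightarrow> 'e \<Rightarrow> real) \<Rightarrow> real set \<Rightarrow>
     (complex \<Rightarrow> 'e) topology" where
  "Oexp_topology smul p K =
     seminorm_topology (Oexp smul p K) ({1..} \<times> UNIV) (Oexp_seminorm p K)"

text \<open>The entire functions, viewed inside \<open>Oexp smul p K\<close> by restriction.\<close>

definition Oexp_entire ::
    "(complex \<Rightarrow> 'e::ab_group_add \<Rightarrow> 'e) \<Rightarrow> ('i \<Rightarrow> 'e \<Rightarrow> real) \<Rightarrow> real set \<Rightarrow> (complex \<Rightarrow> 'e) set" where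
  "Oexp_entire smul p K =
     (\<lambda>f z. if z \<in> complex_of_real ` K then 0 else f z) ` Oexp smul p {}"

definition bv_class ::
    "(complex \<Rightarrow> 'e::ab_group_add \<Rightarrow> 'e) \<Rightarrow> ('i \<Rightarrow> 'e \<Rightarrow> real) \<Rightarrow> real set \<Rightarrow>
     (complex \<Rightarrow> 'e) \<Rightarrow> (complex \<Rightarrow> 'e) set" where
  "bv_class smul p K F = F +o Oexp_entire smul p K"

definition bv ::
    "(complex \<Rightarrow> 'e::ab_group_add \<Rightarrow> 'e) \<Rightarrow> ('i \<Rightarrow> 'e \<Rightarrow> real) \<Rightarrow> real set \<Rightarrow>
     (complex \<Rightarrow> 'e) set set" where
  "bv smul p K = bv_class smul p K ` Oexp smul p K"

definition bv_topology ::
    "(complex \<Rightarrow> 'e::ab_group_add \<Rightarrow> 'e) \<Rightarrow> ('i \<Rightarrow> 'e \<Rightarrow> real) \<Rightarrow> real set \<Rightarrow>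
     (complex \<Rightarrow> 'e) set topology" where
  "bv_topology smul p K = quotient_topology (Oexp_topology smul p K) (bv_class smul p K)"

text \<open>
  The sum of two cosets is their elementwise sum. For the scalar multiple the subspace is added
  again, which matters only for the scalar zero.
\<close>

definition bv_scale ::
    "(complex \<Rightarrow> 'e::ab_group_add \<Rightarrow> 'e) \<Rightarrow> ('i \<Rightarrow> 'e \<Rightarrow> real) \<Rightarrow> real set \<Rightarrow>
     complex \<Rightarrow> (complex \<Rightarrow> 'e) set \<Rightarrow> (complex \<Rightarrow> 'e) set" where
  "bv_scale smul p K c X = (\<lambda>F z. smul c (F z)) ` X + Oexp_entire smul p K"


section \<open>The space \<open>FO\<close> and the Fourier transform\<close>

definition H_fun :: "real \<Rightarrow> real \<Rightarrow> real \<Rightarrow> real" where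
  "H_fun a b \<eta> = (SUP x\<in>{a..b}. x * \<eta>)"

lemma H_fun_eq_max:
  assumes "a \<le> b"
  shows "H_fun a b \<eta> = max (a * \<eta>) (b * \<eta>)"
  unfolding H_fun_def
proof (rule cSup_eq_maximum)
  show "max (a * \<eta>) (b * \<eta>) \<in> (\<lambda>x. x * \<eta>) ` {a..b}" using assms by (auto simp: max_def)
  fix y assume "y \<in> (\<lambda>x. x * \<eta>) ` {a..b}"
  then obtain x where "a \<le> x" "x \<le> b" "y = x * \<eta>" by auto
  then show "y \<le> max (a * \<eta>) (b * \<eta>)"
    by (cases "0 \<le> \<eta>") (auto simp: le_max_iff_disj mult_right_mono mult_right_mono_neg)
qed

definition FO_weighted ::
    "('i \<Rightarrow> 'e \<Rightarrow> real) \<Rightarrow> real \<Rightarrow> real \<Rightarrow> (complex \<Rightarrow> 'e) \<Rightarrow> nat \<times> 'i \<Rightarrow> complex \<Rightarrow> real" where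
  "FO_weighted p a b f =
     (\<lambda>(k, \<alpha>) z. p \<alpha> (f z) * exp (- (1 / real k) * cmod z - H_fun a b (Im z)))"

definition FO_seminorm ::
    "('i \<Rightarrow> 'e \<Rightarrow> real) \<Rightarrow> real \<Rightarrow> real \<Rightarrow> nat \<times> 'i \<Rightarrow> (complex \<Rightarrow> 'e) \<Rightarrow> real" where
  "FO_seminorm p a b i f = (SUP z. FO_weighted p a b f i z)"

definition FO ::
    "(complex \<Rightarrow> 'e::ab_group_add \<Rightarrow> 'e) \<Rightarrow> ('i \<Rightarrow> 'e \<Rightarrow> real) \<Rightarrow> real \<Rightarrow> real \<Rightarrow>
     (complex \<Rightarrow> 'e) set" where
  "FO smul p a b =
     {f. lc_holomorphic_on smul p f UNIV \<and>
         (\<forall>k\<ge>1. \<forall>\<alpha>. bdd_above (range (FO_weighted p a b f (k, \<alpha>))))}"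

definition FO_topology ::
    "(complex \<Rightarrow> 'e::ab_group_add \<Rightarrow> 'e) \<Rightarrow> ('i \<Rightarrow> 'e \<Rightarrow> real) \<Rightarrow> real \<Rightarrow> real \<Rightarrow>
     (complex \<Rightarrow> 'e) topology" where
  "FO_topology smul p a b =
     seminorm_topology (FO smul p a b) ({1..} \<times> UNIV) (FO_seminorm p a b)"

text \<open>The boundary of $U_{1/c}([a,b])$, run through once clockwise from the point $a + ic$.\<close>

definition gamma_path :: "real \<Rightarrow> real \<Rightarrow> real \<Rightarrow> real \<Rightarrow> complex" where
  "gamma_path a b c =
     linepath (Complex a c) (Complex b c) +++
     part_circlepath (complex_of_real b) c (pi / 2) (- pi / 2) +++
     linepath (Complex b (- c)) (Complex a (- c)) +++
     part_circlepath (complex_of_real a) c (3 * pi / 2) (pi / 2)"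

definition has_fourier_value ::
    "(complex \<Rightarrow> 'e::ab_group_add \<Rightarrow> 'e) \<Rightarrow> ('i \<Rightarrow> 'e \<Rightarrow> real) \<Rightarrow> real \<Rightarrow> real \<Rightarrow> real \<Rightarrow>
     (complex \<Rightarrow> 'e) \<Rightarrow> complex \<Rightarrow> 'e \<Rightarrow> bool" where
  "has_fourier_value smul p a b c F \<zeta> e \<longleftrightarrow>
     has_pettis_contour_integral smul p (gamma_path a b c)
       (\<lambda>z. smul (exp (- \<i> * z * \<zeta>)) (F z)) e"

text \<open>The common value of the integrals for all representatives \<open>F\<close> of \<open>X\<close> and all radii \<open>c\<close>.\<close>

definition fourier ::
    "(complex \<Rightarrow> 'e::ab_group_add \<Rightarrow> 'e) \<Rightarrow> ('i \<Rightarrow> 'e \<Rightarrow> real) \<Rightarrow> real \<Rightarrow> real \<Rightarrow>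
     (complex \<Rightarrow> 'e) set \<Rightarrow> complex \<Rightarrow> 'e" where
  "fourier smul p a b X \<zeta> = (THE e. \<forall>F\<in>X. \<forall>c>0. has_fourier_value smul p a b c F \<zeta> e)"

definition bv_FO_topological_isomorphism ::
    "(complex \<Rightarrow> 'e::ab_group_add \<Rightarrow> 'e) \<Rightarrow> ('i \<Rightarrow> 'e \<Rightarrow> real) \<Rightarrow> real \<Rightarrow> real \<Rightarrow>
     ((complex \<Rightarrow> 'e) set \<Rightarrow> complex \<Rightarrow> 'e) \<Rightarrow> bool" where
  "bv_FO_topological_isomorphism smul p a b T \<longleftrightarrow>
     (\<forall>X\<in>bv smul p {a..b}. \<forall>Y\<in>bv smul p {a..b}. T (X + Y) = T X + T Y) \<and>
     (\<forall>c. \<forall>X\<in>bv smul p {a..b}. T (bv_scale smul p {a..b} c X) = (\<lambda>\<zeta>. smul c (T X \<zeta>))) \<and>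
     bij_betw T (bv smul p {a..b}) (FO smul p a b) \<and>
     homeomorphic_map (bv_topology smul p {a..b}) (FO_topology smul p a b) T"


section \<open>Underlying sets of the topologies\<close>

context locally_convex_space
begin

lemma seminorm_zero: "p \<alpha> 0 = 0"
  using seminorm_scale[of \<alpha> 0 0] by simp

lemma topspace_lc_topology: "topspace (lc_topology p) = UNIV"
  by (rule topspace_seminorm_topology) (auto simp: seminorm_zero)

lemma S_strip_nonempty:
  assumes "bounded K" "n \<ge> 1"
  shows "S_strip K n \<noteq> {}"
proof -
  have "bounded (closure (U_nbhd K (1 / real n)))"
  proof (cases "K = {}")
    case False
    obtain B where "\<forall>x\<in>K. \<bar>x\<bar> \<le> B"
      using assms(1) by (auto simp: bounded_iff)
    then have B: "\<And>w. w \<in> complex_of_real ` K \<Longrightarrow> cmod w \<le> B"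
      by auto
    have "cmod z \<le> B + 1 / real n" if z: "z \<in> U_nbhd K (1 / real n)" for z
    proof -
      have "infdist z (complex_of_real ` K) < 1 / real n" using z False by (simp add: U_nbhd_def)
      then obtain w where w: "w \<in> complex_of_real ` K" "dist z w < 1 / real n"
        using False by (auto simp: infdist_def cInf_less_iff)
      have "cmod z \<le> cmod w + dist z w" by (metis dist_norm norm_triangle_sub)
      then show ?thesis using B[OF w(1)] w(2) by linarith
    qed
    then show ?thesis by (intro bounded_closure) (auto simp: bounded_iff)
  qed (simp add: U_nbhd_def)
  then obtain B where B: "\<And>z. z \<in> closure (U_nbhd K (1 / real n)) \<Longrightarrow> cmod z \<le> B"
    by (auto simp: bounded_iff)
  have "complex_of_real (\<bar>B\<bar> + 1) \<notin> closure (U_nbhd K (1 / real n))"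
    using B[of "complex_of_real (\<bar>B\<bar> + 1)"] by (auto simp del: of_real_add)
  then have "complex_of_real (\<bar>B\<bar> + 1) \<in> S_strip K n"
    using assms(2) by (simp add: S_strip_def)
  then show ?thesis by blast
qed

lemma topspace_Oexp_topology:
  assumes "bounded K"
  shows "topspace (Oexp_topology smul p K) = Oexp smul p K"
  unfolding Oexp_topology_def
  by (rule topspace_seminorm_topology)
    (auto simp: Oexp_seminorm_def Oexp_weighted_def seminorm_zero S_strip_nonempty[OF assms])

lemma topspace_bv_topology:
  assumes "bounded K"
  shows "topspace (bv_topology smul p K) = bv smul p K"
  using quotient_map_quotient_topology[of "Oexp_topology smul p K" "bv_class smul p K"]
  by (simp add: quotient_map_def bv_topology_def bv_def topspace_Oexp_topology[OF assms])

lemma topspace_FO_topology: "topspace (FO_topology smul p a b) = FO smul p a b"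
  unfolding FO_topology_def
  by (rule topspace_seminorm_topology) (auto simp: FO_seminorm_def FO_weighted_def seminorm_zero)

end

end

theory Submission
  imports Defs
begin

text \<open>
  For \<open>f\<close> in \<open>FO\<close> the Laplace integral of \<open>f(\<zeta>) exp(i z \<zeta>)\<close> along a ray converges on the half plane that
  the direction of the ray separates from \<open>[a,b]\<close>. By Cauchy's theorem on triangles the integrals along
  different rays agree where both converge, so together they define a function that is holomorphic
  off \<open>[a,b]\<close> and bounded away from it; divided by \<open>2\<pi>\<close> this is the inverse of the Fourier transform,
  with explicit seminorm estimates in both directions. Conversely, if the Fourier transform of \<open>F\<close>
  vanishes, then so does the Cauchy integral of \<open>F\<close> over a small contour around \<open>[a,b]\<close>, and Cauchy's
  formula extends \<open>F\<close> to an entire function. Both arguments are scalar. They carry over to \<open>E\<close> because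
  the dual norms every seminorm (Hahn--Banach), and because local completeness supplies the limits of
  sequences that are Cauchy at a rate common to all seminorms: Riemann sums, difference quotients and
  truncated Laplace integrals.
\<close>

section \<open>Locally convex spaces and their duals\<close>

text \<open>The obstacle is that \<open>E\<close> need not be complete: a vector can only be
  obtained as the limit of a sequence that converges at a rate shared by all seminorms. This is why
  every scalar estimate below carries a constant that is uniform over the functionals dominated by a
  single \<open>p \<alpha>\<close>, together with a rate that does not depend on
  \<open>\<alpha>\<close>. The ray used at \<open>z\<close> points along i times the conjugate of z
  - y, where y is the point of the segment nearest to \<open>z\<close>. In this direction the kernel
  beats the indicator \<open>H_fun\<close> with exponent equal to the full distance of
  \<open>z\<close> from the segment, while the growth of \<open>f\<close> costs only an arbitrarily
  small part of it. The estimates lose indices accordingly: the inverse passes from n to 2n (half of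
  the distance 1/n is spent on growth), the Fourier transform from k to k + 1 (the contour of radius
  1/k must lie outside a closed neighbourhood of smaller radius). The factor 2 pi arises because the
  Laplace transform behaves like i f(0) / w for large w and the contour is run through clockwise.
  Injectivity rests on the differential equation A' = - i z A for the Fourier transform A of F(w) /
  (w - z).\<close>

context locally_convex_space begin

lemma p_minus: "p \<alpha> (- x) = p \<alpha> x"
  using seminorm_scale[of \<alpha> "-1" x] by simp

lemma p_nonneg: "0 \<le> p \<alpha> x"
  using seminorm_triangle[of \<alpha> x "-x"] by (simp add: p_minus seminorm_zero)

lemma p_diff_commute: "p \<alpha> (x - y) = p \<alpha> (y - x)"
  using p_minus[of \<alpha> "x - y"] by simp

lemma p_diff_triangle: "p \<alpha> (x - z) \<le> p \<alpha> (x - y) + p \<alpha> (y - z)"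
  using seminorm_triangle[of \<alpha> "x - y" "y - z"] by simp

lemma p_reverse_triangle: "\<bar>p \<alpha> x - p \<alpha> y\<bar> \<le> p \<alpha> (x - y)"
  using seminorm_triangle[of \<alpha> "x - y" y] seminorm_triangle[of \<alpha> "y - x" x]
  by (simp add: p_diff_commute[of \<alpha> y x])

text \<open>The balls are given only as a subbase. Directedness puts a ball of one seminorm inside
  the intersection of two balls with common centre, so single-seminorm balls already form
  neighbourhood bases.\<close>

lemma openin_lc_topology:
  "openin (lc_topology p) U \<longleftrightarrow> (\<forall>x\<in>U. \<exists>\<alpha> \<epsilon>. 0 < \<epsilon> \<and> {y. p \<alpha> (y - x) < \<epsilon>} \<subseteq> U)"
proof
  assume "openin (lc_topology p) U"
  then have "generate_topology_on {{y \<in> UNIV. p i (y - x) < \<epsilon>} | x i \<epsilon>. x \<in> UNIV \<and> i \<in> UNIV \<and> 0 < \<epsilon>} U"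
    by (simp add: seminorm_topology_def openin_topology_generated_by_iff)
  then show "\<forall>x\<in>U. \<exists>\<alpha> \<epsilon>. 0 < \<epsilon> \<and> {y. p \<alpha> (y - x) < \<epsilon>} \<subseteq> U"
  proof induction
    case Empty then show ?case by simp
  next
    case (Int S T)
    show ?case
    proof
      fix x assume "x \<in> S \<inter> T"
      then obtain \<alpha> \<epsilon> \<beta> \<delta> where 1: "0 < \<epsilon>" "{y. p \<alpha> (y - x) < \<epsilon>} \<subseteq> S" "0 < \<delta>" "{y. p \<beta> (y - x) < \<delta>} \<subseteq> T"
        using Int by blast
      obtain \<gamma> C where C: "\<And>x. max (p \<alpha> x) (p \<beta> x) \<le> C * p \<gamma> x" using directed by blast
      \<comment> \<open>Directedness says nothing about the sign of \<open>C\<close>. Enlarging it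
        to at least 1 keeps the inequality, as seminorms are nonnegative, and allows
        division.\<close>
      define D where "D = max C 1"
      have D: "max (p \<alpha> x) (p \<beta> x) \<le> D * p \<gamma> x" for x
        using C[of x] mult_right_mono[of C D "p \<gamma> x"] p_nonneg by (fastforce simp: D_def)
      have "D > 0" by (simp add: D_def)
      have "{y. p \<gamma> (y - x) < min \<epsilon> \<delta> / D} \<subseteq> S \<inter> T"
      proof
        fix y assume "y \<in> {y. p \<gamma> (y - x) < min \<epsilon> \<delta> / D}"
        then have "D * p \<gamma> (y - x) < min \<epsilon> \<delta>" using \<open>D > 0\<close> by (simp add: field_simps)
        with D[of "y - x"] have "p \<alpha> (y - x) < \<epsilon>" "p \<beta> (y - x) < \<delta>" by linarith+
        then show "y \<in> S \<inter> T" using 1 by blast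
      qed
      moreover have "0 < min \<epsilon> \<delta> / D" using 1 \<open>D > 0\<close> by simp
      ultimately show "\<exists>\<alpha> \<epsilon>. 0 < \<epsilon> \<and> {y. p \<alpha> (y - x) < \<epsilon>} \<subseteq> S \<inter> T" by blast
    qed
  next
    case (UN K) then show ?case by (meson UnionE Union_upper order_trans)
  next
    case (Basis S)
    then obtain x i \<epsilon> where S: "S = {y. p i (y - x) < \<epsilon>}" "0 < \<epsilon>" by auto
    show ?case
    proof
      fix y assume y: "y \<in> S"
      have "{z. p i (z - y) < \<epsilon> - p i (y - x)} \<subseteq> S"
        using S p_diff_triangle[of i _ x y] by (smt (verit) mem_Collect_eq subsetI)
      moreover have "0 < \<epsilon> - p i (y - x)" using y S by simp
      ultimately show "\<exists>\<alpha> \<epsilon>. 0 < \<epsilon> \<and> {z. p \<alpha> (z - y) < \<epsilon>} \<subseteq> S" by blast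
    qed
  qed
next
  assume *: "\<forall>x\<in>U. \<exists>\<alpha> \<epsilon>. 0 < \<epsilon> \<and> {y. p \<alpha> (y - x) < \<epsilon>} \<subseteq> U"
  let ?B = "{{y \<in> UNIV. p i (y - x) < \<epsilon>} | x i \<epsilon>. x \<in> UNIV \<and> i \<in> UNIV \<and> 0 < \<epsilon>}"
  have "U = \<Union>{S \<in> ?B. S \<subseteq> U}"
  proof
    show "U \<subseteq> \<Union>{S \<in> ?B. S \<subseteq> U}"
    proof
      fix x assume "x \<in> U"
      then obtain \<alpha> \<epsilon> where "0 < \<epsilon>" "{y. p \<alpha> (y - x) < \<epsilon>} \<subseteq> U" using * by blast
      moreover have "x \<in> {y. p \<alpha> (y - x) < \<epsilon>}" using \<open>0 < \<epsilon>\<close> by (simp add: seminorm_zero)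
      moreover have "{y. p \<alpha> (y - x) < \<epsilon>} \<in> ?B" using \<open>0 < \<epsilon>\<close> by auto
      ultimately show "x \<in> \<Union>{S \<in> ?B. S \<subseteq> U}" by blast
    qed
  qed blast
  moreover have "openin (lc_topology p) (\<Union>{S \<in> ?B. S \<subseteq> U})"
    unfolding seminorm_topology_def
    by (intro openin_Union) (auto intro: topology_generated_by_Basis)
  ultimately show "openin (lc_topology p) U" by simp
qed

lemma openin_lc_ball: "openin (lc_topology p) {y. p \<alpha> (y - x) < \<epsilon>}"
proof (cases "0 < \<epsilon>")
  case True
  then show ?thesis unfolding seminorm_topology_def
    by (intro topology_generated_by_Basis) auto
next
  case False
  then have "{y. p \<alpha> (y - x) < \<epsilon>} = {}" using p_nonneg[of \<alpha>] by (smt (verit) Collect_empty_eq)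
  then show ?thesis by simp
qed

lemma limitin_lc_topology:
  "limitin (lc_topology p) f l F \<longleftrightarrow> (\<forall>\<alpha>. ((\<lambda>h. p \<alpha> (f h - l)) \<longlongrightarrow> 0) F)"
proof
  assume L: "limitin (lc_topology p) f l F"
  show "\<forall>\<alpha>. ((\<lambda>h. p \<alpha> (f h - l)) \<longlongrightarrow> 0) F"
  proof
    fix \<alpha>
    show "((\<lambda>h. p \<alpha> (f h - l)) \<longlongrightarrow> 0) F"
    proof (rule tendstoI)
      fix e :: real assume "0 < e"
      then have "\<forall>\<^sub>F h in F. f h \<in> {y. p \<alpha> (y - l) < e}"
        using L openin_lc_ball[of \<alpha> l e] unfolding limitin_def by (auto simp: seminorm_zero)
      then show "\<forall>\<^sub>F h in F. dist (p \<alpha> (f h - l)) 0 < e"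
        by eventually_elim (auto simp: p_nonneg)
    qed
  qed
next
  assume L: "\<forall>\<alpha>. ((\<lambda>h. p \<alpha> (f h - l)) \<longlongrightarrow> 0) F"
  show "limitin (lc_topology p) f l F"
    unfolding limitin_def topspace_lc_topology
  proof (intro conjI allI impI)
    fix U assume U: "openin (lc_topology p) U \<and> l \<in> U"
    then obtain \<alpha> \<epsilon> where 1: "0 < \<epsilon>" "{y. p \<alpha> (y - l) < \<epsilon>} \<subseteq> U"
      unfolding openin_lc_topology by blast
    have "\<forall>\<^sub>F h in F. p \<alpha> (f h - l) < \<epsilon>"
      using L \<open>0 < \<epsilon>\<close> order_tendstoD(2) by blast
    then show "\<forall>\<^sub>F h in F. f h \<in> U" by eventually_elim (use 1 in blast)
  qed simp
qed

text \<open>Continuity at zero bounds the functional on the ball of one seminorm, and homogeneity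
  spreads this bound to the whole space. This is the only access to continuity used later.\<close>

lemma lc_dual_iff:
  "\<phi> \<in> lc_dual smul p \<longleftrightarrow> Vector_Spaces.linear smul (*) \<phi> \<and> (\<exists>\<alpha> C. \<forall>x. cmod (\<phi> x) \<le> C * p \<alpha> x)"
proof (cases "Vector_Spaces.linear smul (*) \<phi>")
  case True
  then interpret L: Vector_Spaces.linear smul "(*)" \<phi> .
  have "continuous_map (lc_topology p) euclidean \<phi> \<longleftrightarrow> (\<exists>\<alpha> C. \<forall>x. cmod (\<phi> x) \<le> C * p \<alpha> x)"
  proof
    assume "continuous_map (lc_topology p) euclidean \<phi>"
    then have "openin (lc_topology p) {x \<in> topspace (lc_topology p). \<phi> x \<in> ball 0 1}"
      by (rule openin_continuous_map_preimage) simp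
    then have "openin (lc_topology p) {x. cmod (\<phi> x) < 1}"
      by (simp add: topspace_lc_topology)
    moreover have "0 \<in> {x. cmod (\<phi> x) < 1}" by (simp add: L.zero)
    ultimately obtain \<alpha> \<epsilon> where 1: "0 < \<epsilon>" "{y. p \<alpha> (y - 0) < \<epsilon>} \<subseteq> {x. cmod (\<phi> x) < 1}"
      unfolding openin_lc_topology by blast
    have "cmod (\<phi> x) \<le> (2 / \<epsilon>) * p \<alpha> x" for x
    proof (rule ccontr)
      assume n: "\<not> cmod (\<phi> x) \<le> (2 / \<epsilon>) * p \<alpha> x"
      have "cmod (\<phi> x) > 0" using n p_nonneg[of \<alpha> x] 1(1) by (smt (verit) divide_nonneg_pos mult_nonneg_nonneg norm_ge_zero)
      \<comment> \<open>A violating \<open>x\<close> is rescaled so that the functional has modulus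
        exactly 1 there, although \<open>y\<close> lies in the ball on which the modulus is below
        1.\<close>
      define y where "y = smul (inverse (complex_of_real (cmod (\<phi> x)))) x"
      have "cmod (\<phi> y) = 1" using \<open>cmod (\<phi> x) > 0\<close> by (simp add: y_def L.scale norm_mult norm_inverse)
      have "p \<alpha> y = p \<alpha> x / cmod (\<phi> x)" by (simp add: y_def seminorm_scale norm_inverse divide_inverse)
      also have "\<dots> < \<epsilon>" using n \<open>cmod (\<phi> x) > 0\<close> 1(1) p_nonneg[of \<alpha> x] by (simp add: field_simps)
      finally have "y \<in> {x. cmod (\<phi> x) < 1}" using 1(2) by auto
      then show False using \<open>cmod (\<phi> y) = 1\<close> by simp
    qed
    then show "\<exists>\<alpha> C. \<forall>x. cmod (\<phi> x) \<le> C * p \<alpha> x" by blast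
  next
    assume "\<exists>\<alpha> C. \<forall>x. cmod (\<phi> x) \<le> C * p \<alpha> x"
    then obtain \<alpha> C where C: "\<And>x. cmod (\<phi> x) \<le> C * p \<alpha> x" by blast
    define D where "D = max C 1"
    have D: "cmod (\<phi> x) \<le> D * p \<alpha> x" "D > 0" for x
      using C[of x] mult_right_mono[of C D "p \<alpha> x"] p_nonneg[of \<alpha> x] by (auto simp: D_def)
    show "continuous_map (lc_topology p) euclidean \<phi>"
      unfolding continuous_map_def
    proof (intro conjI allI impI)
      fix U :: "complex set" assume "openin euclidean U"
      then have "open U" by simp
      show "openin (lc_topology p) {x \<in> topspace (lc_topology p). \<phi> x \<in> U}"
        unfolding openin_lc_topology topspace_lc_topology
      proof
        fix x assume "x \<in> {x \<in> UNIV. \<phi> x \<in> U}"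
        then obtain e where e: "e > 0" "ball (\<phi> x) e \<subseteq> U" using \<open>open U\<close> by (auto elim: openE)
        have "{y. p \<alpha> (y - x) < e / D} \<subseteq> {x \<in> UNIV. \<phi> x \<in> U}"
        proof
          fix y assume "y \<in> {y. p \<alpha> (y - x) < e / D}"
          then have "D * p \<alpha> (y - x) < e" using D(2) by (simp add: field_simps)
          then have "cmod (\<phi> (y - x)) < e" using D(1)[of "y - x"] by linarith
          then have "\<phi> y \<in> ball (\<phi> x) e" by (simp add: L.diff dist_norm norm_minus_commute)
          then show "y \<in> {x \<in> UNIV. \<phi> x \<in> U}" using e by blast
        qed
        then show "\<exists>\<alpha> \<epsilon>. 0 < \<epsilon> \<and> {y. p \<alpha> (y - x) < \<epsilon>} \<subseteq> {x \<in> UNIV. \<phi> x \<in> U}"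
          using e(1) D(2) by (meson divide_pos_pos)
      qed
    qed auto
  qed
  then show ?thesis using True by (simp add: lc_dual_def)
qed (simp add: lc_dual_def)

lemma lc_dual_linear:
  assumes "\<phi> \<in> lc_dual smul p"
  shows lc_dual_add: "\<phi> (x + y) = \<phi> x + \<phi> y"
    and lc_dual_diff: "\<phi> (x - y) = \<phi> x - \<phi> y"
    and lc_dual_scale: "\<phi> (smul c x) = c * \<phi> x"
    and lc_dual_zero: "\<phi> 0 = 0"
    and lc_dual_sum: "\<phi> (sum f I) = (\<Sum>i\<in>I. \<phi> (f i))"
proof -
  interpret L: Vector_Spaces.linear smul "(*)" \<phi> using assms by (simp add: lc_dual_def)
  show "\<phi> (x + y) = \<phi> x + \<phi> y" "\<phi> (x - y) = \<phi> x - \<phi> y" "\<phi> (smul c x) = c * \<phi> x" "\<phi> 0 = 0"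
    "\<phi> (sum f I) = (\<Sum>i\<in>I. \<phi> (f i))"
    by (simp_all add: L.add L.diff L.scale L.zero L.sum)
qed

lemma lc_dual_bounded:
  assumes "\<phi> \<in> lc_dual smul p"
  obtains \<alpha> C where "C > 0" "\<And>x. cmod (\<phi> x) \<le> C * p \<alpha> x"
proof -
  obtain \<alpha> C where C: "\<And>x. cmod (\<phi> x) \<le> C * p \<alpha> x" using assms by (auto simp: lc_dual_iff)
  have "cmod (\<phi> x) \<le> max C 1 * p \<alpha> x" for x
    using C[of x] mult_right_mono[of C "max C 1" "p \<alpha> x"] p_nonneg[of \<alpha> x] by auto
  then show thesis using that[of "max C 1" \<alpha>] by auto
qed

end

section \<open>The Hahn--Banach theorem\<close>

context locally_convex_space begin

text \<open>Homogeneity is asked as an inequality and for nonnegative real scalars only, which is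
  easy to check for infima. Equality follows by applying the inequality once more with the inverse
  scalar.\<close>

definition sublinear :: "('e \<Rightarrow> real) \<Rightarrow> bool" where
  "sublinear r \<longleftrightarrow> (\<forall>x y. r (x + y) \<le> r x + r y) \<and> (\<forall>t x. 0 \<le> t \<longrightarrow> r (smul (complex_of_real t) x) \<le> t * r x)"

lemma sublinear_add: "sublinear r \<Longrightarrow> r (x + y) \<le> r x + r y"
  by (simp add: sublinear_def)

lemma sublinear_0: "sublinear r \<Longrightarrow> r 0 = 0"
  unfolding sublinear_def by (metis add.right_neutral add_le_cancel_left mult_zero_left order.refl order_antisym scale_zero_left of_real_0)

lemma sublinear_scale:
  assumes "sublinear r" "0 \<le> t"
  shows "r (smul (complex_of_real t) x) = t * r x"
proof (cases "t = 0")
  case False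
  have "r (smul (complex_of_real (inverse t)) (smul (complex_of_real t) x)) \<le> inverse t * r (smul (complex_of_real t) x)"
    using assms unfolding sublinear_def by (meson inverse_nonnegative_iff_nonnegative)
  also have "smul (complex_of_real (inverse t)) (smul (complex_of_real t) x) = x"
    using False by (simp flip: of_real_mult)
  finally have "t * r x \<le> r (smul (complex_of_real t) x)" using False assms(2) by (simp add: field_simps)
  then show ?thesis using assms unfolding sublinear_def by (meson order_antisym)
qed (use assms sublinear_0 in auto)

text \<open>The shift lowers \<open>r\<close> along \<open>y\<close>: with t = 1 it is at most - r y
  at - y. A functional that coincides with all its shifts is therefore additive, which is how
  minimality is exploited below.\<close>

lemma sublinear_shift:
  fixes y :: 'e
  assumes r: "sublinear r"
  defines "r' \<equiv> \<lambda>x. INF t\<in>{0..}. r (x + smul (complex_of_real t) y) - t * r y"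
  shows "sublinear r'" "0 \<le> t \<Longrightarrow> r' x \<le> r (x + smul (complex_of_real t) y) - t * r y"
proof -
  \<comment> \<open>A lower bound independent of \<open>t\<close>, so that the infimum is
    finite.\<close>
  have low: "- r (- x) \<le> r (x + smul (complex_of_real t) y) - t * r y" if "0 \<le> t" for t x
  proof -
    have "t * r y = r ((x + smul (complex_of_real t) y) + (- x))" using sublinear_scale[OF r that] by simp
    also have "\<dots> \<le> r (x + smul (complex_of_real t) y) + r (- x)" using r by (rule sublinear_add)
    finally show ?thesis by simp
  qed
  then have bdd: "bdd_below ((\<lambda>t. r (x + smul (complex_of_real t) y) - t * r y) ` {0..})" for x
    by (intro bdd_belowI[of _ "- r (- x)"]) auto
  have le: "r' x \<le> r (x + smul (complex_of_real t) y) - t * r y" if "0 \<le> t" for t x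
    unfolding r'_def by (rule cINF_lower[OF bdd]) (use that in auto)
  then show "0 \<le> t \<Longrightarrow> r' x \<le> r (x + smul (complex_of_real t) y) - t * r y" .
  have greatest: "c \<le> r' x" if "\<And>t. 0 \<le> t \<Longrightarrow> c \<le> r (x + smul (complex_of_real t) y) - t * r y" for c x
    unfolding r'_def by (rule cINF_greatest) (use that in auto)
  have "r' (x1 + x2) \<le> r' x1 + r' x2" for x1 x2
  proof -
    \<comment> \<open>The parameter s + t is admissible for x1 + x2; afterwards the infimum is taken
      over \<open>s\<close> and \<open>t\<close> one at a time.\<close>
    have "r' (x1 + x2) - (r (x2 + smul (complex_of_real t) y) - t * r y) \<le> r (x1 + smul (complex_of_real s) y) - s * r y"
      if "0 \<le> s" "0 \<le> t" for s t
    proof -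
      have "r' (x1 + x2) \<le> r ((x1 + x2) + smul (complex_of_real (s + t)) y) - (s + t) * r y"
        using that by (intro le) auto
      also have "(x1 + x2) + smul (complex_of_real (s + t)) y = (x1 + smul (complex_of_real s) y) + (x2 + smul (complex_of_real t) y)"
        by (simp add: scale_left_distrib algebra_simps)
      finally show ?thesis using sublinear_add[OF r] by (smt (verit) distrib_right)
    qed
    then have "r' (x1 + x2) - (r (x2 + smul (complex_of_real t) y) - t * r y) \<le> r' x1" if "0 \<le> t" for t
      using that by (intro greatest) auto
    then have "r' (x1 + x2) - r' x1 \<le> r' x2" by (intro greatest) (smt (verit))
    then show ?thesis by simp
  qed
  moreover have "r' (smul (complex_of_real c) x) \<le> c * r' x" if "0 \<le> c" for c x
  proof (cases "c = 0")
    case True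
    have "r' 0 \<le> 0" using le[of 0 0] sublinear_0[OF r] by simp
    then show ?thesis using True by simp
  next
    case False
    have "r' (smul (complex_of_real c) x) / c \<le> r (x + smul (complex_of_real s) y) - s * r y" if "0 \<le> s" for s
    proof -
      have "r' (smul (complex_of_real c) x) \<le> r (smul (complex_of_real c) x + smul (complex_of_real (c * s)) y) - (c * s) * r y"
        using that \<open>0 \<le> c\<close> by (intro le) auto
      also have "smul (complex_of_real c) x + smul (complex_of_real (c * s)) y = smul (complex_of_real c) (x + smul (complex_of_real s) y)"
        by (simp add: scale_right_distrib)
      also have "r (smul (complex_of_real c) (x + smul (complex_of_real s) y)) = c * r (x + smul (complex_of_real s) y)"
        by (rule sublinear_scale[OF r \<open>0 \<le> c\<close>])
      finally show ?thesis using False \<open>0 \<le> c\<close> by (simp add: field_simps)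
    qed
    then have "r' (smul (complex_of_real c) x) / c \<le> r' x" by (rule greatest)
    then show ?thesis using False \<open>0 \<le> c\<close> by (simp add: field_simps)
  qed
  ultimately show "sublinear r'" by (simp add: sublinear_def)
qed

text \<open>Zorn's lemma applied downwards. A chain has its pointwise infimum as lower bound; it
  stays finite because sublinearity forces f x to be at least - f (- x).\<close>

lemma exists_minimal_sublinear:
  assumes q: "sublinear q"
  shows "\<exists>r. sublinear r \<and> (\<forall>x. r x \<le> q x) \<and> (\<forall>s. sublinear s \<longrightarrow> (\<forall>x. s x \<le> r x) \<longrightarrow> s = r)"
proof -
  define A where "A = {r. sublinear r \<and> (\<forall>x. r x \<le> q x)}"
  \<comment> \<open>The order is reversed, so that a maximal element for \<open>P\<close> is a
    minimal functional.\<close>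
  define P :: "('e \<Rightarrow> real) \<Rightarrow> ('e \<Rightarrow> real) \<Rightarrow> bool" where "P = (\<lambda>f g. \<forall>x. g x \<le> f x)"
  have "\<exists>m\<in>A. \<forall>a\<in>A. P m a \<longrightarrow> a = m"
  proof (rule predicate_Zorn)
    show "partial_order_on A (relation_of P A)"
      by (rule partial_order_on_relation_ofI) (auto simp: P_def fun_eq_iff intro: order_trans order_antisym)
    fix C assume C: "C \<in> Chains (relation_of P A)"
    have CA: "C \<subseteq> A" and ch: "\<And>f g. f \<in> C \<Longrightarrow> g \<in> C \<Longrightarrow> P f g \<or> P g f"
      using C by (auto simp: Chains_def relation_of_def)
    show "\<exists>u\<in>A. \<forall>a\<in>C. P a u"
    proof (cases "C = {}")
      case True then show ?thesis using q by (auto simp: A_def)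
    next
      case False
      have "- q (- x) \<le> f x" if "f \<in> C" for f x
      proof -
        have f: "sublinear f" "f (- x) \<le> q (- x)" using that CA by (auto simp: A_def)
        have "0 \<le> f x + f (- x)" using sublinear_add[OF f(1), of x "- x"] sublinear_0[OF f(1)] by simp
        then show ?thesis using f(2) by linarith
      qed
      then have bdd: "bdd_below ((\<lambda>f. f x) ` C)" for x by (intro bdd_belowI[of _ "- q (- x)"]) auto
      define u where "u x = (INF f\<in>C. f x)" for x
      have le: "u x \<le> f x" if "f \<in> C" for f x unfolding u_def by (rule cINF_lower[OF bdd that])
      have greatest: "c \<le> u x" if "\<And>f. f \<in> C \<Longrightarrow> c \<le> f x" for c x
        unfolding u_def by (rule cINF_greatest) (use that False in auto)
      have "u (x + y) \<le> u x + u y" for x y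
      proof -
        have "u (x + y) - g y \<le> f x" if fg: "f \<in> C" "g \<in> C" for f g
        proof -
          \<comment> \<open>Of two members of the chain the smaller one serves both arguments, and
            it is itself subadditive.\<close>
          obtain h where "h \<in> C" "h x \<le> f x" "h y \<le> g y" using ch[OF fg] fg unfolding P_def by blast
          moreover have "h (x + y) \<le> h x + h y" using \<open>h \<in> C\<close> CA by (auto simp: A_def sublinear_def)
          ultimately show ?thesis using le[OF \<open>h \<in> C\<close>, of "x + y"] by linarith
        qed
        then have "u (x + y) - g y \<le> u x" if "g \<in> C" for g using that by (intro greatest)
        then have "u (x + y) - u x \<le> u y" by (intro greatest) (smt (verit))
        then show ?thesis by simp
      qed
      moreover have "u (smul (complex_of_real t) x) \<le> t * u x" if "0 \<le> t" for t x
      proof -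
        have *: "u (smul (complex_of_real t) x) \<le> t * f x" if "f \<in> C" for f
          using le[OF that, of "smul (complex_of_real t) x"] that CA \<open>0 \<le> t\<close> sublinear_scale[of f t x]
          by (auto simp: A_def)
        show ?thesis
        proof (cases "t = 0")
          case True
          then show ?thesis using * False by auto
        next
          case False
          then have "u (smul (complex_of_real t) x) / t \<le> u x" using * \<open>0 \<le> t\<close>
            by (intro greatest) (simp add: field_simps)
          then show ?thesis using False \<open>0 \<le> t\<close> by (simp add: field_simps)
        qed
      qed
      ultimately have "sublinear u" by (simp add: sublinear_def)
      moreover have "u x \<le> q x" for x using False le CA by (force simp: A_def intro: order_trans)
      ultimately show ?thesis using le by (auto simp: A_def P_def)
    qed
  qed
  then obtain m where m: "m \<in> A" "\<And>a. a \<in> A \<Longrightarrow> P m a \<Longrightarrow> a = m" by blast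
  have "s = m" if "sublinear s" "\<forall>x. s x \<le> m x" for s
    using m(2)[of s] that m(1) unfolding A_def P_def by (force intro: order_trans)
  then show ?thesis using m(1) unfolding A_def by blast
qed

text \<open>A minimal sublinear functional is linear, since it coincides with all of its shifts.\<close>

lemma real_hahn_banach:
  assumes q: "sublinear q"
  obtains g where "\<And>x y. g (x + y) = g x + g y" "\<And>t x. g (smul (complex_of_real t) x) = t * g x"
    "\<And>x. g x \<le> q x" "g x0 = q x0"
proof -
  \<comment> \<open>Shifting along \<open>x0\<close> before minimising forces the value at
    \<open>x0\<close>: every linear functional below \<open>q'\<close> is at most - q x0 at -
    x0.\<close>
  define q' where "q' x = (INF t\<in>{0..}. q (x + smul (complex_of_real t) x0) - t * q x0)" for x
  have q': "sublinear q'" "\<And>t x. 0 \<le> t \<Longrightarrow> q' x \<le> q (x + smul (complex_of_real t) x0) - t * q x0"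
    unfolding q'_def using sublinear_shift[OF q, where y = x0] by auto
  obtain g where g: "sublinear g" "\<And>x. g x \<le> q' x"
    and min: "\<And>s. sublinear s \<Longrightarrow> (\<And>x. s x \<le> g x) \<Longrightarrow> s = g"
    using exists_minimal_sublinear[OF q'(1)] by blast
  have "g x + g y \<le> g (x + y)" for x y
  proof -
    define g' where "g' x = (INF t\<in>{0..}. g (x + smul (complex_of_real t) y) - t * g y)" for x
    have g': "sublinear g'" "\<And>t x. 0 \<le> t \<Longrightarrow> g' x \<le> g (x + smul (complex_of_real t) y) - t * g y"
      unfolding g'_def using sublinear_shift[OF g(1), where y = y] by auto
    \<comment> \<open>The parameter t = 0 puts the shift below \<open>g\<close>, so minimality gives
      equality; the parameter t = 1 then reads as superadditivity.\<close>
    have "g' = g" using g'(2)[of 0] by (intro min g'(1)) simp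
    then show ?thesis using g'(2)[of 1 x] by simp
  qed
  then have add: "g (x + y) = g x + g y" for x y using sublinear_add[OF g(1)] by (meson order_antisym)
  have neg: "g (- x) = - g x" for x using add[of x "- x"] sublinear_0[OF g(1)] by simp
  have scale: "g (smul (complex_of_real t) x) = t * g x" for t x
  proof (cases "0 \<le> t")
    case False
    then have "g (smul (complex_of_real (- t)) x) = - t * g x" by (intro sublinear_scale[OF g(1)]) auto
    then show ?thesis using neg[of "smul (complex_of_real t) x"] by simp
  qed (rule sublinear_scale[OF g(1)])
  have le: "g x \<le> q x" for x using g(2)[of x] q'(2)[of 0 x] by simp
  have "g (- x0) \<le> - q x0" using g(2)[of "- x0"] q'(2)[of 1 "- x0"] sublinear_0[OF q] by simp
  then have "g x0 = q x0" using neg[of x0] le[of x0] by linarith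
  with add scale le show thesis by (rule that)
qed

lemma hahn_banach:
  obtains \<phi> where "\<phi> \<in> lc_dual smul p" "\<And>x. cmod (\<phi> x) \<le> p \<alpha> x" "\<phi> x0 = complex_of_real (p \<alpha> x0)"
proof -
  have "sublinear (p \<alpha>)" by (simp add: sublinear_def seminorm_triangle seminorm_scale)
  then obtain g where g: "\<And>x y. g (x + y) = g x + g y" "\<And>t x. g (smul (complex_of_real t) x) = t * g x"
    "\<And>x. g x \<le> p \<alpha> x" "g x0 = p \<alpha> x0"
    using real_hahn_banach by blast
  \<comment> \<open>A complex linear functional is determined by its real part \<open>g\<close> as g
    x - i g (i x).\<close>
  define \<phi> where "\<phi> x = Complex (g x) (- g (smul \<i> x))" for x
  have add: "\<phi> (x + y) = \<phi> x + \<phi> y" for x y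
    by (simp add: \<phi>_def scale_right_distrib g(1) complex_eq_iff)
  have scale: "\<phi> (smul c x) = c * \<phi> x" for c x
  proof -
    have neg: "g (- y) = - g y" for y using g(2)[of "-1" y] by simp
    have s: "smul c x = smul (of_real (Re c)) x + smul (of_real (Im c)) (smul \<i> x)"
      by (subst complex_eq) (simp add: scale_left_distrib mult.commute)
    have t: "smul \<i> (smul c x) = smul (of_real (Re c)) (smul \<i> x) + smul (of_real (- Im c)) x"
    proof -
      have "\<i> * c = of_real (Re c) * \<i> + of_real (- Im c)" by (simp add: complex_eq_iff)
      then show ?thesis by (simp add: scale_left_distrib flip: scale_scale)
        (metis scale_left_distrib scale_minus_left scale_scale uminus_add_conv_diff diff_conv_add_uminus)
    qed
    have "g (smul c x) = Re c * g x + Im c * g (smul \<i> x)" by (subst s) (simp only: g)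
    moreover have "g (smul \<i> (smul c x)) = Re c * g (smul \<i> x) - Im c * g x" by (subst t) (simp only: g)
    ultimately show ?thesis by (simp add: \<phi>_def complex_eq_iff)
  qed
  have bound: "cmod (\<phi> x) \<le> p \<alpha> x" for x
  proof (cases "\<phi> x = 0")
    case False
    \<comment> \<open>Rotating \<open>x\<close> makes the value of the functional real and
      nonnegative, where it is the value of \<open>g\<close>.\<close>
    define c where "c = cnj (\<phi> x) / of_real (cmod (\<phi> x))"
    have "cmod c = 1" using False by (simp add: c_def norm_divide)
    have "\<phi> (smul c x) = of_real (cmod (\<phi> x))"
      using False by (simp add: scale c_def complex_norm_square[symmetric] mult.commute power2_eq_square)
    then have "cmod (\<phi> x) = g (smul c x)" by (simp add: \<phi>_def complex_eq_iff)
    also have "\<dots> \<le> p \<alpha> x" using g(3)[of "smul c x"] \<open>cmod c = 1\<close> by (simp add: seminorm_scale)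
    finally show ?thesis .
  qed (simp add: p_nonneg)
  have lin: "Vector_Spaces.linear smul (*) \<phi>"
    by unfold_locales (simp_all add: add scale algebra_simps)
  have "\<phi> \<in> lc_dual smul p" unfolding lc_dual_iff using lin bound by (metis mult_1)
  \<comment> \<open>The real part already exhausts the bound on the modulus, so the imaginary part
    vanishes.\<close>
  moreover have "\<phi> x0 = complex_of_real (p \<alpha> x0)"
  proof -
    have "Re (\<phi> x0) = p \<alpha> x0" by (simp add: \<phi>_def g)
    moreover have "(Re (\<phi> x0))\<^sup>2 + (Im (\<phi> x0))\<^sup>2 \<le> (p \<alpha> x0)\<^sup>2"
      using bound[of x0] by (metis cmod_power2 norm_ge_zero power_mono)
    ultimately show ?thesis by (simp add: complex_eq_iff)
  qed
  ultimately show thesis using bound that by blast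
qed

text \<open>The transfer principle from scalars to \<open>E\<close>: a bound that is uniform over
  the functionals dominated by \<open>p \<alpha>\<close> is a bound for \<open>p \<alpha>\<close>,
  by a norming functional.\<close>

lemma p_le_if_dual_le:
  assumes "\<And>\<phi>. \<phi> \<in> lc_dual smul p \<Longrightarrow> (\<And>x. cmod (\<phi> x) \<le> p \<alpha> x) \<Longrightarrow> cmod (\<phi> x) \<le> B"
  shows "p \<alpha> x \<le> B"
proof -
  obtain \<phi> where "\<phi> \<in> lc_dual smul p" "\<And>x. cmod (\<phi> x) \<le> p \<alpha> x" "\<phi> x = complex_of_real (p \<alpha> x)"
    using hahn_banach by blast
  then show ?thesis using assms[of \<phi>] p_nonneg[of \<alpha> x] by simp
qed

end

section \<open>Local completeness and limits of fast Cauchy sequences\<close>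

locale locally_complete_space = locally_convex_space smul p
  for smul :: "complex \<Rightarrow> 'e::ab_group_add \<Rightarrow> 'e" and p :: "'i \<Rightarrow> 'e \<Rightarrow> real" +
  assumes hausdorff: "Hausdorff_space (lc_topology p)"
    and locally_complete: "locally_complete smul p"
begin

lemma dual_separates:
  assumes "\<And>\<phi>. \<phi> \<in> lc_dual smul p \<Longrightarrow> \<phi> x = \<phi> y"
  shows "x = y"
proof -
  have "p \<alpha> (y - x) \<le> 0" for \<alpha>
    by (rule p_le_if_dual_le) (simp add: lc_dual_diff assms)
  then have "p \<alpha> (y - x) = 0" for \<alpha> using p_nonneg by (meson order_antisym)
  \<comment> \<open>The constant function \<open>y\<close> converges to both points; any nontrivial
    filter would do in place of \<open>at 0\<close>.\<close>
  then have "limitin (lc_topology p) (\<lambda>_. y) x (at (0::real))" "limitin (lc_topology p) (\<lambda>_. y) y (at (0::real))"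
    by (simp_all add: limitin_lc_topology topspace_lc_topology seminorm_zero)
  then show ?thesis using limitin_Hausdorff_unique[OF _ _ trivial_limit_at hausdorff] by blast
qed

text \<open>Because the rate \<open>\<epsilon>\<close> is common to all seminorms and only the
  constant varies, all differences lie in multiples of one closed disk. There the sequence is Cauchy
  for the Minkowski functional, and local completeness supplies a limit.\<close>

lemma fast_cauchy_converges:
  fixes u :: "nat \<Rightarrow> 'e"
  assumes cauchy: "\<And>\<alpha>. \<exists>C. \<forall>m n. n \<le> m \<longrightarrow> p \<alpha> (u m - u n) \<le> C * \<epsilon> n"
    and \<epsilon>: "\<epsilon> \<longlonglongrightarrow> (0::real)" "\<And>n. 0 < \<epsilon> n"
  obtains l where "\<And>\<alpha>. (\<lambda>n. p \<alpha> (u n - l)) \<longlonglongrightarrow> 0"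
proof -
  obtain C where C: "\<And>\<alpha> m n. n \<le> m \<Longrightarrow> p \<alpha> (u m - u n) \<le> C \<alpha> * \<epsilon> n" using cauchy by metis
  have C0: "0 \<le> C \<alpha>" for \<alpha> using C[of 0 0 \<alpha>] \<epsilon>(2)[of 0] by (simp add: seminorm_zero zero_le_mult_iff)
  \<comment> \<open>The disk is built from the constants of all seminorms at once, so it is bounded
    and closed by construction.\<close>
  define D where "D = {x. \<forall>\<alpha>. p \<alpha> x \<le> C \<alpha>}"
  have D0: "0 \<in> D" using C0 by (simp add: D_def seminorm_zero)
  have "disk smul p D" unfolding disk_def
  proof (intro conjI allI ballI impI)
    show "D \<noteq> {}" using D0 by blast
    fix \<alpha> show "bdd_above (p \<alpha> ` D)" by (rule bdd_aboveI[of _ "C \<alpha>"]) (auto simp: D_def)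
  next
    fix x y s t assume xy: "x \<in> D" "y \<in> D" and st: "cmod s + cmod t \<le> 1"
    have "p \<alpha> (smul s x + smul t y) \<le> C \<alpha>" for \<alpha>
    proof -
      have "p \<alpha> (smul s x + smul t y) \<le> cmod s * p \<alpha> x + cmod t * p \<alpha> y"
        by (metis seminorm_triangle seminorm_scale)
      also have "\<dots> \<le> cmod s * C \<alpha> + cmod t * C \<alpha>"
        using xy by (intro add_mono mult_left_mono) (auto simp: D_def)
      also have "\<dots> = (cmod s + cmod t) * C \<alpha>" by (simp add: algebra_simps)
      also have "\<dots> \<le> 1 * C \<alpha>" using st C0 by (intro mult_right_mono) auto
      finally show ?thesis by simp
    qed
    then show "smul s x + smul t y \<in> D" by (simp add: D_def)
  qed
  moreover have "closedin (lc_topology p) D"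
    unfolding closedin_def topspace_lc_topology openin_lc_topology
  proof (intro conjI ballI)
    fix x assume "x \<in> UNIV - D"
    then obtain \<alpha> where \<alpha>: "C \<alpha> < p \<alpha> x" by (auto simp: D_def not_le)
    have "{y. p \<alpha> (y - x) < p \<alpha> x - C \<alpha>} \<subseteq> UNIV - D"
    proof
      fix y assume "y \<in> {y. p \<alpha> (y - x) < p \<alpha> x - C \<alpha>}"
      then have "C \<alpha> < p \<alpha> y" using p_reverse_triangle[of \<alpha> y x] by (simp add: abs_le_iff)
      then show "y \<in> UNIV - D" using D_def not_le by blast
    qed
    then show "\<exists>\<alpha> \<epsilon>. 0 < \<epsilon> \<and> {y. p \<alpha> (y - x) < \<epsilon>} \<subseteq> UNIV - D" using \<alpha> by (meson diff_gt_0_iff_gt)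
  qed simp
  ultimately have bD: "banach_disk smul p D" using locally_complete by (simp add: locally_complete_def)
  have inD: "x \<in> smul (complex_of_real t) ` D" if "0 < t" "\<And>\<alpha>. p \<alpha> x \<le> C \<alpha> * t" for t x
  proof -
    have "x = smul (complex_of_real t) (smul (complex_of_real (inverse t)) x)" using that(1) by (simp flip: of_real_mult)
    moreover have "p \<alpha> (smul (complex_of_real (inverse t)) x) = p \<alpha> x / t" for \<alpha>
      using that(1) by (simp add: seminorm_scale norm_inverse divide_inverse)
    then have "smul (complex_of_real (inverse t)) x \<in> D"
      using that by (simp add: D_def pos_divide_le_eq)
    ultimately show ?thesis by blast
  qed
  have mink: "minkowski smul D x \<le> t" if "0 < t" "\<And>\<alpha>. p \<alpha> x \<le> C \<alpha> * t" for t x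
    unfolding minkowski_def by (rule cInf_lower) (use that inD in \<open>auto intro!: bdd_belowI[of _ 0]\<close>)
  have span: "x \<in> module.span smul D" if "0 < t" "x \<in> smul (complex_of_real t) ` D" for x t
    using that(2) by (auto intro: span_scale span_base)
  \<comment> \<open>The infimum defining the Minkowski functional need not be attained; the slack 1
    / (n + 1) makes room for an admissible factor and vanishes along the sequence.\<close>
  have p_mink: "p \<alpha> x \<le> C \<alpha> * (minkowski smul D x + 1 / (real n + 1))" if "x \<in> module.span smul D" for \<alpha> x n
  proof -
    have "\<exists>t>0. x \<in> smul (complex_of_real t) ` D"
    proof -
      \<comment> \<open>Every vector of the span is absorbed by the disk; otherwise the set defining
        its Minkowski functional could be empty and the infimum meaningless.\<close>
      have "\<exists>s\<ge>0. \<forall>\<alpha>. p \<alpha> x \<le> C \<alpha> * s" using that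
      proof (induction rule: span_induct_alt)
        case base then show ?case by (intro exI[of _ 0]) (simp add: seminorm_zero)
      next
        case (step c x y)
        then obtain s where s: "0 \<le> s" "\<And>\<alpha>. p \<alpha> y \<le> C \<alpha> * s" by blast
        have "p \<alpha> (smul c x + y) \<le> C \<alpha> * (cmod c + s)" for \<alpha>
        proof -
          have "p \<alpha> (smul c x + y) \<le> cmod c * p \<alpha> x + p \<alpha> y" by (metis seminorm_triangle seminorm_scale)
          also have "\<dots> \<le> cmod c * C \<alpha> + C \<alpha> * s"
            using step s by (intro add_mono mult_left_mono) (auto simp: D_def)
          finally show ?thesis by (simp add: algebra_simps)
        qed
        then show ?case using s(1) by (intro exI[of _ "cmod c + s"]) auto
      qed
      then obtain s where s: "0 \<le> s" "\<And>\<alpha>. p \<alpha> x \<le> C \<alpha> * s" by blast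
      have "p \<alpha> x \<le> C \<alpha> * (s + 1)" for \<alpha> using s(2)[of \<alpha>] C0[of \<alpha>] by (simp add: algebra_simps)
      then show ?thesis using inD[of "s + 1" x] s(1) by (intro exI[of _ "s + 1"]) auto
    qed
    moreover have "minkowski smul D x < minkowski smul D x + 1 / (real n + 1)" by simp
    ultimately obtain t where t: "0 < t" "x \<in> smul (complex_of_real t) ` D" "t < minkowski smul D x + 1 / (real n + 1)"
      unfolding minkowski_def by (subst (asm) cInf_less_iff) (auto intro!: bdd_belowI[of _ 0])
    then obtain d where d: "d \<in> D" "x = smul (complex_of_real t) d" by blast
    have "p \<alpha> x = t * p \<alpha> d" using d t(1) by (simp add: seminorm_scale)
    also have "\<dots> \<le> t * C \<alpha>" using d t(1) by (simp add: D_def)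
    also have "\<dots> \<le> (minkowski smul D x + 1 / (real n + 1)) * C \<alpha>" using t C0 by (intro mult_right_mono) auto
    finally show ?thesis by (simp add: mult.commute)
  qed
  \<comment> \<open>Only differences of the sequence are known to lie in the span of the
    disk.\<close>
  define v where "v n = u n - u 0" for n
  have vspan: "range v \<subseteq> module.span smul D"
    using C[of 0] \<epsilon>(2) inD[of "\<epsilon> 0" "v _"] span by (fastforce simp: v_def)
  have "\<exists>N. \<forall>m\<ge>N. \<forall>n\<ge>N. minkowski smul D (v m - v n) < e" if "0 < e" for e
  proof -
    obtain N where N: "\<And>n. n \<ge> N \<Longrightarrow> \<epsilon> n < e / 2"
      using order_tendstoD(2)[OF \<epsilon>(1), of "e/2"] \<open>0 < e\<close> unfolding eventually_sequentially by (metis half_gt_zero)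
    have "minkowski smul D (v m - v n) < e" if "N \<le> m" "N \<le> n" for m n
    proof -
      have "p \<alpha> (v m - v n) \<le> C \<alpha> * (e / 2)" for \<alpha>
      proof (cases "n \<le> m")
        case True
        have "p \<alpha> (v m - v n) \<le> C \<alpha> * \<epsilon> n" using C[OF True] by (simp add: v_def)
        also have "\<dots> \<le> C \<alpha> * (e / 2)" using N[OF that(2)] C0 by (intro mult_left_mono) auto
        finally show ?thesis .
      next
        case False
        have "p \<alpha> (v n - v m) \<le> C \<alpha> * \<epsilon> m" using C[of m n] False by (simp add: v_def)
        also have "\<dots> \<le> C \<alpha> * (e / 2)" using N[OF that(1)] C0 by (intro mult_left_mono) auto
        finally show ?thesis by (simp add: p_diff_commute)
      qed
      then have "minkowski smul D (v m - v n) \<le> e / 2" using \<open>0 < e\<close> by (intro mink) auto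
      then show ?thesis using \<open>0 < e\<close> by simp
    qed
    then show ?thesis by blast
  qed
  then obtain l where l: "l \<in> module.span smul D" "(\<lambda>n. minkowski smul D (v n - l)) \<longlonglongrightarrow> 0"
    using bD vspan unfolding banach_disk_def by blast
  have "(\<lambda>n. p \<alpha> (u n - (l + u 0))) \<longlonglongrightarrow> 0" for \<alpha>
  proof (rule tendsto_sandwich)
    have "v n - l \<in> module.span smul D" for n using vspan l(1) by (auto intro: span_diff)
    from p_mink[OF this] show "\<forall>\<^sub>F n in sequentially. p \<alpha> (u n - (l + u 0)) \<le> C \<alpha> * (minkowski smul D (v n - l) + 1 / (real n + 1))"
      by (auto simp: v_def algebra_simps)
    show "\<forall>\<^sub>F n in sequentially. 0 \<le> p \<alpha> (u n - (l + u 0))" by (simp add: p_nonneg)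
    have "(\<lambda>n. 1 / (real n + 1)) \<longlonglongrightarrow> 0" using LIMSEQ_inverse_real_of_nat by (simp add: field_simps)
    then have "(\<lambda>n. C \<alpha> * (minkowski smul D (v n - l) + 1 / (real n + 1))) \<longlonglongrightarrow> C \<alpha> * (0 + 0)"
      by (intro tendsto_intros l(2))
    then show "(\<lambda>n. C \<alpha> * (minkowski smul D (v n - l) + 1 / (real n + 1))) \<longlonglongrightarrow> 0" by simp
  qed simp
  then show thesis by (rule that)
qed

text \<open>The form in which local completeness enters all constructions: scalar limits
  \<open>L \<phi>\<close> are realised by one vector, provided the rate is common and the constants
  are uniform over functionals dominated by a seminorm.\<close>

lemma weak_limit_exists:
  fixes u :: "nat \<Rightarrow> 'e"
  assumes cauchy: "\<And>\<alpha>. \<exists>C. \<forall>\<phi>\<in>lc_dual smul p. (\<forall>x. cmod (\<phi> x) \<le> p \<alpha> x) \<longrightarrow>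
      (\<forall>m n. n \<le> m \<longrightarrow> cmod (\<phi> (u m) - \<phi> (u n)) \<le> C * \<epsilon> n)"
    and \<epsilon>: "\<epsilon> \<longlonglongrightarrow> (0::real)" "\<And>n. 0 < \<epsilon> n"
    and lim: "\<And>\<phi>. \<phi> \<in> lc_dual smul p \<Longrightarrow> (\<lambda>n. \<phi> (u n)) \<longlonglongrightarrow> L \<phi>"
  obtains l where "\<And>\<phi>. \<phi> \<in> lc_dual smul p \<Longrightarrow> \<phi> l = L \<phi>"
proof -
  have "\<exists>C. \<forall>m n. n \<le> m \<longrightarrow> p \<alpha> (u m - u n) \<le> C * \<epsilon> n" for \<alpha>
  proof -
    obtain C where C: "\<And>\<phi> m n. \<phi> \<in> lc_dual smul p \<Longrightarrow> (\<forall>x. cmod (\<phi> x) \<le> p \<alpha> x) \<Longrightarrow> n \<le> m \<Longrightarrow> cmod (\<phi> (u m) - \<phi> (u n)) \<le> C * \<epsilon> n"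
      using cauchy[of \<alpha>] by blast
    have "p \<alpha> (u m - u n) \<le> C * \<epsilon> n" if "n \<le> m" for m n
      by (rule p_le_if_dual_le) (simp add: lc_dual_diff C that)
    then show ?thesis by blast
  qed
  then obtain l where l: "\<And>\<alpha>. (\<lambda>n. p \<alpha> (u n - l)) \<longlonglongrightarrow> 0"
    using fast_cauchy_converges[OF _ \<epsilon>] by blast
  have "\<phi> l = L \<phi>" if \<phi>: "\<phi> \<in> lc_dual smul p" for \<phi>
  proof -
    obtain \<alpha> C where C: "C > 0" "\<And>x. cmod (\<phi> x) \<le> C * p \<alpha> x" using lc_dual_bounded[OF \<phi>] by blast
    have "(\<lambda>n. \<phi> (u n) - \<phi> l) \<longlonglongrightarrow> 0"
    proof (rule Lim_null_comparison)
      show "\<forall>\<^sub>F n in sequentially. cmod (\<phi> (u n) - \<phi> l) \<le> C * p \<alpha> (u n - l)"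
        using C(2) by (simp flip: lc_dual_diff[OF \<phi>])
      show "(\<lambda>n. C * p \<alpha> (u n - l)) \<longlonglongrightarrow> 0" using tendsto_mult_left[OF l, of C] by simp
    qed
    then have "(\<lambda>n. \<phi> (u n)) \<longlonglongrightarrow> \<phi> l" by (simp add: LIM_zero_iff)
    then show ?thesis using lim[OF \<phi>] LIMSEQ_unique by blast
  qed
  then show thesis by (rule that)
qed

end

section \<open>Weakly holomorphic functions and weak integrals\<close>

text \<open>Cauchy's inequality on discs of radius r / 2 about the points of the half-size disc
  bounds the second derivative by 2! B / (r / 2)^2 = 8 B / r^2; the rest is the first-order Taylor
  remainder. The explicit constant is what makes the bound uniform over functionals.\<close>

lemma difference_quotient_bound:
  assumes hol: "\<psi> holomorphic_on \<Omega>" and "open \<Omega>" "cball z r \<subseteq> \<Omega>" "0 < r"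
    and B: "\<And>w. w \<in> cball z r \<Longrightarrow> cmod (\<psi> w) \<le> B" and h: "h \<noteq> 0" "cmod h \<le> r / 2"
  shows "cmod ((\<psi> (z + h) - \<psi> z) / h - deriv \<psi> z) \<le> 8 * B / r\<^sup>2 * cmod h"
proof -
  have bound2: "cmod ((deriv ^^ 2) \<psi> x) \<le> 8 * B / r\<^sup>2" if x: "x \<in> cball z (r / 2)" for x
  proof -
    have sub: "cball x (r / 2) \<subseteq> cball z r" using x by (simp add: cball_subset_cball_iff dist_commute)
    have "cmod ((deriv ^^ 2) \<psi> x) \<le> fact 2 * B / (r / 2) ^ 2"
    proof (rule Cauchy_inequality)
      show "\<psi> holomorphic_on ball x (r / 2)"
        using hol by (rule holomorphic_on_subset) (use sub assms(3) ball_subset_cball in blast)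
      show "continuous_on (cball x (r / 2)) \<psi>"
        using hol by (intro continuous_on_subset[OF holomorphic_on_imp_continuous_on]) (use sub assms(3) in blast)+
      fix w assume "cmod (x - w) = r / 2"
      then have "w \<in> cball x (r / 2)" by (simp add: dist_norm)
      then show "cmod (\<psi> w) \<le> B" using sub B by blast
    qed (use \<open>0 < r\<close> in simp)
    then show ?thesis by (simp add: power2_eq_square)
  qed
  have "cmod ((deriv ^^ 0) \<psi> (z + h) - (\<Sum>i\<le>1. (deriv ^^ i) \<psi> z * (z + h - z) ^ i / fact i))
      \<le> 8 * B / r\<^sup>2 * cmod (z + h - z) ^ Suc 1 / fact 1"
  proof (rule complex_Taylor)
    fix i x assume "x \<in> cball z (r / 2)"
    then have "x \<in> \<Omega>" using assms(3,4) by (auto simp: subset_iff)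
    then show "((deriv ^^ i) \<psi> has_field_derivative (deriv ^^ Suc i) \<psi> x) (at x within cball z (r / 2))"
      using holomorphic_derivI[OF holomorphic_higher_deriv[OF hol \<open>open \<Omega>\<close>] \<open>open \<Omega>\<close>] by auto
  qed (use bound2 assms(4) h in \<open>auto simp: dist_norm numeral_2_eq_2\<close>)
  then have *: "cmod (\<psi> (z + h) - \<psi> z - deriv \<psi> z * h) \<le> 8 * B / r\<^sup>2 * cmod h * cmod h"
    by (simp add: algebra_simps)
  have "(\<psi> (z + h) - \<psi> z) / h - deriv \<psi> z = (\<psi> (z + h) - \<psi> z - deriv \<psi> z * h) / h"
    using h(1) by (simp add: field_simps)
  then show ?thesis using * h(1) by (simp add: norm_divide divide_le_eq)
qed

text \<open>On each of the N subintervals the function varies by at most C / N, so each contributes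
  an error of at most C / N^2. An explicit rate is required by
  \<open>weak_limit_exists\<close>.\<close>

lemma riemann_sum_bound:
  fixes h :: "real \<Rightarrow> complex"
  assumes lip: "\<And>s t. s \<in> {0..1} \<Longrightarrow> t \<in> {0..1} \<Longrightarrow> cmod (h s - h t) \<le> C * \<bar>s - t\<bar>" and "0 < N"
  shows "cmod (integral {0..1} h - (\<Sum>j<N. of_real (1 / real N) * h (real j / real N))) \<le> C / real N"
proof -
  have "0 \<le> C" using order_trans[OF norm_ge_zero lip[of 0 1]] by simp
  then have "C-lipschitz_on {0..1} h" using lip by (intro lipschitz_onI) (auto simp: dist_norm)
  then have cont: "continuous_on {0..1} h" by (rule lipschitz_on_continuous_on)
  have "cmod (integral {0..real m / real N} h - (\<Sum>j<m. of_real (1 / real N) * h (real j / real N))) \<le> real m * (C / (real N)\<^sup>2)"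
    if "m \<le> N" for m
    using that
  proof (induction m)
    case (Suc m)
    let ?s = "real m / real N" and ?t = "real (Suc m) / real N"
    have st: "0 \<le> ?s" "?s \<le> ?t" "?t \<le> 1" "?t - ?s = 1 / real N" using Suc.prems \<open>0 < N\<close> by (auto simp: field_simps)
    have int: "h integrable_on {0..?t}"
      using cont st by (intro integrable_continuous_real continuous_on_subset[OF cont]) auto
    have int2: "h integrable_on {?s..?t}"
      using int by (rule integrable_on_subinterval) (use st in auto)
    have "((\<lambda>_. h ?s) has_integral measure lborel {?s..?t} *\<^sub>R h ?s) {?s..?t}" by (rule has_integral_const_real)
    then have c: "((\<lambda>_. h ?s) has_integral of_real (1 / real N) * h ?s) {?s..?t}"
      by (simp only: content_real[OF st(2)] st(4) scaleR_conv_of_real)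
    have eq: "integral {?s..?t} h - of_real (1 / real N) * h ?s = integral {?s..?t} (\<lambda>x. h x - h ?s)"
      by (rule integral_unique[symmetric], rule has_integral_diff[OF integrable_integral[OF int2] c])
    have "cmod (integral {?s..?t} (\<lambda>x. h x - h ?s)) \<le> (C / real N) * (?t - ?s)"
    proof (rule integral_bound)
      show "continuous_on {?s..?t} (\<lambda>x. h x - h ?s)"
        by (intro continuous_on_diff continuous_on_const continuous_on_subset[OF cont])
          (use st(1-3) in \<open>simp only: atLeastatMost_subset_iff simp_thms\<close>)
      fix x assume x: "x \<in> {?s..?t}"
      have "cmod (h x - h ?s) \<le> C * \<bar>x - ?s\<bar>"
      proof (rule lip)
        show "x \<in> {0..1}" using x st(1,3) unfolding atLeastAtMost_iff by (meson order_trans)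
        show "?s \<in> {0..1}" using st(1) order_trans[OF st(2,3)] unfolding atLeastAtMost_iff by blast
      qed
      also have "\<dots> \<le> C * (1 / real N)"
      proof (rule mult_left_mono[OF _ \<open>0 \<le> C\<close>])
        have "0 \<le> x - ?s" "x - ?s \<le> ?t - ?s" using x unfolding atLeastAtMost_iff by linarith+
        then show "\<bar>x - ?s\<bar> \<le> 1 / real N" unfolding st(4) by simp
      qed
      finally show "cmod (h x - h ?s) \<le> C / real N" by simp
    qed (rule st(2))
    also have "\<dots> = C / (real N)\<^sup>2" by (simp only: st(4)) (simp add: power2_eq_square)
    finally have 1: "cmod (integral {?s..?t} h - of_real (1 / real N) * h ?s) \<le> C / (real N)\<^sup>2"
      by (simp only: eq)
    have "integral {0..?t} h = integral {0..?s} h + integral {?s..?t} h"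
      using Henstock_Kurzweil_Integration.integral_combine[OF st(1,2) int] by simp
    then have "integral {0..?t} h - (\<Sum>j<Suc m. of_real (1 / real N) * h (real j / real N))
       = (integral {0..?s} h - (\<Sum>j<m. of_real (1 / real N) * h (real j / real N))) + (integral {?s..?t} h - of_real (1 / real N) * h ?s)"
      by simp
    moreover have "m \<le> N" using Suc.prems by simp
    ultimately have "cmod (integral {0..?t} h - (\<Sum>j<Suc m. of_real (1 / real N) * h (real j / real N))) \<le> real m * (C / (real N)\<^sup>2) + C / (real N)\<^sup>2"
      using norm_triangle_mono[OF Suc.IH 1] by (simp only:)
    then show ?case by (simp only: distrib_right of_nat_Suc mult_1 add.commute)
  qed simp
  from this[of N] show ?thesis using \<open>0 < N\<close> by (simp add: power2_eq_square)
qed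

context locally_convex_space
begin

lemma lc_holomorphic_on_dual:
  assumes "lc_holomorphic_on smul p g \<Omega>" and \<phi>: "\<phi> \<in> lc_dual smul p"
  shows "(\<lambda>z. \<phi> (g z)) holomorphic_on \<Omega>"
proof (rule holomorphic_onI)
  fix z assume "z \<in> \<Omega>"
  then obtain l where l: "\<And>\<alpha>. ((\<lambda>h. p \<alpha> (smul (inverse h) (g (z + h) - g z) - l)) \<longlongrightarrow> 0) (at 0)"
    using assms(1) unfolding lc_holomorphic_on_def limitin_lc_topology by blast
  obtain \<alpha> C where C: "C > 0" "\<And>x. cmod (\<phi> x) \<le> C * p \<alpha> x" using lc_dual_bounded[OF \<phi>] by blast
  have "((\<lambda>h. (\<phi> (g (z + h)) - \<phi> (g z)) / h - \<phi> l) \<longlongrightarrow> 0) (at 0)"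
  proof (rule Lim_null_comparison)
    show "\<forall>\<^sub>F h in at 0. cmod ((\<phi> (g (z + h)) - \<phi> (g z)) / h - \<phi> l) \<le> C * p \<alpha> (smul (inverse h) (g (z + h) - g z) - l)"
      using C(2)[of "smul (inverse h) (g (z + h) - g z) - l" for h]
      by (simp add: lc_dual_diff[OF \<phi>] lc_dual_scale[OF \<phi>] divide_inverse mult.commute)
    show "((\<lambda>h. C * p \<alpha> (smul (inverse h) (g (z + h) - g z) - l)) \<longlongrightarrow> 0) (at 0)"
      using tendsto_mult_left[OF l, of C] by simp
  qed
  then have "((\<lambda>z. \<phi> (g z)) has_field_derivative \<phi> l) (at z)"
    by (simp add: DERIV_def LIM_zero_iff)
  then show "(\<lambda>z. \<phi> (g z)) field_differentiable at z within \<Omega>"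
    using field_differentiable_at_within field_differentiable_def by blast
qed

lemma lc_holomorphic_on_continuous_on:
  assumes "lc_holomorphic_on smul p g \<Omega>"
  shows "continuous_on \<Omega> (\<lambda>z. p \<alpha> (g z))"
proof (rule continuous_at_imp_continuous_on, rule ballI)
  fix z assume "z \<in> \<Omega>"
  then obtain l where "((\<lambda>h. p \<alpha> (smul (inverse h) (g (z + h) - g z) - l)) \<longlongrightarrow> 0) (at 0)"
    using assms unfolding lc_holomorphic_on_def limitin_lc_topology by blast
  then have lim: "((\<lambda>h. cmod h * (p \<alpha> (smul (inverse h) (g (z + h) - g z) - l) + p \<alpha> l)) \<longlongrightarrow> 0 * (0 + p \<alpha> l)) (at 0)"
    by (intro tendsto_intros tendsto_norm_zero tendsto_ident_at)
  have "((\<lambda>h. p \<alpha> (g (z + h)) - p \<alpha> (g z)) \<longlongrightarrow> 0) (at 0)"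
  proof (rule Lim_null_comparison)
    show "\<forall>\<^sub>F h in at 0. norm (p \<alpha> (g (z + h)) - p \<alpha> (g z)) \<le> cmod h * (p \<alpha> (smul (inverse h) (g (z + h) - g z) - l) + p \<alpha> l)"
      unfolding eventually_at
    proof (intro exI[of _ 1] conjI ballI impI)
      fix h :: complex assume "h \<noteq> 0 \<and> dist h 0 < 1"
      then have "g (z + h) - g z = smul h (smul (inverse h) (g (z + h) - g z))" by simp
      then have "p \<alpha> (g (z + h) - g z) = cmod h * p \<alpha> (smul (inverse h) (g (z + h) - g z))" by (metis seminorm_scale)
      also have "\<dots> \<le> cmod h * (p \<alpha> (smul (inverse h) (g (z + h) - g z) - l) + p \<alpha> l)"
        using seminorm_triangle[of \<alpha> "smul (inverse h) (g (z + h) - g z) - l" l] by (intro mult_left_mono) auto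
      finally show "norm (p \<alpha> (g (z + h)) - p \<alpha> (g z)) \<le> cmod h * (p \<alpha> (smul (inverse h) (g (z + h) - g z) - l) + p \<alpha> l)"
        using p_reverse_triangle[of \<alpha> "g (z + h)" "g z"] by simp
    qed simp
    show "((\<lambda>h. cmod h * (p \<alpha> (smul (inverse h) (g (z + h) - g z) - l) + p \<alpha> l)) \<longlongrightarrow> 0) (at 0)"
      using lim by simp
  qed
  then show "isCont (\<lambda>z. p \<alpha> (g z)) z" by (simp add: isCont_iff LIM_zero_iff)
qed

lemma lc_holomorphic_on_bounded:
  assumes "lc_holomorphic_on smul p g \<Omega>" "compact C" "C \<subseteq> \<Omega>"
  shows "\<exists>B. \<forall>z\<in>C. p \<alpha> (g z) \<le> B"
proof -
  have "compact ((\<lambda>z. p \<alpha> (g z)) ` C)"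
    using assms by (intro compact_continuous_image continuous_on_subset[OF lc_holomorphic_on_continuous_on])
  then have "bdd_above ((\<lambda>z. p \<alpha> (g z)) ` C)" by (intro bounded_imp_bdd_above compact_imp_bounded)
  then show ?thesis by (auto simp: bdd_above_def)
qed

end

context locally_complete_space
begin

text \<open>Local bounds in each seminorm make the scalar difference quotients converge with an
  error linear in h, uniformly over dominated functionals. Local completeness turns their limits
  into a vector derivative. All later holomorphy proofs in \<open>E\<close> go through this
  criterion.\<close>

lemma lc_holomorphic_onI:
  assumes "open \<Omega>"
    and hol: "\<And>\<phi>. \<phi> \<in> lc_dual smul p \<Longrightarrow> (\<lambda>z. \<phi> (g z)) holomorphic_on \<Omega>"
    and bdd: "\<And>\<alpha> C. compact C \<Longrightarrow> C \<subseteq> \<Omega> \<Longrightarrow> \<exists>B. \<forall>z\<in>C. p \<alpha> (g z) \<le> B"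
  shows "lc_holomorphic_on smul p g \<Omega>"
  unfolding lc_holomorphic_on_def limitin_lc_topology
proof
  fix z assume "z \<in> \<Omega>"
  then obtain r where r: "r > 0" "cball z r \<subseteq> \<Omega>" using \<open>open \<Omega>\<close> open_contains_cball by blast
  have "\<forall>\<alpha>. \<exists>B. \<forall>w\<in>cball z r. p \<alpha> (g w) \<le> B" using bdd[OF _ r(2)] by simp
  then obtain B where B: "\<And>\<alpha> w. w \<in> cball z r \<Longrightarrow> p \<alpha> (g w) \<le> B \<alpha>" by metis
  define M where "M \<alpha> = 8 * B \<alpha> / r\<^sup>2" for \<alpha>
  define q where "q h = smul (inverse h) (g (z + h) - g z)" for h
  have q: "cmod (\<phi> (q h) - deriv (\<lambda>z. \<phi> (g z)) z) \<le> M \<alpha> * cmod h"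
    if \<phi>: "\<phi> \<in> lc_dual smul p" "\<And>x. cmod (\<phi> x) \<le> p \<alpha> x" and h: "h \<noteq> 0" "cmod h \<le> r / 2" for \<phi> \<alpha> h
  proof -
    have "\<phi> (q h) = (\<phi> (g (z + h)) - \<phi> (g z)) / h"
      by (simp add: q_def lc_dual_scale[OF \<phi>(1)] lc_dual_diff[OF \<phi>(1)] divide_inverse mult.commute)
    then show ?thesis unfolding M_def
      using difference_quotient_bound[OF hol[OF \<phi>(1)] \<open>open \<Omega>\<close> r(2,1) _ h, of "B \<alpha>"] B \<phi>(2)
      by (metis (no_types, lifting) order_trans)
  qed
  \<comment> \<open>A null sequence of increments inside the range where the difference quotient
    bound holds; it also serves as the common rate.\<close>
  define s where "s n = r / 2 / real (Suc n)" for n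
  have s: "0 < s n" "s n \<le> r / 2" "n \<le> m \<Longrightarrow> s m \<le> s n" for m n
    using r(1) by (auto simp: s_def divide_simps)
  have s0: "s \<longlonglongrightarrow> 0" unfolding s_def
    by (rule LIMSEQ_Suc[OF lim_const_over_n])
  obtain l where l: "\<And>\<phi>. \<phi> \<in> lc_dual smul p \<Longrightarrow> \<phi> l = deriv (\<lambda>z. \<phi> (g z)) z"
  proof (rule weak_limit_exists[of "\<lambda>n. q (of_real (s n))" s])
    fix \<alpha>
    show "\<exists>C. \<forall>\<phi>\<in>lc_dual smul p. (\<forall>x. cmod (\<phi> x) \<le> p \<alpha> x) \<longrightarrow>
        (\<forall>m n. n \<le> m \<longrightarrow> cmod (\<phi> (q (of_real (s m))) - \<phi> (q (of_real (s n)))) \<le> C * s n)"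
    proof (intro exI[of _ "2 * M \<alpha>"] ballI impI allI)
      fix \<phi> and m n :: nat assume \<phi>: "\<phi> \<in> lc_dual smul p" "\<forall>x. cmod (\<phi> x) \<le> p \<alpha> x" and "n \<le> m"
      have 1: "cmod (\<phi> (q (of_real (s k))) - deriv (\<lambda>z. \<phi> (g z)) z) \<le> M \<alpha> * s k" for k
        using q[OF \<phi>(1), of \<alpha> "of_real (s k)"] \<phi>(2) s[of k] by simp
      have "0 \<le> M \<alpha>" using 1[of 0] s(1)[of 0] by (metis norm_ge_zero order_trans zero_le_mult_iff less_le_not_le)
      then have "M \<alpha> * s m \<le> M \<alpha> * s n" using s(3)[OF \<open>n \<le> m\<close>] by (rule mult_left_mono[rotated])
      then show "cmod (\<phi> (q (of_real (s m))) - \<phi> (q (of_real (s n)))) \<le> 2 * M \<alpha> * s n"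
        using norm_triangle_ineq4[of "\<phi> (q (of_real (s m))) - deriv (\<lambda>z. \<phi> (g z)) z" "\<phi> (q (of_real (s n))) - deriv (\<lambda>z. \<phi> (g z)) z"]
          1[of m] 1[of n] by simp
    qed
  next
    fix \<phi> assume \<phi>: "\<phi> \<in> lc_dual smul p"
    have "((\<lambda>z. \<phi> (g z)) has_field_derivative deriv (\<lambda>z. \<phi> (g z)) z) (at z)"
      using holomorphic_derivI[OF hol[OF \<phi>] \<open>open \<Omega>\<close> \<open>z \<in> \<Omega>\<close>] .
    then have "(\<lambda>h. \<phi> (q h)) \<midarrow>0\<rightarrow> deriv (\<lambda>z. \<phi> (g z)) z"
      unfolding DERIV_def q_def lc_dual_scale[OF \<phi>] lc_dual_diff[OF \<phi>] by (simp add: divide_inverse mult.commute)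
    moreover have "complex_of_real (s n) \<noteq> 0" for n using s(1)[of n] by simp
    then have "filterlim (\<lambda>n. complex_of_real (s n)) (at 0) sequentially"
      using tendsto_of_real[OF s0, where 'a=complex] by (intro filterlim_atI) auto
    ultimately show "(\<lambda>n. \<phi> (q (complex_of_real (s n)))) \<longlonglongrightarrow> deriv (\<lambda>z. \<phi> (g z)) z"
      by (rule filterlim_compose)
  qed (use s s0 in auto)
  \<comment> \<open>The sequence \<open>s\<close> only produced the candidate \<open>l\<close>.
    Convergence for arbitrary complex increments follows from the same scalar bound through the
    dual.\<close>
  have "((\<lambda>h. p \<alpha> (q h - l)) \<longlongrightarrow> 0) (at 0)" for \<alpha>
  proof (rule Lim_null_comparison)
    show "\<forall>\<^sub>F h in at 0. norm (p \<alpha> (q h - l)) \<le> M \<alpha> * cmod h"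
      unfolding eventually_at
    proof (intro exI[of _ "r/2"] conjI ballI impI)
      fix h :: complex assume h: "h \<noteq> 0 \<and> dist h 0 < r / 2"
      have "p \<alpha> (q h - l) \<le> M \<alpha> * cmod h"
        by (rule p_le_if_dual_le) (use q h l in \<open>simp add: lc_dual_diff\<close>)
      then show "norm (p \<alpha> (q h - l)) \<le> M \<alpha> * cmod h" by (simp add: p_nonneg)
    qed (use r in simp)
    show "((\<lambda>h. M \<alpha> * cmod h) \<longlongrightarrow> 0) (at 0)"
      using tendsto_mult_left[OF tendsto_norm_zero[OF tendsto_ident_at], of "M \<alpha>"] by simp
  qed
  then show "\<exists>l. \<forall>\<alpha>. ((\<lambda>h. p \<alpha> (smul (inverse h) (g (z + h) - g z) - l)) \<longlongrightarrow> 0) (at 0)"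
    unfolding q_def by blast
qed

text \<open>Riemann sums of a curve that is Lipschitz for every seminorm form a fast Cauchy sequence.\<close>

lemma weak_integral_exists:
  assumes F: "lc_holomorphic_on smul p F \<Omega>" and "open \<Omega>" and "g ` {0..1} \<subseteq> \<Omega>"
    and g': "\<And>t. t \<in> {0..1} \<Longrightarrow> (g has_vector_derivative g' t) (at t within {0..1})"
    and g'': "\<And>t. t \<in> {0..1} \<Longrightarrow> (g' has_vector_derivative g'' t) (at t within {0..1})"
    and M: "\<And>t. t \<in> {0..1} \<Longrightarrow> cmod (g' t) \<le> M1" "\<And>t. t \<in> {0..1} \<Longrightarrow> cmod (g'' t) \<le> M2"
  obtains e where "\<And>\<phi>. \<phi> \<in> lc_dual smul p \<Longrightarrow> \<phi> e = integral {0..1} (\<lambda>t. \<phi> (F (g t)) * g' t)"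
proof -
  have "continuous_on {0..1} g" using g' by (meson continuous_on_vector_derivative)
  then have cg: "compact (g ` {0..1})" by (intro compact_continuous_image) auto
  obtain r where r: "r > 0" "(\<Union>x\<in>g ` {0..1}. cball x r) \<subseteq> \<Omega>"
    using compact_subset_open_imp_cball_epsilon_subset[OF cg assms(2,3)] by blast
  \<comment> \<open>A compact neighbourhood of the curve: on it the seminorms of \<open>F\<close>
    are bounded, and it contains the discs of radius \<open>r\<close> needed for Cauchy's inequality
    along the curve.\<close>
  define K where "K = {x. infdist x (g ` {0..1}) \<le> r}"
  have K: "compact K" unfolding K_def using cg r(1) by (intro compact_infdist_le) auto
  have "K \<subseteq> \<Omega>"
  proof
    fix x assume "x \<in> K"
    moreover obtain y where "y \<in> g ` {0..1}" "infdist x (g ` {0..1}) = dist x y"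
      using infdist_attains_inf[OF compact_imp_closed[OF cg]] by auto
    ultimately have "x \<in> cball y r" by (simp add: K_def dist_commute)
    then show "x \<in> \<Omega>" using r(2) \<open>y \<in> g ` {0..1}\<close> by blast
  qed
  have cbK: "cball (g t) r \<subseteq> K" if "t \<in> {0..1}" for t
    unfolding K_def using that by (auto intro!: infdist_le2 simp: dist_commute)
  have "\<forall>\<alpha>. \<exists>B. \<forall>z\<in>K. p \<alpha> (F z) \<le> B" using lc_holomorphic_on_bounded[OF F K \<open>K \<subseteq> \<Omega>\<close>] by blast
  then obtain B where B: "\<And>\<alpha> z. z \<in> K \<Longrightarrow> p \<alpha> (F z) \<le> B \<alpha>" by metis
  \<comment> \<open>The product rule gives two terms: B M2 from the second derivative of the curve,
    and (B / r) M1 M1 from the derivative of \<open>F\<close>, bounded by Cauchy's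
    inequality.\<close>
  define C where "C \<alpha> = B \<alpha> * M2 + B \<alpha> / r * M1 * M1" for \<alpha>
  define k where "k t = smul (g' t) (F (g t))" for t
  have k: "\<phi> (k t) = \<phi> (F (g t)) * g' t" if "\<phi> \<in> lc_dual smul p" for \<phi> t
    by (simp add: k_def lc_dual_scale[OF that] mult.commute)
  have lip: "cmod (\<phi> (k s) - \<phi> (k t)) \<le> C \<alpha> * \<bar>s - t\<bar>"
    if \<phi>: "\<phi> \<in> lc_dual smul p" "\<And>x. cmod (\<phi> x) \<le> p \<alpha> x" and st: "s \<in> {0..1}" "t \<in> {0..1}" for \<phi> \<alpha> s t
  proof -
    define \<psi> where "\<psi> = (\<lambda>z. \<phi> (F z))"
    have hol: "\<psi> holomorphic_on \<Omega>" unfolding \<psi>_def by (rule lc_holomorphic_on_dual[OF F \<phi>(1)])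
    have \<psi>B: "cmod (\<psi> z) \<le> B \<alpha>" if "z \<in> K" for z
      using B[OF that] \<phi>(2) order_trans unfolding \<psi>_def by blast
    define k' where "k' t = \<psi> (g t) * g'' t + (g' t * deriv \<psi> (g t)) * g' t" for t
    have der: "((\<lambda>t. \<psi> (g t) * g' t) has_derivative (\<lambda>h. h *\<^sub>R k' t)) (at t within {0..1})" if "t \<in> {0..1}" for t
    proof -
      have "(\<psi> has_field_derivative deriv \<psi> (g t)) (at (g t) within g ` {0..1})"
        using that assms(3) by (intro holomorphic_derivI[OF hol \<open>open \<Omega>\<close>]) auto
      then have "((\<psi> \<circ> g) has_vector_derivative g' t * deriv \<psi> (g t)) (at t within {0..1})"
        by (rule field_vector_diff_chain_within[OF g'[OF that]])
      then have "((\<lambda>t. \<psi> (g t) * g' t) has_vector_derivative k' t) (at t within {0..1})"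
        unfolding k'_def o_def by (intro has_vector_derivative_mult g''[OF that])
      then show ?thesis by (simp add: has_vector_derivative_def)
    qed
    have "cmod (\<psi> (g s) * g' s - \<psi> (g t) * g' t) \<le> C \<alpha> * norm (s - t)"
    proof (rule differentiable_bound[OF _ der])
      fix t :: real assume t: "t \<in> {0..1}"
      have "cmod ((deriv ^^ 1) \<psi> (g t)) \<le> fact 1 * B \<alpha> / r ^ 1"
      proof (rule Cauchy_inequality)
        show "\<psi> holomorphic_on ball (g t) r"
          using hol by (rule holomorphic_on_subset) (use cbK[OF t] \<open>K \<subseteq> \<Omega>\<close> ball_subset_cball in blast)
        show "continuous_on (cball (g t) r) \<psi>"
          using hol by (intro continuous_on_subset[OF holomorphic_on_imp_continuous_on]) (use cbK[OF t] \<open>K \<subseteq> \<Omega>\<close> in blast)+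
        fix x assume "cmod (g t - x) = r"
        then have "x \<in> K" using cbK[OF t] by (auto simp: dist_norm subset_iff)
        then show "cmod (\<psi> x) \<le> B \<alpha>" by (rule \<psi>B)
      qed fact
      then have d: "cmod (deriv \<psi> (g t)) \<le> B \<alpha> / r" by simp
      have b: "cmod (\<psi> (g t)) \<le> B \<alpha>" using cbK[OF t] r(1) by (intro \<psi>B) (auto simp: subset_iff)
      have "0 \<le> B \<alpha>" using b norm_ge_zero order_trans by blast
      have "0 \<le> M1" using M(1)[OF t] norm_ge_zero order_trans by blast
      have "cmod (k' t) \<le> cmod (\<psi> (g t)) * cmod (g'' t) + cmod (g' t) * cmod (deriv \<psi> (g t)) * cmod (g' t)"
        unfolding k'_def by (rule order_trans[OF norm_triangle_ineq]) (simp add: norm_mult)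
      also have "\<dots> \<le> B \<alpha> * M2 + M1 * (B \<alpha> / r) * M1"
        using b d M[OF t] r(1) \<open>0 \<le> B \<alpha>\<close> \<open>0 \<le> M1\<close> by (intro add_mono mult_mono) auto
      finally have "cmod (k' t) \<le> C \<alpha>" by (simp add: C_def mult_ac)
      then show "onorm (\<lambda>h. h *\<^sub>R k' t) \<le> C \<alpha>"
        by (intro onorm_le) (simp add: mult.commute[of "C \<alpha>"] mult_left_mono)
    qed (use st in auto)
    then show ?thesis by (simp add: k[OF \<phi>(1)] \<psi>_def)
  qed
  \<comment> \<open>A general functional is dominated only by a multiple of a seminorm. The
    Lipschitz estimate is first lifted to that seminorm and then applied to the functional.\<close>
  have lip': "\<exists>C. \<forall>s\<in>{0..1}. \<forall>t\<in>{0..1}. cmod (\<phi> (k s) - \<phi> (k t)) \<le> C * \<bar>s - t\<bar>" if \<phi>: "\<phi> \<in> lc_dual smul p" for \<phi>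
  proof -
    obtain \<alpha> c where c: "0 < c" "\<And>x. cmod (\<phi> x) \<le> c * p \<alpha> x" using lc_dual_bounded[OF \<phi>] by blast
    have pk: "p \<alpha> (k s - k t) \<le> C \<alpha> * \<bar>s - t\<bar>" if "s \<in> {0..1}" "t \<in> {0..1}" for s t
      by (rule p_le_if_dual_le) (simp only: lc_dual_diff lip that)
    have "cmod (\<phi> (k s) - \<phi> (k t)) \<le> c * (C \<alpha> * \<bar>s - t\<bar>)" if "s \<in> {0..1}" "t \<in> {0..1}" for s t
      unfolding lc_dual_diff[OF \<phi>, symmetric]
      by (rule order_trans[OF c(2) mult_left_mono[OF pk[OF that]]]) (use c(1) in simp)
    then show ?thesis by (intro exI[of _ "c * C \<alpha>"]) (simp add: mult.assoc)
  qed
  define u where "u n = (\<Sum>j<Suc n. smul (of_real (1 / real (Suc n))) (k (real j / real (Suc n))))" for n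
  have \<phi>u: "\<phi> (u n) = (\<Sum>j<Suc n. of_real (1 / real (Suc n)) * \<phi> (k (real j / real (Suc n))))" if "\<phi> \<in> lc_dual smul p" for \<phi> n
    unfolding u_def by (simp only: lc_dual_sum[OF that] lc_dual_scale[OF that])
  have rs: "cmod (integral {0..1} (\<lambda>t. \<phi> (k t)) - \<phi> (u n)) \<le> D / real (Suc n)"
    if "\<phi> \<in> lc_dual smul p" "\<And>s t. s \<in> {0..1} \<Longrightarrow> t \<in> {0..1} \<Longrightarrow> cmod (\<phi> (k s) - \<phi> (k t)) \<le> D * \<bar>s - t\<bar>" for \<phi> n D
    unfolding \<phi>u[OF that(1)] by (rule riemann_sum_bound[OF that(2)]) simp_all
  obtain e where e: "\<And>\<phi>. \<phi> \<in> lc_dual smul p \<Longrightarrow> \<phi> e = integral {0..1} (\<lambda>t. \<phi> (k t))"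
  proof (rule weak_limit_exists[of u "\<lambda>n. 1 / real (Suc n)"])
    fix \<alpha>
    show "\<exists>C. \<forall>\<phi>\<in>lc_dual smul p. (\<forall>x. cmod (\<phi> x) \<le> p \<alpha> x) \<longrightarrow>
        (\<forall>m n. n \<le> m \<longrightarrow> cmod (\<phi> (u m) - \<phi> (u n)) \<le> C * (1 / real (Suc n)))"
    proof (intro exI[of _ "2 * C \<alpha>"] ballI impI allI)
      fix \<phi> and m n :: nat assume \<phi>: "\<phi> \<in> lc_dual smul p" "\<forall>x. cmod (\<phi> x) \<le> p \<alpha> x" and "n \<le> m"
      have 1: "cmod (integral {0..1} (\<lambda>t. \<phi> (k t)) - \<phi> (u j)) \<le> C \<alpha> / real (Suc j)" for j
        using rs[OF \<phi>(1), of "C \<alpha>"] lip[OF \<phi>(1)] \<phi>(2) by blast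
      have "0 \<le> C \<alpha> / real (Suc 0)" using norm_ge_zero 1[of 0] by (rule order_trans)
      then have "0 \<le> C \<alpha>" by simp
      then have "C \<alpha> / real (Suc m) \<le> C \<alpha> / real (Suc n)" using \<open>n \<le> m\<close> by (intro divide_left_mono) auto
      then show "cmod (\<phi> (u m) - \<phi> (u n)) \<le> 2 * C \<alpha> * (1 / real (Suc n))"
        using norm_triangle_ineq4[of "integral {0..1} (\<lambda>t. \<phi> (k t)) - \<phi> (u n)" "integral {0..1} (\<lambda>t. \<phi> (k t)) - \<phi> (u m)"]
          1[of m] 1[of n] by simp
    qed
  next
    fix \<phi> assume \<phi>: "\<phi> \<in> lc_dual smul p"
    then obtain D where D: "\<And>s t. s \<in> {0..1} \<Longrightarrow> t \<in> {0..1} \<Longrightarrow> cmod (\<phi> (k s) - \<phi> (k t)) \<le> D * \<bar>s - t\<bar>"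
      using lip' by blast
    have "(\<lambda>n. \<phi> (u n) - integral {0..1} (\<lambda>t. \<phi> (k t))) \<longlonglongrightarrow> 0"
    proof (rule Lim_null_comparison)
      show "\<forall>\<^sub>F n in sequentially. cmod (\<phi> (u n) - integral {0..1} (\<lambda>t. \<phi> (k t))) \<le> D / real (Suc n)"
        using rs[OF \<phi> D] by (simp add: norm_minus_commute)
      show "(\<lambda>n. D / real (Suc n)) \<longlonglongrightarrow> 0" by (rule LIMSEQ_Suc[OF lim_const_over_n])
    qed
    then show "(\<lambda>n. \<phi> (u n)) \<longlonglongrightarrow> integral {0..1} (\<lambda>t. \<phi> (k t))" by (simp add: LIM_zero_iff)
  next
    show "(\<lambda>n. 1 / real (Suc n)) \<longlonglongrightarrow> 0" by (rule LIMSEQ_Suc[OF lim_const_over_n])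
  qed auto
  have "\<phi> e = integral {0..1} (\<lambda>t. \<phi> (F (g t)) * g' t)" if "\<phi> \<in> lc_dual smul p" for \<phi>
    using e[OF that] by (simp add: k[OF that])
  then show thesis by (rule that)
qed

end

section \<open>Contour integrals along the path around a segment\<close>

abbreviation segment :: "real \<Rightarrow> real \<Rightarrow> complex set" where
  "segment a b \<equiv> complex_of_real ` {a..b}"

lemma compact_segment: "compact (segment a b)"
  by (intro compact_continuous_image continuous_intros) auto

lemma closed_segment_real: "closed (segment a b)"
  by (rule compact_imp_closed[OF compact_segment])

lemma open_Compl_segment: "open (- segment a b)"
  using closed_segment_real by blast

lemma convex_segment: "convex (segment a b)"
  by (intro convex_linear_image) (auto intro: linearI simp: scaleR_conv_of_real)

lemma infdist_segment_pos:
  assumes "a \<le> b" "z \<notin> segment a b"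
  shows "0 < infdist z (segment a b)"
  using assms by (intro infdist_pos_not_in_closed closed_segment_real) auto

lemma infdist_segment_attained:
  assumes "a \<le> b"
  obtains y where "y \<in> segment a b" "infdist z (segment a b) = dist z y"
  using infdist_attains_inf[OF closed_segment_real[of a b]] assms by auto

text \<open>At a fixed parameter the point of the path is linear in (a, b, c). Hence straight-line
  homotopies between two such paths pass through paths of the same kind, with interpolated
  data.\<close>

lemma gamma_path_affine:
  "gamma_path a b c t = of_real a * gamma_path 1 0 0 t + of_real b * gamma_path 0 1 0 t + of_real c * gamma_path 0 0 1 t"
  by (auto simp: gamma_path_def joinpaths_def linepath_def part_circlepath_def complex_eq_iff algebra_simps)

lemma valid_path_gamma_path [simp]: "valid_path (gamma_path a b c)"
  and path_gamma_path [simp]: "path (gamma_path a b c)"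
  and gamma_path_loop [simp]: "pathfinish (gamma_path a b c) = pathstart (gamma_path a b c)"
proof -
  have "exp (\<i> * complex_of_real (pi / 2)) = \<i>" "exp (\<i> * complex_of_real (- pi / 2)) = - \<i>"
    "exp (\<i> * complex_of_real (3 * pi / 2)) = - \<i>"
    using cos_3over2_pi sin_3over2_pi unfolding cis_conv_exp[symmetric]
    by (simp_all add: complex_eq_iff mult.commute[of pi])
  then have e: "exp (\<i> * complex_of_real pi / 2) = \<i>" "exp (- (\<i> * complex_of_real pi / 2)) = - \<i>"
    "exp (\<i> * (3 * complex_of_real pi) / 2) = - \<i>" by simp_all
  have e1: "Complex b c = of_real b + of_real c * \<i>" "Complex b (-c) = of_real b - of_real c * \<i>"
    "Complex a c = of_real a + of_real c * \<i>" "Complex a (-c) = of_real a - of_real c * \<i>" by (simp_all add: complex_eq_iff)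
  show "valid_path (gamma_path a b c)"
    unfolding gamma_path_def using e e1
    by (simp add: pathfinish_part_circlepath pathstart_part_circlepath)
  then show "path (gamma_path a b c)" by (rule valid_path_imp_path)
  show "pathfinish (gamma_path a b c) = pathstart (gamma_path a b c)"
    unfolding gamma_path_def using e e1 by simp
qed

text \<open>Of the angle on each arc only the sign of the cosine is recorded: it says that the arc
  points away from the segment, which is all that the distance computation uses.\<close>

lemma path_image_gamma_path:
  assumes "a \<le> b" "0 \<le> c" "w \<in> path_image (gamma_path a b c)"
  shows "(\<exists>x\<in>{a..b}. w = Complex x c \<or> w = Complex x (- c)) \<or>
    (\<exists>\<theta>. 0 \<le> cos \<theta> \<and> w = of_real b + of_real c * cis \<theta>) \<or>
    (\<exists>\<theta>. cos \<theta> \<le> 0 \<and> w = of_real a + of_real c * cis \<theta>)"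
proof -
  have l: "\<exists>x\<in>{a..b}. w = Complex x d" if "w \<in> closed_segment (Complex a d) (Complex b d)" for d
  proof -
    have "\<exists>u. 0 \<le> u \<and> u \<le> 1 \<and> w = (1 - u) *\<^sub>R Complex a d + u *\<^sub>R Complex b d"
      using that by (simp only: in_segment)
    then obtain u where u: "0 \<le> u" "u \<le> 1" "w = (1 - u) *\<^sub>R Complex a d + u *\<^sub>R Complex b d" by blast
    have "(1 - u) *\<^sub>R a + u *\<^sub>R b \<in> closed_segment a b" using u by (auto simp: closed_segment_def)
    then have "(1 - u) * a + u * b \<in> {a..b}" using assms(1) by (simp add: closed_segment_eq_real_ivl)
    moreover have "w = Complex ((1 - u) * a + u * b) d" using u(3) by (simp add: complex_eq_iff algebra_simps)
    ultimately show ?thesis by blast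
  qed
  have "w \<in> path_image (linepath (Complex a c) (Complex b c)) \<union> (path_image (part_circlepath (complex_of_real b) c (pi / 2) (- pi / 2))
     \<union> (path_image (linepath (Complex b (- c)) (Complex a (- c))) \<union> path_image (part_circlepath (complex_of_real a) c (3 * pi / 2) (pi / 2))))"
    using assms(3) path_image_join_subset unfolding gamma_path_def by blast
  then consider "w \<in> closed_segment (Complex a c) (Complex b c)" | "w \<in> closed_segment (Complex a (- c)) (Complex b (- c))"
    | \<theta> where "\<theta> \<in> closed_segment (pi / 2) (- pi / 2)" "w = of_real b + of_real c * cis \<theta>"
    | \<theta> where "\<theta> \<in> closed_segment (3 * pi / 2) (pi / 2)" "w = of_real a + of_real c * cis \<theta>"
    by (auto simp: path_image_part_circlepath' closed_segment_commute)
  then show ?thesis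
  proof cases
    case 3
    then have "0 \<le> cos \<theta>" by (intro cos_ge_zero) (auto simp: closed_segment_eq_real_ivl split: if_splits)
    then show ?thesis using 3 by blast
  next
    case 4
    have "pi / 2 \<le> \<theta>" "\<theta> \<le> 3 * pi / 2" using 4(1) by (auto simp: closed_segment_eq_real_ivl split: if_splits)
    then have "0 \<le> cos (\<theta> - pi)" by (intro cos_ge_zero) auto
    then have "cos \<theta> \<le> 0" by (simp add: cos_diff)
    then show ?thesis using 4 by blast
  qed (use l in blast)+
qed

text \<open>The contour lies on a level set of the distance. On the arcs the cross term in the
  squared distance to a point of the segment is nonnegative, since the arc bends away from
  it.\<close>

lemma infdist_gamma_path:
  assumes "a \<le> b" "0 \<le> c" "w \<in> path_image (gamma_path a b c)"
  shows "infdist w (segment a b) = c"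
proof (rule antisym)
  note cases = path_image_gamma_path[OF assms]
  have "\<exists>y\<in>segment a b. dist w y \<le> c"
    using cases
  proof (elim disjE bexE exE conjE)
    fix x assume "x \<in> {a..b}" "w = Complex x c"
    then have "of_real x \<in> segment a b" "dist w (of_real x) \<le> c" using assms(2) by (auto simp: dist_norm cmod_def)
    then show ?thesis by blast
  next
    fix x assume "x \<in> {a..b}" "w = Complex x (- c)"
    then have "of_real x \<in> segment a b" "dist w (of_real x) \<le> c" using assms(2) by (auto simp: dist_norm cmod_def)
    then show ?thesis by blast
  next
    fix \<theta> assume "w = of_real b + of_real c * cis \<theta>"
    then have "of_real b \<in> segment a b" "dist w (of_real b) \<le> c" using assms by (auto simp: dist_norm norm_mult)
    then show ?thesis by blast
  next
    fix \<theta> assume "w = of_real a + of_real c * cis \<theta>"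
    then have "of_real a \<in> segment a b" "dist w (of_real a) \<le> c" using assms by (auto simp: dist_norm norm_mult)
    then show ?thesis by blast
  qed
  then show "infdist w (segment a b) \<le> c" by (auto intro: infdist_le2)
  have "c \<le> dist w y" if y: "y \<in> segment a b" for y
  proof -
    obtain x where x: "a \<le> x" "x \<le> b" "y = of_real x" using y by auto
    have c2: "c * (c * (cos \<theta> * cos \<theta>)) + c * (c * (sin \<theta> * sin \<theta>)) = c * c" for \<theta>
      using sin_cos_squared_add2[of \<theta>] by algebra
    have "c\<^sup>2 \<le> (Re w - x)\<^sup>2 + (Im w)\<^sup>2"
      using cases
    proof (elim disjE bexE exE conjE)
      fix \<theta> assume t: "0 \<le> cos \<theta>" "w = of_real b + of_real c * cis \<theta>"
      have "(Re w - x)\<^sup>2 + (Im w)\<^sup>2 = (b - x)\<^sup>2 + 2 * (b - x) * (c * cos \<theta>) + c\<^sup>2"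
        using t(2) c2[of \<theta>] by (simp add: power2_eq_square algebra_simps)
      moreover have "0 \<le> 2 * (b - x) * (c * cos \<theta>)" using t(1) assms(2) x by simp
      ultimately show ?thesis using zero_le_power2[of "b - x"] by linarith
    next
      fix \<theta> assume t: "cos \<theta> \<le> 0" "w = of_real a + of_real c * cis \<theta>"
      have "(Re w - x)\<^sup>2 + (Im w)\<^sup>2 = (x - a)\<^sup>2 + 2 * (x - a) * (c * (- cos \<theta>)) + c\<^sup>2"
        using t(2) c2[of \<theta>] by (simp add: power2_eq_square algebra_simps)
      moreover have "0 \<le> 2 * (x - a) * (c * (- cos \<theta>))" using t(1) assms(2) x by (intro mult_nonneg_nonneg) auto
      ultimately show ?thesis using zero_le_power2[of "x - a"] by linarith
    qed auto
    then have "c\<^sup>2 \<le> (dist w y)\<^sup>2" using x(3) by (simp add: dist_norm cmod_power2)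
    then show ?thesis using power2_le_imp_le zero_le_dist by blast
  qed
  then show "c \<le> infdist w (segment a b)"
    using infdist_segment_attained[OF assms(1), of w] by metis
qed

lemma path_image_gamma_path_subset:
  assumes "a \<le> b" "0 < c"
  shows "path_image (gamma_path a b c) \<subseteq> - segment a b"
proof
  fix w assume "w \<in> path_image (gamma_path a b c)"
  then have "infdist w (segment a b) = c" using assms by (intro infdist_gamma_path) auto
  then show "w \<in> - segment a b" using assms(2) by auto
qed

text \<open>The linear homotopy between the two contours consists of contours of intermediate
  radius, whose distance from the segment is exactly that radius; so it stays inside
  \<open>S\<close>.\<close>

lemma contour_integral_gamma_path_eq:
  assumes "a \<le> b" "0 < c" "c \<le> c'" and S: "open S" "{w. c \<le> infdist w (segment a b) \<and> infdist w (segment a b) \<le> c'} \<subseteq> S"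
    and F: "F holomorphic_on S"
  shows "contour_integral (gamma_path a b c) F = contour_integral (gamma_path a b c') F"
proof (rule Cauchy_theorem_homotopic_loops[OF _ S(1) F])
  show "homotopic_loops S (gamma_path a b c) (gamma_path a b c')"
  proof (rule homotopic_loops_linear)
    fix t :: real assume t: "t \<in> {0..1}"
    show "closed_segment (gamma_path a b c t) (gamma_path a b c' t) \<subseteq> S"
    proof
      fix w assume "w \<in> closed_segment (gamma_path a b c t) (gamma_path a b c' t)"
      then have "\<exists>u. 0 \<le> u \<and> u \<le> 1 \<and> w = (1 - u) *\<^sub>R gamma_path a b c t + u *\<^sub>R gamma_path a b c' t"
        by (simp only: in_segment)
      then obtain u where u: "0 \<le> u" "u \<le> 1" "w = (1 - u) *\<^sub>R gamma_path a b c t + u *\<^sub>R gamma_path a b c' t" by blast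
      define d where "d = (1 - u) * c + u * c'"
      have "d = c + u * (c' - c)" by (simp add: d_def algebra_simps)
      moreover have "0 \<le> u * (c' - c)" "u * (c' - c) \<le> c' - c"
        using u assms(3) by (auto intro: mult_left_le_one_le)
      ultimately have d: "c \<le> d" "d \<le> c'" by linarith+
      have "w = gamma_path a b d t"
        unfolding u(3) gamma_path_affine[of a b c t] gamma_path_affine[of a b c' t] gamma_path_affine[of a b d t]
        by (simp add: d_def scaleR_conv_of_real algebra_simps)
      then have "w \<in> path_image (gamma_path a b d)" using t by (simp add: path_image_def)
      then have "infdist w (segment a b) = d" using assms d by (intro infdist_gamma_path) auto
      then show "w \<in> S" using S(2) d by auto
    qed
  qed auto
qed auto

text \<open>\<open>L\<close> acts as an upper bound for the length. The notion bundles the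
  integrability and the estimate that rays, arcs and their joins all have, so that later arguments
  treat them alike.\<close>

definition tame_path :: "(real \<Rightarrow> complex) \<Rightarrow> real \<Rightarrow> bool" where
  "tame_path g L \<longleftrightarrow> valid_path g \<and> 0 \<le> L \<and>
     (\<forall>h B. continuous_on (path_image g) h \<longrightarrow> (\<forall>w\<in>path_image g. cmod (h w) \<le> B) \<longrightarrow>
        h contour_integrable_on g \<and> cmod (contour_integral g h) \<le> L * B)"

lemma tame_path_compact: "tame_path g L \<Longrightarrow> compact (path_image g)"
  by (simp add: tame_path_def compact_valid_path_image)

lemma tame_path_bound:
  assumes "tame_path g L" "continuous_on (path_image g) h" "\<And>w. w \<in> path_image g \<Longrightarrow> cmod (h w) \<le> B"
  shows "cmod (contour_integral g h) \<le> L * B"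
  using assms unfolding tame_path_def by blast

lemma tame_path_integrable:
  assumes "tame_path g L" "continuous_on (path_image g) h"
  shows "h contour_integrable_on g"
proof -
  have "compact (h ` path_image g)" using assms tame_path_compact by (intro compact_continuous_image)
  then obtain B where "\<forall>x\<in>h ` path_image g. cmod x \<le> B" using compact_imp_bounded bounded_iff by metis
  then show ?thesis using assms unfolding tame_path_def by blast
qed

lemma tame_linepath: "tame_path (linepath a b) (cmod (b - a))"
  unfolding tame_path_def
proof (intro conjI allI impI)
  fix h B assume h: "continuous_on (path_image (linepath a b)) h" "\<forall>w\<in>path_image (linepath a b). cmod (h w) \<le> B"
  show i: "h contour_integrable_on linepath a b" using h(1) by (intro contour_integrable_continuous_linepath) simp
  have "0 \<le> B" using h(2) norm_ge_zero order_trans by (metis pathstart_in_path_image)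
  then show "cmod (contour_integral (linepath a b) h) \<le> cmod (b - a) * B"
    using contour_integral_bound_linepath[OF i, of B] h(2) by (simp add: mult.commute)
qed auto

lemma tame_part_circlepath:
  assumes "0 \<le> r"
  shows "tame_path (part_circlepath z r s t) (r * \<bar>t - s\<bar>)"
  unfolding tame_path_def
proof (intro conjI allI impI)
  fix h B assume h: "continuous_on (path_image (part_circlepath z r s t)) h" "\<forall>w\<in>path_image (part_circlepath z r s t). cmod (h w) \<le> B"
  show i: "h contour_integrable_on part_circlepath z r s t" using h(1) by (intro contour_integrable_continuous_part_circlepath)
  have "0 \<le> B" using h(2) norm_ge_zero order_trans by (metis pathstart_in_path_image)
  then show "cmod (contour_integral (part_circlepath z r s t) h) \<le> r * \<bar>t - s\<bar> * B"
    using contour_integral_bound_part_circlepath[OF i, of B] h(2) assms by (simp add: mult_ac)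
qed (use assms in auto)

lemma tame_path_join:
  assumes "tame_path g1 L1" "tame_path g2 L2" "pathfinish g1 = pathstart g2"
  shows "tame_path (g1 +++ g2) (L1 + L2)"
  unfolding tame_path_def
proof (intro conjI allI impI)
  fix h B assume h: "continuous_on (path_image (g1 +++ g2)) h" "\<forall>w\<in>path_image (g1 +++ g2). cmod (h w) \<le> B"
  have c: "continuous_on (path_image g1) h" "continuous_on (path_image g2) h"
    using h(1) assms(3) by (auto simp: path_image_join intro: continuous_on_subset)
  have *: "h contour_integrable_on g1" "cmod (contour_integral g1 h) \<le> L1 * B"
    "h contour_integrable_on g2" "cmod (contour_integral g2 h) \<le> L2 * B"
    using h(2) assms(3) by (auto simp: path_image_join tame_path_integrable[OF assms(1) c(1)] tame_path_integrable[OF assms(2) c(2)]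
      intro!: tame_path_bound[OF assms(1) c(1)] tame_path_bound[OF assms(2) c(2)])
  then show "h contour_integrable_on g1 +++ g2" using assms by (simp add: tame_path_def)
  show "cmod (contour_integral (g1 +++ g2) h) \<le> (L1 + L2) * B"
    using * assms(1,2) norm_triangle_mono[of "contour_integral g1 h" "L1 * B" "contour_integral g2 h" "L2 * B"]
    by (simp add: tame_path_def algebra_simps)
qed (use assms in \<open>auto simp: tame_path_def\<close>)

text \<open>The constant is the length of the contour: two segments of length b - a and two half
  circles of length pi c.\<close>

lemma tame_gamma_path:
  assumes "a \<le> b" "0 \<le> c"
  shows "tame_path (gamma_path a b c) (2 * (b - a) + 2 * pi * c)"
proof -
  have e: "exp (\<i> * complex_of_real (pi / 2)) = \<i>" "exp (\<i> * complex_of_real (- pi / 2)) = - \<i>"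
    "exp (\<i> * complex_of_real (3 * pi / 2)) = - \<i>"
    using cos_3over2_pi sin_3over2_pi unfolding cis_conv_exp[symmetric]
    by (simp_all add: complex_eq_iff mult.commute[of pi])
  have e1: "Complex b c = of_real b + of_real c * \<i>" "Complex b (-c) = of_real b - of_real c * \<i>"
    "Complex a c = of_real a + of_real c * \<i>" "Complex a (-c) = of_real a - of_real c * \<i>" by (simp_all add: complex_eq_iff)
  have "tame_path (gamma_path a b c) (cmod (Complex b c - Complex a c) + (c * \<bar>- pi / 2 - pi / 2\<bar> +
     (cmod (Complex a (- c) - Complex b (- c)) + c * \<bar>pi / 2 - 3 * pi / 2\<bar>)))"
    unfolding gamma_path_def
    by (intro tame_path_join tame_linepath tame_part_circlepath assms(2);
        simp only: pathfinish_part_circlepath pathstart_part_circlepath pathfinish_linepath pathstart_linepath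
          pathstart_join pathfinish_join e e1) simp_all
  moreover have "cmod (Complex b c - Complex a c) = b - a" "cmod (Complex a (- c) - Complex b (- c)) = b - a"
    using assms by (simp_all add: cmod_def)
  ultimately show ?thesis using assms by (simp add: field_simps)
qed

section \<open>Differentiation under the contour integral\<close>

lemma contour_integral_has_field_derivative:
  assumes g: "tame_path g L"
    and cont: "\<And>\<zeta>. cmod (\<zeta> - \<zeta>0) < r \<Longrightarrow> continuous_on (path_image g) (\<lambda>w. k w \<zeta>)" "continuous_on (path_image g) k'"
    and "0 < r"
    and bound: "\<And>w h. w \<in> path_image g \<Longrightarrow> cmod h < r \<Longrightarrow> cmod (k w (\<zeta>0 + h) - k w \<zeta>0 - h * k' w) \<le> M * (cmod h)\<^sup>2"
  shows "((\<lambda>\<zeta>. contour_integral g (\<lambda>w. k w \<zeta>)) has_field_derivative contour_integral g k') (at \<zeta>0)"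
  unfolding DERIV_def
proof (subst LIM_zero_iff[symmetric], rule Lim_null_comparison)
  let ?I = "\<lambda>\<zeta>. contour_integral g (\<lambda>w. k w \<zeta>)"
  show "\<forall>\<^sub>F h in at 0. cmod ((?I (\<zeta>0 + h) - ?I \<zeta>0) / h - contour_integral g k') \<le> L * M * cmod h"
    unfolding eventually_at
  proof (intro exI[of _ r] conjI ballI impI)
    fix h :: complex assume h: "h \<noteq> 0 \<and> dist h 0 < r"
    have c: "continuous_on (path_image g) (\<lambda>w. k w (\<zeta>0 + h))" "continuous_on (path_image g) (\<lambda>w. k w \<zeta>0)"
      using h \<open>0 < r\<close> by (intro cont; simp)+
    note i = tame_path_integrable[OF g c(1)] tame_path_integrable[OF g c(2)] tame_path_integrable[OF g cont(2)]
    have "contour_integral g (\<lambda>w. k w (\<zeta>0 + h) - k w \<zeta>0 - h * k' w) = ?I (\<zeta>0 + h) - ?I \<zeta>0 - h * contour_integral g k'"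
      using i by (simp add: contour_integral_diff contour_integral_lmul contour_integrable_diff contour_integrable_lmul)
    \<comment> \<open>The error in the integrand is quadratic in h uniformly on the path, so one
      power of h survives the division.\<close>
    moreover have "cmod (contour_integral g (\<lambda>w. k w (\<zeta>0 + h) - k w \<zeta>0 - h * k' w)) \<le> L * (M * (cmod h)\<^sup>2)"
      using h by (intro tame_path_bound[OF g] continuous_intros c cont(2) bound) auto
    ultimately have "cmod (?I (\<zeta>0 + h) - ?I \<zeta>0 - h * contour_integral g k') \<le> (L * M * cmod h) * cmod h"
      by (simp add: power2_eq_square mult_ac)
    then have "cmod (?I (\<zeta>0 + h) - ?I \<zeta>0 - h * contour_integral g k') / cmod h \<le> L * M * cmod h"
      using h by (simp add: divide_le_eq)
    moreover have "(?I (\<zeta>0 + h) - ?I \<zeta>0) / h - contour_integral g k' = (?I (\<zeta>0 + h) - ?I \<zeta>0 - h * contour_integral g k') / h"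
      using h by (simp add: field_simps)
    ultimately show "cmod ((?I (\<zeta>0 + h) - ?I \<zeta>0) / h - contour_integral g k') \<le> L * M * cmod h"
      by (simp add: norm_divide)
  qed (use \<open>0 < r\<close> in simp)
  show "((\<lambda>h. L * M * cmod h) \<longlongrightarrow> 0) (at 0)"
    using tendsto_mult_left[OF tendsto_norm_zero[OF tendsto_ident_at], of "L * M"] by simp
qed

text \<open>With \<tau> = - i this is the Fourier kernel on the contour; with \<tau> = i it is the
  Laplace kernel, where \<open>w\<close> runs along the ray and the parameter is the point
  z.\<close>

lemma contour_integral_exp_has_field_derivative:
  assumes g: "tame_path g L" and F: "continuous_on (path_image g) F"
  shows "((\<lambda>\<zeta>. contour_integral g (\<lambda>w. F w * exp (\<tau> * w * \<zeta>))) has_field_derivative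
    contour_integral g (\<lambda>w. F w * (\<tau> * w) * exp (\<tau> * w * \<zeta>0))) (at \<zeta>0)"
proof -
  have "compact ((\<lambda>w. F w * exp (\<tau> * w * \<zeta>0)) ` path_image g)"
    using tame_path_compact[OF g] by (intro compact_continuous_image continuous_intros F)
  then obtain B where "\<forall>x\<in>(\<lambda>w. F w * exp (\<tau> * w * \<zeta>0)) ` path_image g. cmod x \<le> B" using compact_imp_bounded bounded_iff by metis
  then have B: "\<And>w. w \<in> path_image g \<Longrightarrow> cmod (F w * exp (\<tau> * w * \<zeta>0)) \<le> B" by blast
  obtain R where R: "\<And>w. w \<in> path_image g \<Longrightarrow> cmod w \<le> R"
    using compact_imp_bounded[OF tame_path_compact[OF g]] unfolding bounded_iff by blast
  define Q where "Q = cmod \<tau> * R"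
  show ?thesis
  proof (rule contour_integral_has_field_derivative[OF g, where r = 1 and M = "B * (exp Q * Q\<^sup>2)"])
    fix w h :: complex assume w: "w \<in> path_image g" and h: "cmod h < 1"
    define x where "x = \<tau> * w * h"
    have Q: "cmod (\<tau> * w) \<le> Q" "0 \<le> Q" using R[OF w] by (auto simp: Q_def norm_mult mult_left_mono intro: order_trans[OF norm_ge_zero] mult_nonneg_nonneg)
    have x: "cmod x \<le> Q * cmod h" using Q(1) by (simp add: x_def norm_mult mult_right_mono)
    also have "\<dots> \<le> Q" using h Q(2) by (simp add: mult_left_le)
    \<comment> \<open>This uses that h has modulus below 1, and it keeps the exponential factor of
      the Taylor remainder below exp Q.\<close>
    finally have xQ: "cmod x \<le> Q" .
    have "cmod (exp x - (\<Sum>k\<le>1. x ^ k / fact k)) \<le> exp \<bar>Re x\<bar> * cmod x ^ Suc 1 / fact 1" by (rule Taylor_exp)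
    then have "cmod (exp x - 1 - x) \<le> exp \<bar>Re x\<bar> * (cmod x)\<^sup>2" by (simp add: power2_eq_square algebra_simps)
    also have "\<dots> \<le> exp Q * (Q * cmod h)\<^sup>2"
      using x xQ abs_Re_le_cmod[of x] by (intro mult_mono power_mono) auto
    finally have 1: "cmod (exp x - 1 - x) \<le> exp Q * (Q * cmod h)\<^sup>2" .
    have "F w * exp (\<tau> * w * (\<zeta>0 + h)) - F w * exp (\<tau> * w * \<zeta>0) - h * (F w * (\<tau> * w) * exp (\<tau> * w * \<zeta>0))
      = (F w * exp (\<tau> * w * \<zeta>0)) * (exp x - 1 - x)"
      by (simp add: x_def ring_distribs exp_add mult_ac)
    then have "cmod (F w * exp (\<tau> * w * (\<zeta>0 + h)) - F w * exp (\<tau> * w * \<zeta>0) - h * (F w * (\<tau> * w) * exp (\<tau> * w * \<zeta>0)))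
      = cmod (F w * exp (\<tau> * w * \<zeta>0)) * cmod (exp x - 1 - x)" by (metis norm_mult)
    also have "\<dots> \<le> B * (exp Q * (Q * cmod h)\<^sup>2)" using B[OF w] 1 by (intro mult_mono) (auto intro: order_trans[OF norm_ge_zero])
    finally show "cmod (F w * exp (\<tau> * w * (\<zeta>0 + h)) - F w * exp (\<tau> * w * \<zeta>0) - h * (F w * (\<tau> * w) * exp (\<tau> * w * \<zeta>0)))
      \<le> B * (exp Q * Q\<^sup>2) * (cmod h)\<^sup>2" by (simp add: power_mult_distrib mult_ac)
  qed (auto intro!: continuous_intros F)
qed

lemma contour_integral_cauchy_has_field_derivative:
  assumes g: "tame_path g L" and F: "continuous_on (path_image g) F" and z: "z \<notin> path_image g"
  shows "((\<lambda>z. contour_integral g (\<lambda>w. F w / (w - z))) has_field_derivative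
    contour_integral g (\<lambda>w. F w / (w - z)\<^sup>2)) (at z)"
proof -
  have ne: "path_image g \<noteq> {}" by simp
  have "closed (path_image g)" using tame_path_compact[OF g] compact_imp_closed by blast
  \<comment> \<open>Half of the distance from \<open>z\<close> to the path: increments below
    \<open>d\<close> still leave the distance at least \<open>d\<close>, which explains the constant
    M.\<close>
  then obtain d where d: "d > 0" "\<And>w. w \<in> path_image g \<Longrightarrow> 2 * d \<le> cmod (w - z)"
  proof -
    assume "closed (path_image g)" and *: "\<And>d. 0 < d \<Longrightarrow> (\<And>w. w \<in> path_image g \<Longrightarrow> 2 * d \<le> cmod (w - z)) \<Longrightarrow> thesis"
    then have "0 < infdist z (path_image g)" using z by (intro infdist_pos_not_in_closed ne)
    moreover have "infdist z (path_image g) \<le> cmod (w - z)" if "w \<in> path_image g" for w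
      using infdist_le[OF that, of z] by (simp add: dist_norm norm_minus_commute)
    ultimately show thesis using *[of "infdist z (path_image g) / 2"] by simp
  qed
  have "compact (F ` path_image g)" using tame_path_compact[OF g] F by (intro compact_continuous_image)
  then obtain B where "\<forall>x\<in>F ` path_image g. cmod x \<le> B" using compact_imp_bounded bounded_iff by metis
  then have B: "\<And>w. w \<in> path_image g \<Longrightarrow> cmod (F w) \<le> B" by blast
  show ?thesis
  proof (rule contour_integral_has_field_derivative[OF g, where r = d and M = "B / (d * (2 * d)\<^sup>2)"])
    fix \<zeta> assume "cmod (\<zeta> - z) < d"
    then have "w \<noteq> \<zeta>" if "w \<in> path_image g" for w using d(2)[OF that] d(1) by auto
    then show "continuous_on (path_image g) (\<lambda>w. F w / (w - \<zeta>))" by (intro continuous_intros F) auto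
  next
    show "continuous_on (path_image g) (\<lambda>w. F w / (w - z)\<^sup>2)" using z by (intro continuous_intros F) auto
  next
    fix w h assume w: "w \<in> path_image g" and h: "cmod h < d"
    define x where "x = w - z"
    have 2: "2 * d \<le> cmod x" using d(2)[OF w] by (simp add: x_def)
    have 1: "d \<le> cmod (x - h)" using 2 h norm_triangle_ineq2[of x h] by linarith
    have nz: "x \<noteq> 0" "x - h \<noteq> 0" using 1 2 d(1) by auto
    have "F w / (w - (z + h)) - F w / (w - z) - h * (F w / (w - z)\<^sup>2) = F w * (1 / (x - h) - 1 / x - h / x\<^sup>2)"
      by (simp add: x_def algebra_simps)
    also have "1 / (x - h) - 1 / x - h / x\<^sup>2 = h\<^sup>2 / ((x - h) * x\<^sup>2)"
      using nz by (simp add: field_simps power2_eq_square)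
    finally have "cmod (F w / (w - (z + h)) - F w / (w - z) - h * (F w / (w - z)\<^sup>2)) = cmod (F w) * ((cmod h)\<^sup>2 / (cmod (x - h) * (cmod x)\<^sup>2))"
      by (simp add: norm_mult norm_divide norm_power)
    also have "\<dots> \<le> B * ((cmod h)\<^sup>2 / (d * (2 * d)\<^sup>2))"
      using B[OF w] 1 2 d(1) by (intro mult_mono divide_left_mono power_mono mult_pos_pos) (auto intro: order_trans[OF norm_ge_zero])
    finally show "cmod (F w / (w - (z + h)) - F w / (w - z) - h * (F w / (w - z)\<^sup>2)) \<le> B / (d * (2 * d)\<^sup>2) * (cmod h)\<^sup>2" by simp
  qed (fact d(1))
qed

section \<open>Cauchy's formula around a segment\<close>

lemma continuous_on_gamma_path:
  assumes "F holomorphic_on - segment a b" "a \<le> b" "0 < c"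
  shows "continuous_on (path_image (gamma_path a b c)) F"
  using holomorphic_on_imp_continuous_on[OF assms(1)] path_image_gamma_path_subset[OF assms(2,3)]
  by (rule continuous_on_subset)

lemma contour_integral_gamma_path_indep:
  assumes "F holomorphic_on - segment a b" "a \<le> b" "0 < c" "0 < c'"
  shows "contour_integral (gamma_path a b c) F = contour_integral (gamma_path a b c') F"
proof -
  have *: "contour_integral (gamma_path a b c) F = contour_integral (gamma_path a b c') F" if "0 < c" "c \<le> c'" for c c'
    using that assms(2) by (intro contour_integral_gamma_path_eq[OF _ _ _ open_Compl_segment _ assms(1)]) auto
  consider "c \<le> c'" | "c' \<le> c" by linarith
  then show ?thesis
    by cases (rule *[OF assms(3)], assumption, rule *[OF assms(4), symmetric], assumption)
qed

lemma contour_integral_gamma_path_entire: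
  assumes "F holomorphic_on UNIV"
  shows "contour_integral (gamma_path a b c) F = 0"
  by (rule contour_integral_unique, rule Cauchy_theorem_convex_simple[OF assms]) auto

text \<open>Convex combinations of nearest points compete in the infimum, so the distance to a
  convex set is a convex function. The closed sublevel set serves as a domain for Cauchy's theorem,
  the open one as a connected set on which the winding number is constant.\<close>

lemma convex_infdist_sublevel:
  fixes K :: "'a::euclidean_space set"
  assumes "convex K" "closed K" "K \<noteq> {}"
  shows "convex {w. infdist w K \<le> c}" "convex {w. infdist w K < c}"
proof -
  have le: "infdist ((1 - t) *\<^sub>R v + t *\<^sub>R w) K \<le> (1 - t) * infdist v K + t * infdist w K"
    if t: "0 \<le> t" "t \<le> 1" for t v w
  proof -
    obtain x where x: "x \<in> K" "infdist v K = dist v x" using infdist_attains_inf[OF assms(2,3), of v] by auto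
    obtain y where y: "y \<in> K" "infdist w K = dist w y" using infdist_attains_inf[OF assms(2,3), of w] by auto
    have "(1 - t) *\<^sub>R x + t *\<^sub>R y \<in> K" using assms(1) x(1) y(1) t by (simp add: convex_alt)
    then have "infdist ((1 - t) *\<^sub>R v + t *\<^sub>R w) K \<le> dist ((1 - t) *\<^sub>R v + t *\<^sub>R w) ((1 - t) *\<^sub>R x + t *\<^sub>R y)"
      by (rule infdist_le)
    also have "\<dots> = norm ((1 - t) *\<^sub>R (v - x) + t *\<^sub>R (w - y))"
      by (simp add: dist_norm algebra_simps)
    also have "\<dots> \<le> (1 - t) * dist v x + t * dist w y"
      using norm_triangle_ineq[of "(1 - t) *\<^sub>R (v - x)" "t *\<^sub>R (w - y)"] t by (simp add: dist_norm)
    finally show ?thesis by (simp only: x(2) y(2))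
  qed
  show "convex {w. infdist w K \<le> c}"
    unfolding convex_alt
  proof (intro ballI allI impI)
    fix v w t assume h: "v \<in> {w. infdist w K \<le> c}" "w \<in> {w. infdist w K \<le> c}" "0 \<le> t \<and> t \<le> (1::real)"
    have "(1 - t) * infdist v K + t * infdist w K \<le> c" using h by (intro convex_bound_le) auto
    then show "(1 - t) *\<^sub>R v + t *\<^sub>R w \<in> {w. infdist w K \<le> c}" using le[of t v w] h by simp
  qed
  show "convex {w. infdist w K < c}"
    unfolding convex_alt
  proof (intro ballI allI impI)
    fix v w t assume h: "v \<in> {w. infdist w K < c}" "w \<in> {w. infdist w K < c}" "0 \<le> t \<and> t \<le> (1::real)"
    have "(1 - t) * infdist v K + t * infdist w K < c" using h by (intro convex_bound_lt) auto
    then show "(1 - t) *\<^sub>R v + t *\<^sub>R w \<in> {w. infdist w K < c}" using le[of t v w] h by simp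
  qed
qed

lemma segment_nonempty: "a \<le> b \<Longrightarrow> segment a b \<noteq> {}"
  by simp

text \<open>The contour lies in a convex sublevel set that misses \<open>z\<close>, where the Cauchy
  kernel is holomorphic.\<close>

lemma winding_number_gamma_path_outside:
  assumes "a \<le> b" "0 < c" "c < infdist z (segment a b)"
  shows "contour_integral (gamma_path a b c) (\<lambda>w. 1 / (w - z)) = 0"
proof -
  define S where "S = {w. infdist w (segment a b) \<le> c}"
  have "convex S" unfolding S_def
    by (rule convex_infdist_sublevel[OF convex_segment closed_segment_real segment_nonempty[OF assms(1)]])
  have zS: "z \<notin> S" using assms(3) by (simp add: S_def)
  have "path_image (gamma_path a b c) \<subseteq> S"
    using infdist_gamma_path[OF assms(1) less_imp_le[OF assms(2)]] by (simp add: S_def subset_iff)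
  moreover have "w - z \<noteq> 0" if "w \<in> S" for w using zS that by auto
  then have "(\<lambda>w. 1 / (w - z)) holomorphic_on S" by (intro holomorphic_intros)
  ultimately show ?thesis using \<open>convex S\<close>
    by (intro contour_integral_unique Cauchy_theorem_convex_simple[of _ S]) simp_all
qed

lemma contour_integral_part_circlepath_center:
  assumes "0 < r"
  shows "contour_integral (part_circlepath z r s t) (\<lambda>w. 1 / (w - z)) = \<i> * of_real (t - s)"
proof -
  have "contour_integral (part_circlepath z r s t) (\<lambda>w. 1 / (w - z)) = integral {0..1} (\<lambda>x::real. \<i> * of_real (t - s))"
    unfolding contour_integral_integral vector_derivative_part_circlepath
    by (rule integral_cong) (use assms in \<open>simp add: part_circlepath_def\<close>)
  then show ?thesis by simp
qed

text \<open>For a degenerate segment the straight pieces are constant and the two half circles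
  contribute - pi i each, the sign coming from the clockwise orientation.\<close>

lemma winding_number_gamma_path_center:
  assumes "0 < c"
  shows "contour_integral (gamma_path x x c) (\<lambda>w. 1 / (w - of_real x)) = - (2 * pi * \<i>)"
proof -
  let ?f = "\<lambda>w. 1 / (w - complex_of_real x)"
  have t: "tame_path (gamma_path x x c) (2 * (x - x) + 2 * pi * c)"
    by (rule tame_gamma_path) (use assms in auto)
  have "continuous_on (path_image (gamma_path x x c)) ?f"
    using path_image_gamma_path_subset[of x x c] assms by (intro continuous_intros) auto
  then have i: "?f contour_integrable_on gamma_path x x c" by (rule tame_path_integrable[OF t])
  define l1 where "l1 = linepath (Complex x c) (Complex x c)"
  define l2 where "l2 = linepath (Complex x (- c)) (Complex x (- c))"
  define g1 where "g1 = part_circlepath (complex_of_real x) c (pi / 2) (- pi / 2)"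
  define g2 where "g2 = part_circlepath (complex_of_real x) c (3 * pi / 2) (pi / 2)"
  have g: "gamma_path x x c = l1 +++ g1 +++ l2 +++ g2" unfolding gamma_path_def l1_def l2_def g1_def g2_def ..
  have v: "valid_path (l1 +++ g1 +++ l2 +++ g2)" using valid_path_gamma_path g by metis
  have v1: "valid_path l1" "valid_path g1" "valid_path l2" "valid_path g2" by (simp_all add: l1_def l2_def g1_def g2_def)
  have e: "pathfinish l2 = pathstart g2" "pathfinish g1 = pathstart (l2 +++ g2)"
    using cos_3over2_pi sin_3over2_pi
    by (simp_all add: l1_def l2_def g1_def g2_def) (simp_all add: complex_eq_iff Re_exp Im_exp mult.commute[of pi])
  have v2: "valid_path (l2 +++ g2)" "valid_path (g1 +++ l2 +++ g2)" using v1 e by auto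
  have "contour_integral (gamma_path x x c) ?f = contour_integral l1 ?f + (contour_integral g1 ?f + (contour_integral l2 ?f + contour_integral g2 ?f))"
    using i v1 v2 unfolding g by simp
  also have "\<dots> = 0 + (\<i> * of_real (- pi / 2 - pi / 2) + (0 + \<i> * of_real (pi / 2 - 3 * pi / 2)))"
    unfolding g1_def g2_def contour_integral_part_circlepath_center[OF assms] l1_def l2_def by simp
  finally show ?thesis by (simp add: field_simps)
qed

text \<open>The winding number is first carried from \<open>z\<close> to the endpoint
  \<open>a\<close> inside the open sublevel set; then the segment is shrunk to \<open>a\<close>,
  which turns the contour into a circle.\<close>

lemma winding_number_gamma_path_inside:
  assumes "a \<le> b" "0 < c" "infdist z (segment a b) < c"
  shows "contour_integral (gamma_path a b c) (\<lambda>w. 1 / (w - z)) = - (2 * pi * \<i>)"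
proof -
  define S where "S = {w. infdist w (segment a b) < c}"
  have "convex S" unfolding S_def
    by (rule convex_infdist_sublevel[OF convex_segment closed_segment_real segment_nonempty[OF assms(1)]])
  have "w \<notin> path_image (gamma_path a b c)" if "w \<in> S" for w
    using infdist_gamma_path[OF assms(1) less_imp_le[OF assms(2)], of w] that by (auto simp: S_def)
  then have disj: "S \<inter> path_image (gamma_path a b c) = {}" by blast
  have "of_real a \<in> segment a b" using assms(1) by simp
  then have aS: "of_real a \<in> S" unfolding S_def using assms(2) by simp
  have zS: "z \<in> S" using assms(3) by (simp add: S_def)
  have "winding_number (gamma_path a b c) z = winding_number (gamma_path a b c) (of_real a)"
    by (rule winding_number_eq[OF _ _ zS aS _ disj]) (use \<open>convex S\<close> in \<open>auto intro: convex_connected\<close>)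
  \<comment> \<open>Here the right endpoint is interpolated. The intermediate contours surround the
    segments from \<open>a\<close> to \<open>d\<close>, which contain \<open>a\<close>, and
    therefore avoid it.\<close>
  also have "\<dots> = winding_number (gamma_path a a c) (of_real a)"
  proof (rule winding_number_homotopic_loops, rule homotopic_loops_linear)
    fix t :: real assume t: "t \<in> {0..1}"
    show "closed_segment (gamma_path a b c t) (gamma_path a a c t) \<subseteq> - {complex_of_real a}"
    proof
      fix w assume "w \<in> closed_segment (gamma_path a b c t) (gamma_path a a c t)"
      then have "\<exists>u. 0 \<le> u \<and> u \<le> 1 \<and> w = (1 - u) *\<^sub>R gamma_path a b c t + u *\<^sub>R gamma_path a a c t"
        by (simp only: in_segment)
      then obtain u where u: "0 \<le> u" "u \<le> 1" "w = (1 - u) *\<^sub>R gamma_path a b c t + u *\<^sub>R gamma_path a a c t" by blast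
      define d where "d = (1 - u) * b + u * a"
      have "d = a + (1 - u) * (b - a)" by (simp add: d_def algebra_simps)
      then have d: "a \<le> d" using u assms(1) by simp
      have "w = gamma_path a d c t"
        unfolding u(3) gamma_path_affine[of a b c t] gamma_path_affine[of a a c t] gamma_path_affine[of a d c t]
        by (simp add: d_def scaleR_conv_of_real algebra_simps)
      then have "w \<in> path_image (gamma_path a d c)" using t by (simp add: path_image_def)
      then have "w \<notin> segment a d" using path_image_gamma_path_subset[OF d assms(2)] by blast
      then show "w \<in> - {complex_of_real a}" using d by auto
    qed
  qed auto
  finally have 1: "winding_number (gamma_path a b c) z = winding_number (gamma_path a a c) (of_real a)" .
  have "z \<notin> path_image (gamma_path a b c)" using disj zS by blast
  moreover have "of_real a \<notin> path_image (gamma_path a a c)" using path_image_gamma_path_subset[of a a c] assms(2) by auto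
  ultimately show ?thesis
    using 1 winding_number_gamma_path_center[OF assms(2), of a] by (simp add: winding_number_valid_path divide_eq_eq)
qed

text \<open>The difference quotient of \<open>F\<close> at \<open>z\<close> is holomorphic off the
  segment, so its integrals over both contours agree. Splitting it leaves F z times the two winding
  integrals, which are 0 for the inner and - 2 pi i for the outer contour.\<close>

lemma cauchy_decomposition:
  assumes F: "F holomorphic_on - segment a b" and "a \<le> b" "0 < c" "c < infdist z (segment a b)" "infdist z (segment a b) < C"
  shows "2 * pi * \<i> * F z = contour_integral (gamma_path a b c) (\<lambda>w. F w / (w - z)) - contour_integral (gamma_path a b C) (\<lambda>w. F w / (w - z))"
proof -
  have "0 < C" using assms by simp
  define g where "g w = (if w = z then deriv F z else (F w - F z) / (w - z))" for w
  have "g holomorphic_on - segment a b" unfolding g_def by (rule pole_lemma_open[OF F open_Compl_segment])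
  then have eq: "contour_integral (gamma_path a b c) g = contour_integral (gamma_path a b C) g"
    using assms \<open>0 < C\<close> by (intro contour_integral_gamma_path_indep)
  have split: "contour_integral (gamma_path a b d) g = contour_integral (gamma_path a b d) (\<lambda>w. F w / (w - z)) - F z * contour_integral (gamma_path a b d) (\<lambda>w. 1 / (w - z))"
    if "0 < d" "d \<noteq> infdist z (segment a b)" for d
  proof -
    have zn: "z \<notin> path_image (gamma_path a b d)" using infdist_gamma_path[of a b d z] that assms(2) by auto
    have t: "tame_path (gamma_path a b d) (2 * (b - a) + 2 * pi * d)" using that assms(2) by (intro tame_gamma_path) auto
    note cF = continuous_on_gamma_path[OF F assms(2) that(1)]
    have i: "(\<lambda>w. F w / (w - z)) contour_integrable_on gamma_path a b d" "(\<lambda>w. 1 / (w - z)) contour_integrable_on gamma_path a b d"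
      using zn by (intro tame_path_integrable[OF t] continuous_intros cF; auto)+
    have "contour_integral (gamma_path a b d) g = contour_integral (gamma_path a b d) (\<lambda>w. F w / (w - z) - F z * (1 / (w - z)))"
      using zn by (intro contour_integral_cong) (auto simp: g_def diff_divide_distrib)
    then show ?thesis using i by (simp add: contour_integral_diff contour_integral_lmul contour_integrable_lmul del: times_divide_eq_right mult_1_right)
  qed
  have "contour_integral (gamma_path a b c) (\<lambda>w. F w / (w - z)) - F z * 0 = contour_integral (gamma_path a b C) (\<lambda>w. F w / (w - z)) - F z * (- (2 * pi * \<i>))"
    using eq split[of c] split[of C] assms \<open>0 < C\<close> winding_number_gamma_path_outside[of a b c z] winding_number_gamma_path_inside[of a b C z] by simp
  then show ?thesis by (simp add: algebra_simps)
qed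

text \<open>For the nearest point y, the imaginary part of (z - w) u is the inner product of z - y
  and z - w divided by the distance d. The projection inequality for convex sets bounds it below by
  d.\<close>

lemma exists_separating_direction:
  assumes "a \<le> b" "z \<notin> segment a b"
  shows "\<exists>u. cmod u = 1 \<and> (\<forall>w\<in>segment a b. infdist z (segment a b) \<le> Im ((z - w) * u))"
proof -
  define d where "d = infdist z (segment a b)"
  have d: "0 < d" unfolding d_def by (rule infdist_segment_pos[OF assms])
  obtain y where y: "y \<in> segment a b" "d = dist z y"
    unfolding d_def by (rule infdist_segment_attained[OF assms(1)])
  define u where "u = \<i> * cnj (z - y) / of_real d"
  have "cmod u = 1" using d y(2) by (simp add: u_def norm_mult norm_divide dist_norm del: complex_cnj_diff)
  moreover have "d \<le> Im ((z - w) * u)" if w: "w \<in> segment a b" for w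
  proof -
    have "(z - y) \<bullet> (w - y) \<le> 0"
    proof (rule any_closest_point_dot[OF convex_segment closed_segment_real y(1) w], rule ballI)
      fix x assume "x \<in> segment a b"
      then show "dist z y \<le> dist z x" using infdist_le[of x "segment a b" z] y(2) unfolding d_def by linarith
    qed
    moreover have "(z - y) \<bullet> (z - y) = d * d" using y(2) by (simp add: dist_norm power2_norm_eq_inner flip: power2_eq_square)
    moreover have "(z - y) \<bullet> (z - w) = (z - y) \<bullet> (z - y) - (z - y) \<bullet> (w - y)" by (simp add: inner_diff_right)
    ultimately have "d * d \<le> (z - y) \<bullet> (z - w)" by simp
    moreover have "Im ((z - w) * u) = ((z - y) \<bullet> (z - w)) / d"
      using d by (simp add: u_def inner_complex_def add_divide_distrib algebra_simps)
    ultimately show ?thesis using d by (simp add: le_divide_eq)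
  qed
  ultimately show ?thesis unfolding d_def by blast
qed

text \<open>Let A be the Fourier transform of F(w) / (w - z). Writing w = (w - z) + z and using that
  the transform of \<open>F\<close> vanishes gives A' = - i z A, so exp(i z T) A(T) is constant. Its
  integrand contains exp(i (z - w) T), which decays when T moves in a direction separating
  \<open>z\<close> from the contour; hence the constant A(0) is zero.\<close>

lemma fourier_zero_imp_cauchy_zero:
  assumes F: "F holomorphic_on - segment a b" and "a \<le> b" "0 < c" "c < infdist z (segment a b)"
    and zero: "\<And>\<zeta>. contour_integral (gamma_path a b c) (\<lambda>w. F w * exp (- \<i> * w * \<zeta>)) = 0"
  shows "contour_integral (gamma_path a b c) (\<lambda>w. F w / (w - z)) = 0"
proof -
  let ?g = "gamma_path a b c"
  define L where "L = 2 * (b - a) + 2 * pi * c"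
  define d where "d = infdist z (segment a b)"
  have t: "tame_path ?g L" unfolding L_def using assms(2,3) by (intro tame_gamma_path) auto
  have zn: "z \<notin> path_image ?g" using infdist_gamma_path[of a b c z] assms(2-4) by auto
  have nz: "w \<noteq> z" if "w \<in> path_image ?g" for w using zn that by auto
  note cF = continuous_on_gamma_path[OF F assms(2,3)]
  define F1 where "F1 w = F w / (w - z)" for w
  have cF1: "continuous_on (path_image ?g) F1" unfolding F1_def using nz by (intro continuous_intros cF) auto
  define A where "A T = contour_integral ?g (\<lambda>w. F1 w * exp (- \<i> * w * T))" for T
  have A': "(A has_field_derivative contour_integral ?g (\<lambda>w. F1 w * (- \<i> * w) * exp (- \<i> * w * T))) (at T)" for T
    unfolding A_def using contour_integral_exp_has_field_derivative[OF t cF1, of "- \<i>"] .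
  have int: "contour_integral ?g (\<lambda>w. F1 w * (- \<i> * w) * exp (- \<i> * w * T)) = - \<i> * z * A T" for T
  proof -
    have "contour_integral ?g (\<lambda>w. F1 w * (- \<i> * w) * exp (- \<i> * w * T))
      = contour_integral ?g (\<lambda>w. - \<i> * (F w * exp (- \<i> * w * T)) + (- \<i> * z) * (F1 w * exp (- \<i> * w * T)))"
    proof (rule contour_integral_cong)
      fix w assume "w \<in> path_image ?g"
      then have FF1: "F w = F1 w * (w - z)" using nz by (simp add: F1_def)
      show "F1 w * (- \<i> * w) * exp (- \<i> * w * T) = - \<i> * (F w * exp (- \<i> * w * T)) + (- \<i> * z) * (F1 w * exp (- \<i> * w * T))"
        unfolding FF1 by (simp add: algebra_simps)
    qed simp
    also have "\<dots> = - \<i> * contour_integral ?g (\<lambda>w. F w * exp (- \<i> * w * T)) + (- \<i> * z) * A T"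
    proof -
      have "(\<lambda>w. F w * exp (- \<i> * w * T)) contour_integrable_on ?g" "(\<lambda>w. F1 w * exp (- \<i> * w * T)) contour_integrable_on ?g"
        by (intro tame_path_integrable[OF t] continuous_intros cF cF1)+
      then show ?thesis unfolding A_def
        by (simp only: contour_integral_add contour_integral_lmul contour_integrable_lmul)
    qed
    finally show ?thesis using zero by simp
  qed
  have "((\<lambda>T. exp (\<i> * z * T) * A T) has_field_derivative 0) (at T)" for T
    by (rule derivative_eq_intros A' refl)+ (simp only: int, simp add: algebra_simps)
  then have const: "exp (\<i> * z * T) * A T = A 0" for T
    using has_field_derivative_zero_constant[of UNIV "\<lambda>T. exp (\<i> * z * T) * A T"] by (metis UNIV_I convex_UNIV exp_zero mult_1 mult_zero_right)
  have "d > c" "z \<notin> segment a b" using assms(2-4) by (auto simp: d_def)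
  obtain u where u: "cmod u = 1" "\<And>w. w \<in> segment a b \<Longrightarrow> d \<le> Im ((z - w) * u)"
    using exists_separating_direction[OF assms(2) \<open>z \<notin> segment a b\<close>] unfolding d_def by blast
  \<comment> \<open>The contour is at distance \<open>c\<close> from the segment, so of the margin
    \<open>d\<close> at least d - c remains.\<close>
  have sep: "d - c \<le> Im ((z - w) * u)" if w: "w \<in> path_image ?g" for w
  proof -
    have "infdist w (segment a b) = c" using w assms(2,3) by (intro infdist_gamma_path) auto
    moreover obtain y where "y \<in> segment a b" "infdist w (segment a b) = dist w y"
      by (rule infdist_segment_attained[OF assms(2)])
    ultimately have y: "y \<in> segment a b" "dist w y = c" by simp_all
    have "Im ((w - y) * u) \<le> cmod ((w - y) * u)" using abs_Im_le_cmod[of "(w - y) * u"] by linarith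
    also have "\<dots> = c" using y u by (simp add: norm_mult dist_norm)
    finally have "Im ((w - y) * u) \<le> c" .
    moreover have "(z - w) * u = (z - y) * u - (w - y) * u" by (simp add: algebra_simps)
    ultimately show ?thesis using u(2)[OF y(1)] by simp
  qed
  have "compact (F1 ` path_image ?g)" using tame_path_compact[OF t] cF1 by (intro compact_continuous_image)
  then obtain B where "\<forall>x\<in>F1 ` path_image ?g. cmod x \<le> B" using compact_imp_bounded bounded_iff by metis
  then have B: "\<And>w. w \<in> path_image ?g \<Longrightarrow> cmod (F1 w) \<le> B" by blast
  have bound: "cmod (A 0) \<le> L * (B * exp (- (d - c)) ^ n)" for n
  proof -
    define T where "T = of_nat n * u"
    have "A 0 = exp (\<i> * z * T) * A T" by (rule const[symmetric])
    also have "\<dots> = contour_integral ?g (\<lambda>w. exp (\<i> * z * T) * (F1 w * exp (- \<i> * w * T)))"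
      unfolding A_def by (intro contour_integral_lmul[symmetric] tame_path_integrable[OF t] continuous_intros cF1)
    also have "cmod \<dots> \<le> L * (B * exp (- (d - c)) ^ n)"
    proof (intro tame_path_bound[OF t] continuous_intros cF1)
      fix w assume w: "w \<in> path_image ?g"
      have "cmod (exp (\<i> * z * T) * exp (- \<i> * w * T)) = exp (- real n * Im ((z - w) * u))"
        by (simp add: T_def flip: exp_add) (simp add: algebra_simps)
      also have "\<dots> \<le> exp (- real n * (d - c))" using sep[OF w] by (simp add: mult_left_mono)
      also have "\<dots> = exp (- (d - c)) ^ n" by (simp add: exp_of_nat_mult[symmetric] algebra_simps)
      finally have "cmod (exp (\<i> * z * T) * exp (- \<i> * w * T)) \<le> exp (- (d - c)) ^ n" .
      then have "cmod (F1 w) * cmod (exp (\<i> * z * T) * exp (- \<i> * w * T)) \<le> B * exp (- (d - c)) ^ n"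
        using B[OF w] by (intro mult_mono) (auto intro: order_trans[OF norm_ge_zero])
      then show "cmod (exp (\<i> * z * T) * (F1 w * exp (- \<i> * w * T))) \<le> B * exp (- (d - c)) ^ n"
        by (simp add: norm_mult mult_ac)
    qed
    finally show ?thesis .
  qed
  have "(\<lambda>n. L * (B * exp (- (d - c)) ^ n)) \<longlonglongrightarrow> L * (B * 0)"
    using \<open>d > c\<close> by (intro tendsto_intros LIMSEQ_power_zero) auto
  then have "cmod (A 0) \<le> 0" using bound by (intro LIMSEQ_le_const[of _ 0]) auto
  then show ?thesis by (simp add: A_def F1_def)
qed

section \<open>The Laplace transform of entire functions of exponential type\<close>

lemma Im_mult_real_le_H_fun:
  assumes "w \<in> segment a b"
  shows "Im (w * \<zeta>) \<le> H_fun a b (Im \<zeta>)"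
proof -
  obtain x where x: "a \<le> x" "x \<le> b" "w = of_real x" using assms by auto
  then have "x * Im \<zeta> \<le> max (a * Im \<zeta>) (b * Im \<zeta>)"
    by (cases "0 \<le> Im \<zeta>") (auto simp: le_max_iff_disj mult_right_mono mult_right_mono_neg)
  then show ?thesis using x H_fun_eq_max[of a b] by simp
qed

text \<open>Replaces the supremum by a single point of the segment, chosen for the given \<zeta>;
  separation inequalities, which hold for all points of the segment, then apply to it.\<close>

lemma H_fun_attained:
  assumes "a \<le> b"
  obtains w where "w \<in> segment a b" "H_fun a b (Im \<zeta>) = Im (w * \<zeta>)"
proof -
  have "H_fun a b (Im \<zeta>) = Im (of_real a * \<zeta>) \<or> H_fun a b (Im \<zeta>) = Im (of_real b * \<zeta>)"
    using H_fun_eq_max[OF assms, of "Im \<zeta>"] by (simp add: max_def)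
  moreover have "of_real a \<in> segment a b" "of_real b \<in> segment a b" using assms by auto
  ultimately show thesis using that by blast
qed

lemma H_fun_add_le:
  assumes "a \<le> b"
  shows "H_fun a b (s + t) \<le> H_fun a b s + (\<bar>a\<bar> + \<bar>b\<bar>) * \<bar>t\<bar>"
proof -
  have "x * t \<le> (\<bar>a\<bar> + \<bar>b\<bar>) * \<bar>t\<bar>" if "x = a \<or> x = b" for x
  proof -
    have "x * t \<le> \<bar>x\<bar> * \<bar>t\<bar>" by (metis abs_ge_self abs_mult)
    also have "\<dots> \<le> (\<bar>a\<bar> + \<bar>b\<bar>) * \<bar>t\<bar>" using that by (intro mult_right_mono) auto
    finally show ?thesis .
  qed
  then have "a * t \<le> (\<bar>a\<bar> + \<bar>b\<bar>) * \<bar>t\<bar>" "b * t \<le> (\<bar>a\<bar> + \<bar>b\<bar>) * \<bar>t\<bar>" by blast+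
  then show ?thesis unfolding H_fun_eq_max[OF assms] by (simp add: distrib_left max_def)
qed

text \<open>For \<zeta> = t u with t nonnegative it says that Im (z \<zeta>) exceeds the indicator
  \<open>H_fun\<close> at Im \<zeta> by at least m t. So \<open>m\<close> is the exponential rate by
  which the kernel exp(i z \<zeta>) wins along the ray.\<close>

definition separates :: "real \<Rightarrow> real \<Rightarrow> complex \<Rightarrow> complex \<Rightarrow> real \<Rightarrow> bool" where
  "separates a b z u m \<longleftrightarrow> cmod u = 1 \<and> (\<forall>w\<in>segment a b. m \<le> Im ((z - w) * u))"

definition growth_bound :: "real \<Rightarrow> real \<Rightarrow> (complex \<Rightarrow> complex) \<Rightarrow> real \<Rightarrow> real \<Rightarrow> bool" where
  "growth_bound a b f C \<epsilon> \<longleftrightarrow> (\<forall>\<zeta>. cmod (f \<zeta>) \<le> C * exp (\<epsilon> * cmod \<zeta> + H_fun a b (Im \<zeta>)))"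

lemma growth_bound_nonneg:
  assumes "growth_bound a b f C \<epsilon>"
  shows "0 \<le> C"
proof -
  have "0 \<le> C * exp (\<epsilon> * cmod 0 + H_fun a b (Im 0))"
    using assms norm_ge_zero order_trans unfolding growth_bound_def by blast
  then show ?thesis by (simp add: zero_le_mult_iff)
qed

text \<open>Two directions are treated together because separation is preserved in the cone they
  span. With t = 0 this is decay along a ray; with s + t fixed it is smallness on the segment
  joining two rays.\<close>

lemma growth_bound_cone:
  assumes "a \<le> b" and f: "growth_bound a b f C \<epsilon>" and "0 \<le> \<epsilon>" "0 \<le> s" "0 \<le> t"
    and "separates a b z u m" "separates a b z v m"
  shows "cmod (f (s * u + t * v) * exp (\<i> * z * (s * u + t * v))) \<le> C * exp (- (m - \<epsilon>) * (s + t))"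
proof -
  define \<zeta> where "\<zeta> = s * u + t * v"
  \<comment> \<open>The extremal point depends on \<zeta>, but both separation inequalities hold at
    it.\<close>
  obtain w where w: "w \<in> segment a b" "H_fun a b (Im \<zeta>) = Im (w * \<zeta>)" using H_fun_attained[OF assms(1)] by blast
  have "cmod \<zeta> \<le> cmod (s * u) + cmod (t * v)" unfolding \<zeta>_def by (rule norm_triangle_ineq)
  then have "cmod \<zeta> \<le> s + t" using assms by (simp add: separates_def norm_mult)
  then have 1: "\<epsilon> * cmod \<zeta> \<le> \<epsilon> * (s + t)" using assms by (intro mult_left_mono)
  have "m \<le> Im ((z - w) * u)" "m \<le> Im ((z - w) * v)" using assms w by (auto simp: separates_def)
  then have "s * m + t * m \<le> s * Im ((z - w) * u) + t * Im ((z - w) * v)"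
    using assms by (intro add_mono mult_left_mono) auto
  also have "\<dots> = Im ((z - w) * \<zeta>)" by (simp add: \<zeta>_def algebra_simps)
  finally have 2: "s * m + t * m \<le> Im (z * \<zeta>) - Im (w * \<zeta>)" by (simp add: algebra_simps)
  have "cmod (f \<zeta> * exp (\<i> * z * \<zeta>)) = cmod (f \<zeta>) * exp (- Im (z * \<zeta>))"
    by (simp add: norm_mult mult.assoc)
  also have "\<dots> \<le> C * exp (\<epsilon> * cmod \<zeta> + H_fun a b (Im \<zeta>)) * exp (- Im (z * \<zeta>))"
    using f by (intro mult_right_mono) (auto simp: growth_bound_def)
  also have "\<dots> = C * exp (\<epsilon> * cmod \<zeta> + Im (w * \<zeta>) - Im (z * \<zeta>))"
    by (simp add: w(2) mult.assoc flip: exp_add)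
  also have "\<dots> \<le> C * exp (- (m - \<epsilon>) * (s + t))"
    using 1 2 growth_bound_nonneg[OF f] by (intro mult_left_mono) (auto simp: algebra_simps)
  finally show ?thesis unfolding \<zeta>_def .
qed

text \<open>Laplace integrals truncated at integer lengths: the completeness available in
  \<open>E\<close> concerns sequences, and integer steps give a geometric rate.\<close>

definition laplace_seq :: "(complex \<Rightarrow> complex) \<Rightarrow> complex \<Rightarrow> complex \<Rightarrow> nat \<Rightarrow> complex" where
  "laplace_seq f z u N = contour_integral (linepath 0 (of_nat N * u)) (\<lambda>\<zeta>. f \<zeta> * exp (\<i> * z * \<zeta>))"

text \<open>A primitive turns integrals over segments into differences of values, so Cauchy's
  theorem for triangles becomes a cancellation.\<close>

lemma contour_integral_linepath_entire:
  assumes "g holomorphic_on UNIV"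
  shows "\<exists>G. \<forall>x y. contour_integral (linepath x y) g = G y - G x"
proof -
  obtain G where G: "\<And>x. x \<in> UNIV \<Longrightarrow> (G has_field_derivative g x) (at x within UNIV)"
    using holomorphic_convex_primitive'[OF convex_UNIV open_UNIV assms] by blast
  have "contour_integral (linepath x y) g = G y - G x" for x y
    using contour_integral_unique[OF contour_integral_primitive[of UNIV G g "linepath x y"]] G by simp
  then show ?thesis by blast
qed

text \<open>Comparison with the explicit integral of C exp(- \<kappa> t) from N to M, whose upper
  limit contributes with a negative sign and is dropped.\<close>

lemma contour_integral_linepath_exp_bound:
  assumes "N \<le> M" "0 < \<kappa>" "cmod u = 1"
    and cont: "continuous_on UNIV g"
    and bound: "\<And>t. N \<le> t \<Longrightarrow> cmod (g (of_real t * u)) \<le> C * exp (- \<kappa> * t)"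
  shows "cmod (contour_integral (linepath (of_real N * u) (of_real M * u)) g) \<le> C / \<kappa> * exp (- \<kappa> * N)"
proof -
  have C: "0 \<le> C" using order_trans[OF norm_ge_zero bound[of N]] by (simp add: zero_le_mult_iff)
  define x where "x t = N + (M - N) * t" for t
  have lp: "linepath (of_real N * u) (of_real M * u) t = of_real (x t) * u" for t
    by (simp add: linepath_def x_def scaleR_conv_of_real algebra_simps)
  have ci: "(\<lambda>t. g (linepath (of_real N * u) (of_real M * u) t) * (of_real M * u - of_real N * u)) integrable_on {0..1}"
    by (intro integrable_continuous_real continuous_intros continuous_on_compose2[OF cont]) auto
  have der: "((\<lambda>t. - (C / \<kappa>) * exp (- \<kappa> * x t)) has_vector_derivative (C * exp (- \<kappa> * x t)) * (M - N)) (at t within {0..1})" for t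
    unfolding x_def has_real_derivative_iff_has_vector_derivative[symmetric]
    by (rule derivative_eq_intros refl)+ (use assms(2) in \<open>simp add: field_simps\<close>)
  have hi: "((\<lambda>t. (C * exp (- \<kappa> * x t)) * (M - N)) has_integral (- (C / \<kappa>) * exp (- \<kappa> * x 1) - (- (C / \<kappa>) * exp (- \<kappa> * x 0)))) {0..1}"
    by (rule fundamental_theorem_of_calculus) (use der in auto)
  have "cmod (contour_integral (linepath (of_real N * u) (of_real M * u)) g)
      = norm (integral {0..1} (\<lambda>t. g (linepath (of_real N * u) (of_real M * u) t) * (of_real M * u - of_real N * u)))"
    by (simp add: contour_integral_integral)
  also have "\<dots> \<le> integral {0..1} (\<lambda>t. (C * exp (- \<kappa> * x t)) * (M - N))"
  proof (rule integral_norm_bound_integral[OF ci])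
    show "(\<lambda>t. C * exp (- \<kappa> * x t) * (M - N)) integrable_on {0..1}" using hi by blast
    fix t :: real assume t: "t \<in> {0..1}"
    have "N \<le> x t" using t assms(1) by (simp add: x_def)
    then have "cmod (g (of_real (x t) * u)) \<le> C * exp (- \<kappa> * x t)" by (rule bound)
    moreover have "cmod (of_real M * u - of_real N * u) = M - N"
      using assms(1,3) by (simp add: norm_mult flip: left_diff_distrib of_real_diff)
    ultimately show "norm (g (linepath (of_real N * u) (of_real M * u) t) * (of_real M * u - of_real N * u)) \<le> (C * exp (- \<kappa> * x t)) * (M - N)"
      unfolding lp norm_mult using assms(1) by (simp add: mult_right_mono)
  qed
  also have "\<dots> = (- (C / \<kappa>) * exp (- \<kappa> * x 1) - (- (C / \<kappa>) * exp (- \<kappa> * x 0)))" using hi by (rule integral_unique)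
  also have "\<dots> \<le> C / \<kappa> * exp (- \<kappa> * N)" using C assms(2) by (simp add: x_def)
  finally show ?thesis .
qed

text \<open>The ratio of the geometric rate depends only on the margin and on \<epsilon>, and the
  function enters only through \<open>C\<close>. This is the shape that
  \<open>weak_limit_exists\<close> needs.\<close>

lemma laplace_seq_diff:
  assumes "a \<le> b" and f: "f holomorphic_on UNIV" "growth_bound a b f C \<epsilon>" and "0 \<le> \<epsilon>" "\<epsilon> < m" "separates a b z u m" "N \<le> M"
  shows "cmod (laplace_seq f z u M - laplace_seq f z u N) \<le> C / (m - \<epsilon>) * exp (- (m - \<epsilon>)) ^ N"
proof -
  let ?g = "\<lambda>\<zeta>. f \<zeta> * exp (\<i> * z * \<zeta>)"
  have hol: "?g holomorphic_on UNIV" by (intro holomorphic_intros f(1))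
  obtain G where G: "\<And>x y. contour_integral (linepath x y) ?g = G y - G x"
    using contour_integral_linepath_entire[OF hol] by auto
  have "laplace_seq f z u M - laplace_seq f z u N = contour_integral (linepath (of_real (real N) * u) (of_real (real M) * u)) ?g"
    by (simp add: laplace_seq_def G)
  also have "cmod \<dots> \<le> C / (m - \<epsilon>) * exp (- (m - \<epsilon>) * real N)"
  proof (rule contour_integral_linepath_exp_bound)
    show "continuous_on UNIV ?g" using hol by (rule holomorphic_on_imp_continuous_on)
    fix t assume "real N \<le> t"
    then have "0 \<le> t" by (meson of_nat_0_le_iff order_trans)
    then show "cmod (?g (of_real t * u)) \<le> C * exp (- (m - \<epsilon>) * t)"
      using growth_bound_cone[OF assms(1) f(2) \<open>0 \<le> \<epsilon>\<close> \<open>0 \<le> t\<close> order_refl assms(6,6)] by simp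
  qed (use assms in \<open>auto simp: separates_def\<close>)
  also have "exp (- (m - \<epsilon>) * real N) = exp (- (m - \<epsilon>)) ^ N" by (simp add: exp_of_nat_mult[symmetric] mult.commute)
  finally show ?thesis .
qed

text \<open>The difference is the integral over the third side of the triangle with vertices 0, N u,
  N v. Its length is at most 2 N, while the cone estimate with s + t = N makes the integrand
  exponentially small there.\<close>

lemma laplace_seq_directions:
  assumes "a \<le> b" and f: "f holomorphic_on UNIV" "growth_bound a b f C \<epsilon>" and "0 \<le> \<epsilon>" "\<epsilon> < m" "separates a b z u m" "separates a b z v m"
  shows "(\<lambda>N. laplace_seq f z u N - laplace_seq f z v N) \<longlonglongrightarrow> 0"
proof (rule Lim_null_comparison)
  let ?g = "\<lambda>\<zeta>. f \<zeta> * exp (\<i> * z * \<zeta>)"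
  have hol: "?g holomorphic_on UNIV" by (intro holomorphic_intros f(1))
  obtain G where G: "\<And>x y. contour_integral (linepath x y) ?g = G y - G x"
    using contour_integral_linepath_entire[OF hol] by auto
  have C: "0 \<le> C" by (rule growth_bound_nonneg[OF f(2)])
  have "cmod (laplace_seq f z u N - laplace_seq f z v N) \<le> 2 * C * (real N * exp (- (m - \<epsilon>)) ^ N)" for N
  proof -
    let ?p = "linepath (of_nat N * v) (of_nat N * u)"
    have "laplace_seq f z u N - laplace_seq f z v N = contour_integral ?p ?g" by (simp add: laplace_seq_def G)
    also have "cmod \<dots> \<le> cmod (of_nat N * u - of_nat N * v) * (C * exp (- (m - \<epsilon>)) ^ N)"
    proof (rule tame_path_bound[OF tame_linepath])
      show "continuous_on (path_image ?p) ?g"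
        using holomorphic_on_imp_continuous_on[OF hol] by (rule continuous_on_subset) simp
      fix w assume "w \<in> path_image ?p"
      then have "\<exists>x. 0 \<le> x \<and> x \<le> 1 \<and> w = (1 - x) *\<^sub>R (of_nat N * v) + x *\<^sub>R (of_nat N * u)"
        by (simp only: path_image_linepath in_segment)
      then obtain x where x: "0 \<le> x" "x \<le> 1" "w = (1 - x) *\<^sub>R (of_nat N * v) + x *\<^sub>R (of_nat N * u)" by blast
      have w: "w = of_real (x * N) * u + of_real ((1 - x) * N) * v" by (simp add: x(3) scaleR_conv_of_real)
      have "cmod (?g w) \<le> C * exp (- (m - \<epsilon>) * (x * N + (1 - x) * N))"
        unfolding w by (rule growth_bound_cone[OF assms(1) f(2) \<open>0 \<le> \<epsilon>\<close> _ _ assms(6,7)]) (use x in auto)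
      also have "x * real N + (1 - x) * real N = real N" by (simp add: algebra_simps)
      also have "exp (- (m - \<epsilon>) * real N) = exp (- (m - \<epsilon>)) ^ N" by (simp add: exp_of_nat_mult[symmetric] mult.commute)
      finally show "cmod (?g w) \<le> C * exp (- (m - \<epsilon>)) ^ N" .
    qed
    also have "cmod (of_nat N * u - of_nat N * v) \<le> 2 * real N"
      using norm_triangle_ineq4[of "of_nat N * u" "of_nat N * v"] assms by (simp add: norm_mult separates_def)
    finally show ?thesis using C by (simp add: mult_right_mono mult_ac)
  qed
  then show "\<forall>\<^sub>F N in sequentially. cmod (laplace_seq f z u N - laplace_seq f z v N) \<le> 2 * C * (real N * exp (- (m - \<epsilon>)) ^ N)" by simp
  have "(\<lambda>N. real N * exp (- (m - \<epsilon>)) ^ N) \<longlonglongrightarrow> 0" using assms by (intro powser_times_n_limit_0) auto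
  then show "(\<lambda>N. 2 * C * (real N * exp (- (m - \<epsilon>)) ^ N)) \<longlonglongrightarrow> 0" using tendsto_mult_right_zero by blast
qed

definition infra_growth :: "real \<Rightarrow> real \<Rightarrow> (complex \<Rightarrow> complex) \<Rightarrow> bool" where
  "infra_growth a b f \<longleftrightarrow> f holomorphic_on UNIV \<and> (\<forall>\<epsilon>>0. \<exists>C. growth_bound a b f C \<epsilon>)"

definition sep_dir :: "real \<Rightarrow> real \<Rightarrow> complex \<Rightarrow> complex" where
  "sep_dir a b z = (SOME u. separates a b z u (infdist z (segment a b)))"

text \<open>The particular ray chosen by \<open>sep_dir\<close> is immaterial:
  \<open>laplace_tendsto\<close> gives the same limit along every ray with positive margin.\<close>

definition laplace :: "real \<Rightarrow> real \<Rightarrow> (complex \<Rightarrow> complex) \<Rightarrow> complex \<Rightarrow> complex" where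
  "laplace a b f z = lim (laplace_seq f z (sep_dir a b z))"

lemma separates_sep_dir:
  assumes "a \<le> b" "z \<notin> segment a b"
  shows "separates a b z (sep_dir a b z) (infdist z (segment a b))"
  unfolding sep_dir_def separates_def by (rule someI_ex[OF exists_separating_direction[OF assms]])

lemma separates_mono: "separates a b z u m \<Longrightarrow> m' \<le> m \<Longrightarrow> separates a b z u m'"
  by (force simp: separates_def)

lemma laplace_tendsto:
  assumes "a \<le> b" and f: "infra_growth a b f" and "z \<notin> segment a b" "separates a b z u m" "0 < m"
  shows "laplace_seq f z u \<longlonglongrightarrow> laplace a b f z"
proof -
  define d where "d = infdist z (segment a b)"
  define u0 where "u0 = sep_dir a b z"
  have d: "0 < d" unfolding d_def by (rule infdist_segment_pos[OF assms(1,3)])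
  \<comment> \<open>A margin shared by the chosen direction and the given one; half of it is left
    for the growth of \<open>f\<close>.\<close>
  define k where "k = min d m"
  have k: "0 < k" "separates a b z u k" "separates a b z u0 k"
    using d assms separates_sep_dir[OF assms(1,3)] unfolding k_def u0_def d_def by (auto intro: separates_mono)
  obtain C where C: "growth_bound a b f C (k / 2)" and hol: "f holomorphic_on UNIV"
    using f k(1) unfolding infra_growth_def by (meson half_gt_zero)
  have "Cauchy (laplace_seq f z u0)"
  proof (rule metric_CauchyI)
    fix e :: real assume "0 < e"
    define q where "q = exp (- (k - k / 2))"
    have "(\<lambda>N. C / (k - k / 2) * q ^ N) \<longlonglongrightarrow> C / (k - k / 2) * 0"
      unfolding q_def using k(1) by (intro tendsto_intros LIMSEQ_power_zero) auto
    then have "\<forall>\<^sub>F N in sequentially. C / (k - k / 2) * q ^ N < e / 2"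
      using \<open>0 < e\<close> by (intro order_tendstoD(2)) auto
    then obtain N where "C / (k - k / 2) * q ^ N < e / 2" by (auto simp: eventually_sequentially)
    then have N: "dist (laplace_seq f z u0 n) (laplace_seq f z u0 N) < e / 2" if "n \<ge> N" for n
      using laplace_seq_diff[OF assms(1) hol C _ _ k(3) that] k(1) by (simp add: dist_norm q_def)
    show "\<exists>M. \<forall>m\<ge>M. \<forall>n\<ge>M. dist (laplace_seq f z u0 m) (laplace_seq f z u0 n) < e"
      using N dist_triangle_half_r by (metis dist_commute)
  qed
  then have "laplace_seq f z u0 \<longlonglongrightarrow> laplace a b f z"
    unfolding laplace_def u0_def by (simp add: Cauchy_convergent_iff convergent_LIMSEQ_iff)
  moreover have "(\<lambda>N. laplace_seq f z u N - laplace_seq f z u0 N) \<longlonglongrightarrow> 0"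
    by (rule laplace_seq_directions[OF assms(1) hol C _ _ k(2,3)]) (use k in auto)
  ultimately show ?thesis using tendsto_add by fastforce
qed

lemma laplace_seq_rate:
  assumes "a \<le> b" and f: "infra_growth a b f" "growth_bound a b f C \<epsilon>" and "0 \<le> \<epsilon>" "\<epsilon> < m" "z \<notin> segment a b" "separates a b z u m"
  shows "cmod (laplace a b f z - laplace_seq f z u N) \<le> C / (m - \<epsilon>) * exp (- (m - \<epsilon>)) ^ N"
proof (rule Lim_norm_ubound[OF trivial_limit_sequentially])
  show "(\<lambda>M. laplace_seq f z u M - laplace_seq f z u N) \<longlonglongrightarrow> laplace a b f z - laplace_seq f z u N"
    by (intro tendsto_intros laplace_tendsto[OF assms(1) f(1) assms(6,7)]) (use assms in auto)
  show "\<forall>\<^sub>F M in sequentially. norm (laplace_seq f z u M - laplace_seq f z u N) \<le> C / (m - \<epsilon>) * exp (- (m - \<epsilon>)) ^ N"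
    using laplace_seq_diff[OF assms(1) _ f(2) assms(4,5,7)] f(1) unfolding eventually_sequentially infra_growth_def by blast
qed

text \<open>This is the rate at N = 0, where the truncated integral vanishes. The bound depends on
  \<open>z\<close> only through its distance from the segment, so the transform is bounded off every
  neighbourhood of it.\<close>

lemma laplace_bound:
  assumes "a \<le> b" and f: "infra_growth a b f" "growth_bound a b f C \<epsilon>" and "0 \<le> \<epsilon>" "\<epsilon> < m" "m \<le> infdist z (segment a b)"
  shows "cmod (laplace a b f z) \<le> C / (m - \<epsilon>)"
proof -
  have z: "z \<notin> segment a b" using assms by auto
  have "separates a b z (sep_dir a b z) m" using separates_sep_dir[OF assms(1) z] assms(6) by (rule separates_mono)
  from laplace_seq_rate[OF assms(1-5) z this, of 0] show ?thesis by (simp add: laplace_seq_def)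
qed

text \<open>The ray chosen at \<open>z0\<close> still separates nearby points with half the margin.
  Along this fixed ray the truncated integrals are holomorphic in z and converge uniformly near
  \<open>z0\<close>.\<close>

lemma laplace_holomorphic:
  assumes "a \<le> b" and f: "infra_growth a b f"
  shows "laplace a b f holomorphic_on - segment a b"
proof -
  have *: "\<exists>U. open U \<and> z0 \<in> U \<and> laplace a b f holomorphic_on U" if z0: "z0 \<in> - segment a b" for z0
  proof -
    define d where "d = infdist z0 (segment a b)"
    have d: "0 < d" unfolding d_def using z0 by (intro infdist_segment_pos[OF assms(1)]) auto
    define u where "u = sep_dir a b z0"
    have u: "separates a b z0 u d" unfolding u_def d_def using z0 by (intro separates_sep_dir[OF assms(1)]) auto
    define U where "U = ball z0 (d / 2)"
    have sepU: "separates a b z u (d / 2)" if "z \<in> U" for z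
      unfolding separates_def
    proof (intro conjI ballI)
      show "cmod u = 1" using u by (simp add: separates_def)
      fix w assume "w \<in> segment a b"
      then have "d \<le> Im ((z0 - w) * u)" using u unfolding separates_def by blast
      moreover have "Im ((z0 - z) * u) \<le> cmod ((z0 - z) * u)" using abs_Im_le_cmod[of "(z0 - z) * u"] by linarith
      then have "Im ((z0 - z) * u) \<le> d / 2" using u that by (simp add: norm_mult separates_def U_def dist_norm)
      moreover have "(z - w) * u = (z0 - w) * u - (z0 - z) * u" by (simp add: algebra_simps)
      ultimately show "d / 2 \<le> Im ((z - w) * u)" by simp
    qed
    have Useg: "z \<notin> segment a b" if "z \<in> U" for z
    proof
      assume "z \<in> segment a b"
      then have "d / 2 \<le> Im ((z - z) * u)" using sepU[OF that] unfolding separates_def by blast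
      then show False using d by simp
    qed
    \<comment> \<open>The margin on \<open>U\<close> is d / 2, so growth at rate d / 4 leaves a
      positive exponent.\<close>
    obtain C where C: "growth_bound a b f C (d / 4)" and hol: "f holomorphic_on UNIV"
      using f d unfolding infra_growth_def by (metis divide_pos_pos zero_less_numeral)
    define q where "q = exp (- (d / 2 - d / 4))"
    have "laplace a b f holomorphic_on U"
    proof (rule holomorphic_uniform_sequence[where f = "\<lambda>N z. laplace_seq f z u N"])
      show "open U" by (simp add: U_def)
      fix N :: nat
      show "(\<lambda>z. laplace_seq f z u N) holomorphic_on U"
      proof (rule holomorphic_onI, rule field_differentiable_at_within)
        fix z
        have "((\<lambda>z. contour_integral (linepath 0 (of_nat N * u)) (\<lambda>w. f w * exp (\<i> * w * z))) has_field_derivative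
          contour_integral (linepath 0 (of_nat N * u)) (\<lambda>w. f w * (\<i> * w) * exp (\<i> * w * z))) (at z)"
          by (rule contour_integral_exp_has_field_derivative[OF tame_linepath])
            (rule continuous_on_subset[OF holomorphic_on_imp_continuous_on[OF hol]], simp)
        moreover have "(\<lambda>z. laplace_seq f z u N) = (\<lambda>z. contour_integral (linepath 0 (of_nat N * u)) (\<lambda>w. f w * exp (\<i> * w * z)))"
          unfolding laplace_seq_def by (intro ext arg_cong[of _ _ "contour_integral _"]) (simp add: mult_ac)
        ultimately show "(\<lambda>z. laplace_seq f z u N) field_differentiable at z"
          unfolding field_differentiable_def by metis
      qed
    next
      fix z assume "z \<in> U"
      moreover have "open U" by (simp add: U_def)
      ultimately obtain e where e: "0 < e" "cball z e \<subseteq> U" using open_contains_cball by meson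
      have "uniform_limit U (\<lambda>N z. laplace_seq f z u N) (laplace a b f) sequentially"
      proof (rule uniform_limitI)
        fix r :: real assume "0 < r"
        have "(\<lambda>N. C / (d / 2 - d / 4) * q ^ N) \<longlonglongrightarrow> C / (d / 2 - d / 4) * 0"
          unfolding q_def using d by (intro tendsto_intros LIMSEQ_power_zero) auto
        then have "\<forall>\<^sub>F N in sequentially. C / (d / 2 - d / 4) * q ^ N < r"
          using \<open>0 < r\<close> by (intro order_tendstoD(2)) auto
        then show "\<forall>\<^sub>F N in sequentially. \<forall>z\<in>U. dist (laplace_seq f z u N) (laplace a b f z) < r"
        proof eventually_elim
          case (elim N)
          show ?case
          proof
            fix z assume z: "z \<in> U"
            have "dist (laplace_seq f z u N) (laplace a b f z) \<le> C / (d / 2 - d / 4) * q ^ N"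
              unfolding q_def dist_norm norm_minus_commute[of "laplace_seq f z u N"]
              by (rule laplace_seq_rate[OF assms(1) f C _ _ Useg[OF z] sepU[OF z]]) (use d in auto)
            then show "dist (laplace_seq f z u N) (laplace a b f z) < r" using elim by simp
          qed
        qed
      qed
      from uniform_limit_on_subset[OF this e(2)]
      show "\<exists>e>0. cball z e \<subseteq> U \<and> uniform_limit (cball z e) (\<lambda>N z. laplace_seq f z u N) (laplace a b f) sequentially"
        using e by (intro exI[of _ e] conjI)
    qed
    then show ?thesis using d by (intro exI[of _ U]) (auto simp: U_def)
  qed
  show ?thesis
  proof (rule holomorphic_onI)
    fix z assume "z \<in> - segment a b"
    then obtain U where "open U" "z \<in> U" "laplace a b f holomorphic_on U" using * by blast
    then have "laplace a b f field_differentiable at z" using holomorphic_on_imp_differentiable_at by blast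
    then show "laplace a b f field_differentiable at z within - segment a b" by (rule field_differentiable_at_within)
  qed
qed

section \<open>Integration by parts and inversion\<close>

lemma growth_bound_deriv:
  assumes "a \<le> b" "f holomorphic_on UNIV" "growth_bound a b f C \<epsilon>" "0 \<le> \<epsilon>"
  shows "growth_bound a b (deriv f) (C * exp (\<epsilon> + \<bar>a\<bar> + \<bar>b\<bar>)) \<epsilon>"
  unfolding growth_bound_def
proof
  fix \<zeta>
  \<comment> \<open>Cauchy's inequality on the unit circle: moving by 1 raises the exponent by at
    most \<epsilon> + |a| + |b|.\<close>
  have "cmod ((deriv ^^ 1) f \<zeta>) \<le> fact 1 * (C * exp (\<epsilon> * cmod \<zeta> + H_fun a b (Im \<zeta>) + (\<epsilon> + \<bar>a\<bar> + \<bar>b\<bar>))) / 1 ^ 1"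
  proof (rule Cauchy_inequality)
    fix x assume x: "cmod (\<zeta> - x) = 1"
    have "cmod x \<le> cmod \<zeta> + 1" using norm_triangle_ineq2[of x \<zeta>] x by (simp add: norm_minus_commute)
    then have 1: "\<epsilon> * cmod x \<le> \<epsilon> * cmod \<zeta> + \<epsilon>" using mult_left_mono[of _ _ \<epsilon>] assms(4) by (fastforce simp: distrib_left)
    have "\<bar>Im x - Im \<zeta>\<bar> \<le> 1" using abs_Im_le_cmod[of "x - \<zeta>"] x by (simp add: norm_minus_commute)
    then have "(\<bar>a\<bar> + \<bar>b\<bar>) * \<bar>Im x - Im \<zeta>\<bar> \<le> \<bar>a\<bar> + \<bar>b\<bar>" by (intro mult_left_le) auto
    then have 2: "H_fun a b (Im x) \<le> H_fun a b (Im \<zeta>) + \<bar>a\<bar> + \<bar>b\<bar>" using H_fun_add_le[OF assms(1), of "Im \<zeta>" "Im x - Im \<zeta>"] by simp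
    have "cmod (f x) \<le> C * exp (\<epsilon> * cmod x + H_fun a b (Im x))" using assms(3) by (simp add: growth_bound_def)
    also have "\<dots> \<le> C * exp (\<epsilon> * cmod \<zeta> + H_fun a b (Im \<zeta>) + (\<epsilon> + \<bar>a\<bar> + \<bar>b\<bar>))"
      using 1 2 growth_bound_nonneg[OF assms(3)] by (intro mult_left_mono) auto
    finally show "cmod (f x) \<le> C * exp (\<epsilon> * cmod \<zeta> + H_fun a b (Im \<zeta>) + (\<epsilon> + \<bar>a\<bar> + \<bar>b\<bar>))" .
  qed (auto intro: holomorphic_on_subset[OF assms(2)] holomorphic_on_imp_continuous_on)
  then show "cmod (deriv f \<zeta>) \<le> C * exp (\<epsilon> + \<bar>a\<bar> + \<bar>b\<bar>) * exp (\<epsilon> * cmod \<zeta> + H_fun a b (Im \<zeta>))"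
    by (simp add: exp_add mult_ac)
qed

lemma infra_growth_deriv:
  assumes "a \<le> b" "infra_growth a b f"
  shows "infra_growth a b (deriv f)"
  using assms growth_bound_deriv[OF assms(1)] unfolding infra_growth_def
  by (meson holomorphic_deriv open_UNIV less_imp_le)

text \<open>Integration by parts along a ray: the boundary term at the far end decays by the cone
  estimate, and the one at the origin gives f 0. It trades multiplication by w for differentiation
  of \<open>f\<close>.\<close>

lemma laplace_deriv:
  assumes "a \<le> b" and f: "infra_growth a b f" and z: "z \<notin> segment a b"
  shows "- \<i> * z * laplace a b f z = f 0 + laplace a b (deriv f) z"
proof -
  define d where "d = infdist z (segment a b)"
  define u where "u = sep_dir a b z"
  have d: "0 < d" unfolding d_def by (rule infdist_segment_pos[OF assms(1,3)])
  have u: "separates a b z u d" unfolding u_def d_def by (rule separates_sep_dir[OF assms(1,3)])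
  have hol: "f holomorphic_on UNIV" using f by (simp add: infra_growth_def)
  have eq: "laplace_seq (deriv f) z u N + \<i> * z * laplace_seq f z u N = f (of_nat N * u) * exp (\<i> * z * (of_nat N * u)) - f 0" for N
  proof -
    let ?p = "linepath 0 (of_nat N * u)"
    have i: "(\<lambda>\<zeta>. deriv f \<zeta> * exp (\<i> * z * \<zeta>)) contour_integrable_on ?p" "(\<lambda>\<zeta>. f \<zeta> * exp (\<i> * z * \<zeta>)) contour_integrable_on ?p"
      by (intro contour_integrable_holomorphic_simple[where S = UNIV] holomorphic_intros hol holomorphic_deriv[OF hol]; simp)+
    have "((\<lambda>\<zeta>. f \<zeta> * exp (\<i> * z * \<zeta>)) has_field_derivative (deriv f \<zeta> * exp (\<i> * z * \<zeta>) + \<i> * z * (f \<zeta> * exp (\<i> * z * \<zeta>)))) (at \<zeta>)" for \<zeta>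
      by (rule derivative_eq_intros holomorphic_derivI[OF hol] refl | simp)+
    then have "((\<lambda>\<zeta>. deriv f \<zeta> * exp (\<i> * z * \<zeta>) + \<i> * z * (f \<zeta> * exp (\<i> * z * \<zeta>))) has_contour_integral
       (f (pathfinish ?p) * exp (\<i> * z * pathfinish ?p) - f (pathstart ?p) * exp (\<i> * z * pathstart ?p))) ?p"
      by (intro contour_integral_primitive[where S = UNIV] valid_path_linepath) auto
    from contour_integral_unique[OF this] show ?thesis
      using i by (simp add: laplace_seq_def contour_integral_add contour_integral_lmul contour_integrable_lmul)
  qed
  have f': "infra_growth a b (deriv f)" by (rule infra_growth_deriv[OF assms(1) f])
  obtain C where C: "growth_bound a b f C (d / 2)" using f d unfolding infra_growth_def by (meson half_gt_zero)
  have "(\<lambda>N. f (of_nat N * u) * exp (\<i> * z * (of_nat N * u))) \<longlonglongrightarrow> 0"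
  proof (rule Lim_null_comparison)
    have "cmod (f (of_nat N * u) * exp (\<i> * z * (of_nat N * u))) \<le> C * exp (- (d - d / 2)) ^ N" for N
    proof -
      have "cmod (f (of_nat N * u) * exp (\<i> * z * (of_nat N * u))) \<le> C * exp (- (d - d / 2) * real N)"
        using growth_bound_cone[OF assms(1) C _ of_nat_0_le_iff[of N] order_refl u u] d by simp
      also have "exp (- (d - d / 2) * real N) = exp (- (d - d / 2)) ^ N" by (simp add: exp_of_nat_mult[symmetric] mult.commute)
      finally show ?thesis .
    qed
    then show "\<forall>\<^sub>F N in sequentially. cmod (f (of_nat N * u) * exp (\<i> * z * (of_nat N * u))) \<le> C * exp (- (d - d / 2)) ^ N" by simp
    have "(\<lambda>N. C * exp (- (d - d / 2)) ^ N) \<longlonglongrightarrow> C * 0"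
      using d by (intro tendsto_intros LIMSEQ_power_zero) auto
    then show "(\<lambda>N. C * exp (- (d - d / 2)) ^ N) \<longlonglongrightarrow> 0" by simp
  qed
  then have "(\<lambda>N. laplace_seq (deriv f) z u N + \<i> * z * laplace_seq f z u N) \<longlonglongrightarrow> 0 - f 0"
    unfolding eq by (intro tendsto_intros)
  moreover have "(\<lambda>N. laplace_seq (deriv f) z u N + \<i> * z * laplace_seq f z u N) \<longlonglongrightarrow> laplace a b (deriv f) z + \<i> * z * laplace a b f z"
    by (intro tendsto_intros laplace_tendsto[OF assms(1) _ z u d] f f')
  ultimately have "laplace a b (deriv f) z + \<i> * z * laplace a b f z = 0 - f 0" using LIMSEQ_unique by blast
  then have "f 0 = - (laplace a b (deriv f) z + \<i> * z * laplace a b f z)" by (metis diff_0 minus_minus)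
  then show ?thesis by simp
qed

lemma norm_gamma_path_ge:
  assumes "a \<le> b" "0 < c" "w \<in> path_image (gamma_path a b c)"
  shows "c - (\<bar>a\<bar> + \<bar>b\<bar>) \<le> cmod w"
proof -
  have "complex_of_real a \<in> segment a b" using assms(1) by simp
  then have "infdist w (segment a b) \<le> dist w (of_real a)" by (rule infdist_le)
  moreover have "infdist w (segment a b) = c" using assms by (intro infdist_gamma_path) auto
  moreover have "dist w (of_real a) \<le> cmod w + \<bar>a\<bar>" by (metis dist_norm norm_of_real norm_triangle_ineq4)
  ultimately show ?thesis by linarith
qed

text \<open>Integration by parts writes the transform at w as i (f 0 + r(w)) / w, where r is the
  transform of the derivative. The first part contributes 2 pi f 0 by the winding number. The second
  is of order 1 / d^2 on a contour of length of order d, and the integral does not depend on the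
  radius d, so it disappears in the limit.\<close>

lemma contour_integral_laplace:
  fixes f :: "complex \<Rightarrow> complex"
  assumes "a \<le> b" and f: "infra_growth a b f" and "0 < c"
  shows "contour_integral (gamma_path a b c) (laplace a b f) = 2 * pi * f 0"
proof -
  have f': "infra_growth a b (deriv f)" by (rule infra_growth_deriv[OF assms(1) f])
  obtain C where C: "growth_bound a b (deriv f) C 1"
    using f' unfolding infra_growth_def by (meson zero_less_one)
  have C0: "0 \<le> C" by (rule growth_bound_nonneg[OF C])
  have hol: "laplace a b f holomorphic_on - segment a b" "laplace a b (deriv f) holomorphic_on - segment a b"
    by (rule laplace_holomorphic[OF assms(1)], fact)+
  \<comment> \<open>For d > R the origin lies inside the contour, w has modulus at least d - R on
    it, and d exceeds the growth rate 1 used for the derivative.\<close>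
  define R where "R = \<bar>a\<bar> + \<bar>b\<bar> + 1"
  let ?I = "contour_integral (gamma_path a b c) (laplace a b f)"
  have bound: "cmod (?I - 2 * pi * f 0) \<le> (2 * (b - a) + 2 * pi * d) * (C / (d - 1) / (d - R))" if d: "R < d" for d
  proof -
    let ?g = "gamma_path a b d"
    have d1: "1 < d" "0 < d" using d by (auto simp: R_def)
    have t: "tame_path ?g (2 * (b - a) + 2 * pi * d)" using assms d1 by (intro tame_gamma_path) auto
    have w: "d - R \<le> cmod w" "w \<noteq> 0" "infdist w (segment a b) = d" "w \<notin> segment a b" if "w \<in> path_image ?g" for w
    proof -
      show "d - R \<le> cmod w" using norm_gamma_path_ge[OF assms(1) d1(2) that] by (simp add: R_def)
      then show "w \<noteq> 0" using d by auto
      show "infdist w (segment a b) = d" using assms(1) d1 that by (intro infdist_gamma_path) auto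
      show "w \<notin> segment a b" using path_image_gamma_path_subset[OF assms(1) d1(2)] that by blast
    qed
    note cL = continuous_on_gamma_path[OF hol(2) assms(1) d1(2)]
    have c: "continuous_on (path_image ?g) (\<lambda>w. 1 / (w - 0))" "continuous_on (path_image ?g) (\<lambda>w. laplace a b (deriv f) w / w)"
      using w(2) by (intro continuous_intros cL; simp)+
    note i = tame_path_integrable[OF t c(1)] tame_path_integrable[OF t c(2)]
    have "infdist 0 (segment a b) < d"
    proof -
      have "complex_of_real a \<in> segment a b" using assms(1) by simp
      then have "infdist 0 (segment a b) \<le> dist 0 (complex_of_real a)" by (rule infdist_le)
      then show ?thesis using d by (simp add: R_def)
    qed
    then have wind: "contour_integral ?g (\<lambda>w. 1 / (w - 0)) = - (2 * pi * \<i>)"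
      by (rule winding_number_gamma_path_inside[OF assms(1) d1(2)])
    have "?I = contour_integral ?g (laplace a b f)"
      by (rule contour_integral_gamma_path_indep[OF hol(1) assms(1,3) d1(2)])
    also have "\<dots> = contour_integral ?g (\<lambda>w. \<i> * f 0 * (1 / (w - 0)) + \<i> * (laplace a b (deriv f) w / w))"
    proof (rule contour_integral_cong)
      fix x assume x: "x \<in> path_image ?g"
      have "x * laplace a b f x = \<i> * (- \<i> * x * laplace a b f x)" by (simp add: mult.assoc)
      also have "\<dots> = \<i> * (f 0 + laplace a b (deriv f) x)"
        by (simp only: laplace_deriv[OF assms(1) f w(4)[OF x]])
      finally have "x * laplace a b f x = \<i> * (f 0 + laplace a b (deriv f) x)" .
      then show "laplace a b f x = \<i> * f 0 * (1 / (x - 0)) + \<i> * (laplace a b (deriv f) x / x)"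
        using w(2)[OF x] by (simp add: field_simps)
    qed simp
    also have "\<dots> = \<i> * f 0 * contour_integral ?g (\<lambda>w. 1 / (w - 0)) + \<i> * contour_integral ?g (\<lambda>w. laplace a b (deriv f) w / w)"
      using i by (simp only: contour_integral_add contour_integral_lmul contour_integrable_lmul)
    also have "\<dots> = 2 * pi * f 0 + \<i> * contour_integral ?g (\<lambda>w. laplace a b (deriv f) w / w)"
      unfolding wind by simp
    finally have "cmod (?I - 2 * pi * f 0) = cmod (contour_integral ?g (\<lambda>w. laplace a b (deriv f) w / w))"
      by (simp add: norm_mult)
    also have "\<dots> \<le> (2 * (b - a) + 2 * pi * d) * (C / (d - 1) / (d - R))"
    proof (rule tame_path_bound[OF t c(2)])
      fix x assume x: "x \<in> path_image ?g"
      have "cmod (laplace a b (deriv f) x) \<le> C / (d - 1)"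
        using laplace_bound[OF assms(1) f' C _ d1(1)] w(3)[OF x] by simp
      then show "cmod (laplace a b (deriv f) x / x) \<le> C / (d - 1) / (d - R)"
        unfolding norm_divide using w(1)[OF x] d d1 C0 by (intro frac_le) auto
    qed
    finally show ?thesis .
  qed
  \<comment> \<open>For d > 2 R both d - 1 and d - R are at least d / 2, which turns the estimate
    into a multiple of 1 / d.\<close>
  have bound': "cmod (?I - 2 * pi * f 0) \<le> (2 * (b - a) + 2 * pi) * C * 4 / d" if d: "2 * R < d" for d
  proof -
    have R: "1 \<le> R" by (simp add: R_def)
    have "(2 * (b - a)) * 1 \<le> (2 * (b - a)) * d" using d R assms(1) by (intro mult_left_mono) auto
    then have 1: "2 * (b - a) + 2 * pi * d \<le> (2 * (b - a) + 2 * pi) * d" by (simp add: distrib_right)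
    have "C / (d - 1) \<le> C / (d / 2)" using d R C0 by (intro divide_left_mono) auto
    then have "C / (d - 1) / (d - R) \<le> C / (d / 2) / (d / 2)" using d R C0 by (intro frac_le) auto
    then have "(2 * (b - a) + 2 * pi * d) * (C / (d - 1) / (d - R)) \<le> (2 * (b - a) + 2 * pi) * d * (C / (d / 2) / (d / 2))"
      using 1 d R C0 assms(1) by (intro mult_mono) auto
    also have "\<dots> = (2 * (b - a) + 2 * pi) * C * 4 / d" using d R by (simp add: field_simps)
    finally show ?thesis using bound[of d] d R by linarith
  qed
  have "((\<lambda>d. (2 * (b - a) + 2 * pi) * C * 4 / d) \<longlongrightarrow> 0) at_top"
    by (intro tendsto_divide_0[OF tendsto_const] filterlim_at_top_imp_at_infinity filterlim_ident)
  moreover have "\<forall>\<^sub>F d in at_top. cmod (?I - 2 * pi * f 0) \<le> (2 * (b - a) + 2 * pi) * C * 4 / d"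
    using eventually_gt_at_top[of "2 * R"] by eventually_elim (rule bound')
  ultimately have "cmod (?I - 2 * pi * f 0) \<le> 0"
    by (intro tendsto_lowerbound[where F = at_top]) auto
  then show ?thesis by simp
qed

text \<open>
  Both sides are entire functions of \<open>\<zeta>\<close>, and integration by parts in the Laplace transform
  shows that differentiating the left-hand side amounts to replacing \<open>f\<close> by its derivative.
  Hence it suffices to compare the values at zero.
\<close>

lemma fourier_laplace:
  fixes f :: "complex \<Rightarrow> complex"
  assumes "a \<le> b" and f: "infra_growth a b f" and "0 < c"
  shows "contour_integral (gamma_path a b c) (\<lambda>w. laplace a b f w * exp (- \<i> * w * \<zeta>)) = 2 * pi * f \<zeta>"
proof -
  let ?g = "gamma_path a b c"
  define \<Phi> where "\<Phi> f \<zeta> = contour_integral ?g (\<lambda>w. laplace a b f w * exp (- \<i> * w * \<zeta>))" for f \<zeta>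
  have t: "tame_path ?g (2 * (b - a) + 2 * pi * c)" using assms by (intro tame_gamma_path) auto
  have der: "(\<Phi> f has_field_derivative \<Phi> (deriv f) \<zeta>) (at \<zeta>)" if f: "infra_growth a b f" for f \<zeta>
  proof -
    have f': "infra_growth a b (deriv f)" by (rule infra_growth_deriv[OF assms(1) f])
    have c: "continuous_on (path_image ?g) (laplace a b f)" "continuous_on (path_image ?g) (laplace a b (deriv f))"
      by (rule continuous_on_gamma_path[OF laplace_holomorphic[OF assms(1)] assms(1,3)], fact)+
    have i: "(\<lambda>w. exp (- \<i> * w * \<zeta>)) contour_integrable_on ?g"
      "(\<lambda>w. laplace a b (deriv f) w * exp (- \<i> * w * \<zeta>)) contour_integrable_on ?g"
      by (intro tame_path_integrable[OF t] continuous_intros c)+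
    have "contour_integral ?g (\<lambda>w. laplace a b f w * (- \<i> * w) * exp (- \<i> * w * \<zeta>))
      = contour_integral ?g (\<lambda>w. f 0 * exp (- \<i> * w * \<zeta>) + laplace a b (deriv f) w * exp (- \<i> * w * \<zeta>))"
    proof (rule contour_integral_cong)
      fix w assume "w \<in> path_image ?g"
      then have "w \<notin> segment a b" using path_image_gamma_path_subset[OF assms(1,3)] by blast
      then have "laplace a b f w * (- \<i> * w) = f 0 + laplace a b (deriv f) w"
        using laplace_deriv[OF assms(1) f] by (metis mult.commute)
      then show "laplace a b f w * (- \<i> * w) * exp (- \<i> * w * \<zeta>) = f 0 * exp (- \<i> * w * \<zeta>) + laplace a b (deriv f) w * exp (- \<i> * w * \<zeta>)"
        by (simp only: distrib_right)
    qed simp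
    also have "\<dots> = f 0 * contour_integral ?g (\<lambda>w. exp (- \<i> * w * \<zeta>)) + \<Phi> (deriv f) \<zeta>"
      unfolding \<Phi>_def using i by (simp only: contour_integral_add contour_integral_lmul contour_integrable_lmul)
    \<comment> \<open>The boundary term f 0 is multiplied by an entire kernel, whose integral over
      the closed contour vanishes.\<close>
    also have "contour_integral ?g (\<lambda>w. exp (- \<i> * w * \<zeta>)) = 0"
      by (rule contour_integral_gamma_path_entire) (intro holomorphic_intros)
    finally show ?thesis
      using contour_integral_exp_has_field_derivative[OF t c(1), of "- \<i>" \<zeta>] unfolding \<Phi>_def by simp
  qed
  define D :: "nat \<Rightarrow> complex \<Rightarrow> complex" where "D n = (deriv ^^ n) f" for n
  have ig: "infra_growth a b (D n)" for n
    unfolding D_def by (induction n) (simp_all add: f infra_growth_deriv[OF assms(1)])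
  have D: "deriv (D n) = D (Suc n)" "D 0 = f" for n by (simp_all add: D_def)
  \<comment> \<open>Iterating the derivative rule reduces the comparison of all Taylor coefficients
    at 0 to the value at 0 for the functions \<open>D n\<close>.\<close>
  have "(deriv ^^ n) (\<Phi> f) = \<Phi> (D n)" for n
  proof (induction n)
    case (Suc n)
    then have "(deriv ^^ Suc n) (\<Phi> f) = deriv (\<Phi> (D n))" by simp
    also have "\<dots> = \<Phi> (D (Suc n))" using der[OF ig[of n]] by (simp add: D fun_eq_iff DERIV_imp_deriv)
    finally show ?case .
  qed (simp add: D)
  moreover have "\<Phi> (D n) 0 = 2 * pi * D n 0" for n
    unfolding \<Phi>_def using contour_integral_laplace[OF assms(1) ig[of n] assms(3)] by simp
  moreover have hol: "f holomorphic_on UNIV" using f by (simp add: infra_growth_def)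
  then have "(deriv ^^ n) (\<lambda>z. 2 * pi * f z) 0 = 2 * pi * D n 0" for n
    using higher_deriv_cmult[of f UNIV 0 n "2 * pi"] by (simp add: D_def)
  ultimately have eq: "(deriv ^^ n) (\<Phi> f) 0 = (deriv ^^ n) (\<lambda>z. 2 * pi * f z) 0" for n by simp
  have "\<Phi> f \<zeta> = 2 * pi * f \<zeta>"
  proof (rule holomorphic_fun_eq_on_connected[OF _ _ open_UNIV connected_UNIV eq UNIV_I UNIV_I])
    show "\<Phi> f holomorphic_on UNIV"
      using der[OF f] by (intro holomorphic_onI) (auto simp: field_differentiable_def)
    show "(\<lambda>z. 2 * pi * f z) holomorphic_on UNIV" by (intro holomorphic_intros hol)
  qed
  then show ?thesis by (simp add: \<Phi>_def)
qed

section \<open>Pettis contour integrals\<close>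

text \<open>A bound on the speed off a finite set survives joining: each half is run at double
  speed, and the junction is added to the exceptional set. The bound serves to pass from gauge to
  Lebesgue integrals.\<close>

lemma bounded_deriv_join:
  assumes "\<exists>B S. finite S \<and> (\<forall>t\<in>{0..1} - S. \<exists>d. (g1 has_vector_derivative d) (at t) \<and> cmod d \<le> B)"
    and "\<exists>B S. finite S \<and> (\<forall>t\<in>{0..1} - S. \<exists>d. (g2 has_vector_derivative d) (at t) \<and> cmod d \<le> B)"
  shows "\<exists>B S. finite S \<and> (\<forall>t\<in>{0..1} - S. \<exists>d. ((g1 +++ g2) has_vector_derivative d) (at t) \<and> cmod d \<le> B)"
proof -
  obtain B1 S1 where 1: "finite S1" "\<And>t. t \<in> {0..1} - S1 \<Longrightarrow> \<exists>d. (g1 has_vector_derivative d) (at t) \<and> cmod d \<le> B1"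
    using assms(1) by metis
  obtain B2 S2 where 2: "finite S2" "\<And>t. t \<in> {0..1} - S2 \<Longrightarrow> \<exists>d. (g2 has_vector_derivative d) (at t) \<and> cmod d \<le> B2"
    using assms(2) by metis
  define S where "S = {1 / 2} \<union> (\<lambda>x. x / 2) ` S1 \<union> (\<lambda>x. (x + 1) / 2) ` S2"
  have "\<exists>d. ((g1 +++ g2) has_vector_derivative d) (at t) \<and> cmod d \<le> 2 * max B1 B2" if t: "t \<in> {0..1} - S" for t
  proof (cases "t < 1 / 2")
    case True
    have "2 * t / 2 \<in> S" if "2 * t \<in> S1" using that unfolding S_def by blast
    then have "2 * t \<notin> S1" using t by auto
    then obtain d where d: "(g1 has_vector_derivative d) (at (2 * t))" "cmod d \<le> B1" using 1(2)[of "2 * t"] t True by auto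
    have "((g1 \<circ> (\<lambda>x. 2 * x)) has_vector_derivative 2 *\<^sub>R d) (at t)"
      by (rule vector_diff_chain_at) (use d in \<open>auto intro!: derivative_eq_intros simp: has_real_derivative_iff_has_vector_derivative[symmetric]\<close>)
    then have "((g1 +++ g2) has_vector_derivative 2 *\<^sub>R d) (at t)"
      by (rule has_vector_derivative_transform_within_open[of _ _ _ "{..<1/2}"]) (use True in \<open>auto simp: joinpaths_def\<close>)
    moreover have "cmod (2 *\<^sub>R d) \<le> 2 * max B1 B2" using d(2) by simp
    ultimately show ?thesis by blast
  next
    case False
    then have "1 / 2 < t" using t by (auto simp: S_def)
    have "(2 * t - 1 + 1) / 2 \<in> S" if "2 * t - 1 \<in> S2" using that unfolding S_def by blast
    then have "2 * t - 1 \<notin> S2" using t by auto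
    then obtain d where d: "(g2 has_vector_derivative d) (at (2 * t - 1))" "cmod d \<le> B2" using 2(2)[of "2 * t - 1"] t \<open>1 / 2 < t\<close> by auto
    have "((g2 \<circ> (\<lambda>x. 2 * x - 1)) has_vector_derivative 2 *\<^sub>R d) (at t)"
      by (rule vector_diff_chain_at) (use d in \<open>auto intro!: derivative_eq_intros simp: has_real_derivative_iff_has_vector_derivative[symmetric]\<close>)
    then have "((g1 +++ g2) has_vector_derivative 2 *\<^sub>R d) (at t)"
      by (rule has_vector_derivative_transform_within_open[of _ _ _ "{1/2<..}"]) (use \<open>1 / 2 < t\<close> in \<open>auto simp: joinpaths_def\<close>)
    moreover have "cmod (2 *\<^sub>R d) \<le> 2 * max B1 B2" using d(2) by simp
    ultimately show ?thesis by blast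
  qed
  moreover have "finite S" using 1(1) 2(1) by (simp add: S_def)
  ultimately show ?thesis by blast
qed

lemma bounded_deriv_linepath:
  "\<exists>B S. finite S \<and> (\<forall>t\<in>{0..1} - S. \<exists>d. (linepath a b has_vector_derivative d) (at t) \<and> cmod d \<le> B)"
proof -
  have "(linepath a b has_vector_derivative (b - a)) (at t)" for t by (rule has_vector_derivative_linepath_within)
  then show ?thesis by (intro exI[of _ "cmod (b - a)"] exI[of _ "{}"]) auto
qed

lemma bounded_deriv_part_circlepath:
  "\<exists>B S. finite S \<and> (\<forall>x\<in>{0..1} - S. \<exists>d. (part_circlepath z r s t has_vector_derivative d) (at x) \<and> cmod d \<le> B)"
proof -
  have "cmod (\<i> * r * (of_real t - of_real s) * exp (\<i> * linepath s t x)) \<le> \<bar>r\<bar> * \<bar>t - s\<bar>" for x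
    by (simp add: norm_mult flip: of_real_diff)
  then show ?thesis using has_vector_derivative_part_circlepath[of z r s t]
    by (intro exI[of _ "\<bar>r\<bar> * \<bar>t - s\<bar>"] exI[of _ "{}"]) blast
qed

lemma vector_derivative_gamma_path_bounded:
  "\<exists>B. \<forall>t\<in>{0..1}. cmod (vector_derivative (gamma_path a b c) (at t within {0..1})) \<le> B"
proof -
  let ?v = "\<lambda>t. cmod (vector_derivative (gamma_path a b c) (at t within {0..1}))"
  have "\<exists>B S. finite S \<and> (\<forall>t\<in>{0..1} - S. \<exists>d. (gamma_path a b c has_vector_derivative d) (at t) \<and> cmod d \<le> B)"
    unfolding gamma_path_def by (intro bounded_deriv_join bounded_deriv_linepath bounded_deriv_part_circlepath)
  then obtain B S where S: "finite S" and B: "\<And>t. t \<in> {0..1} - S \<Longrightarrow> \<exists>d. (gamma_path a b c has_vector_derivative d) (at t) \<and> cmod d \<le> B"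
    by metis
  \<comment> \<open>At the exceptional points \<open>vector_derivative\<close> may be an unspecified
    value; there are finitely many, so the sum of their norms covers them.\<close>
  have "?v t \<le> \<bar>B\<bar> + (\<Sum>t\<in>S. ?v t)" if t: "t \<in> {0..1}" for t
  proof (cases "t \<in> S")
    case True
    then have "?v t \<le> (\<Sum>t\<in>S. ?v t)" using S by (intro member_le_sum) auto
    then show ?thesis by simp
  next
    case False
    then obtain d where d: "(gamma_path a b c has_vector_derivative d) (at t)" "cmod d \<le> B" using B t by auto
    have "vector_derivative (gamma_path a b c) (at t within {0..1}) = d"
      by (rule vector_derivative_at_within_ivl[OF d(1)]) (use t in auto)
    moreover have "0 \<le> (\<Sum>t\<in>S. ?v t)" by (intro sum_nonneg) auto
    ultimately show ?thesis using d(2) by simp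
  qed
  then show ?thesis by blast
qed

text \<open>Contour integrals are gauge integrals, Pettis integrals are Lebesgue integrals. A
  bounded gauge integrable function on an interval is absolutely integrable, so both exist and
  agree.\<close>

lemma lebesgue_contour_integral_gamma_path:
  assumes "a \<le> b" "0 < c" and h: "continuous_on (path_image (gamma_path a b c)) h"
  shows "integrable (lebesgue_on {0..1}) (\<lambda>t. vector_derivative (gamma_path a b c) (at t within {0..1}) * h (gamma_path a b c t))"
    and "(LINT t|lebesgue_on {0..1}. vector_derivative (gamma_path a b c) (at t within {0..1}) * h (gamma_path a b c t)) = contour_integral (gamma_path a b c) h"
proof -
  let ?g = "gamma_path a b c"
  let ?f = "\<lambda>t. vector_derivative ?g (at t within {0..1}) * h (?g t)"
  have t: "tame_path ?g (2 * (b - a) + 2 * pi * c)" using assms(1,2) by (intro tame_gamma_path) auto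
  have i: "(?f has_integral contour_integral ?g h) {0..1}"
    using has_contour_integral_integral[OF tame_path_integrable[OF t h]]
    unfolding has_contour_integral_def by (simp add: mult.commute)
  have "compact (h ` path_image ?g)" using tame_path_compact[OF t] h by (intro compact_continuous_image)
  then obtain M where M: "\<And>x. x \<in> h ` path_image ?g \<Longrightarrow> cmod x \<le> M" using compact_imp_bounded bounded_iff by metis
  obtain B where B: "\<And>t. t \<in> {0..1} \<Longrightarrow> cmod (vector_derivative ?g (at t within {0..1})) \<le> B"
    using vector_derivative_gamma_path_bounded[of a b c] by blast
  have "?f absolutely_integrable_on {0..1}"
  proof (rule absolutely_integrable_integrable_bound)
    fix t :: real assume t: "t \<in> {0..1}"
    then have "cmod (h (?g t)) \<le> M" by (intro M) (auto simp: path_image_def)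
    moreover have "0 \<le> B" using B[OF t] norm_ge_zero order_trans by blast
    ultimately show "norm (?f t) \<le> B * M" unfolding norm_mult using B[OF t] by (intro mult_mono) auto
  next
    show "?f integrable_on {0..1}" using i by blast
  qed auto
  then show I: "integrable (lebesgue_on {0..1}) ?f"
    by (simp add: integrable_restrict_space set_integrable_def)
  show "(LINT t|lebesgue_on {0..1}. ?f t) = contour_integral ?g h"
    using lebesgue_integral_eq_integral[OF I] i by (simp add: integral_unique)
qed

context locally_complete_space
begin

lemma lc_holomorphic_on_scale:
  assumes "open \<Omega>" "f holomorphic_on \<Omega>" "lc_holomorphic_on smul p F \<Omega>"
  shows "lc_holomorphic_on smul p (\<lambda>z. smul (f z) (F z)) \<Omega>"
proof (rule lc_holomorphic_onI[OF assms(1)])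
  fix \<phi> assume \<phi>: "\<phi> \<in> lc_dual smul p"
  show "(\<lambda>z. \<phi> (smul (f z) (F z))) holomorphic_on \<Omega>"
    unfolding lc_dual_scale[OF \<phi>] by (intro holomorphic_on_mult assms(2) lc_holomorphic_on_dual[OF assms(3) \<phi>])
next
  fix \<alpha> C assume C: "compact C" "C \<subseteq> \<Omega>"
  obtain B where B: "\<And>z. z \<in> C \<Longrightarrow> p \<alpha> (F z) \<le> B" using lc_holomorphic_on_bounded[OF assms(3) C] by blast
  have "compact (f ` C)" using C assms(2) by (intro compact_continuous_image continuous_on_subset[OF holomorphic_on_imp_continuous_on])
  then obtain M where M: "\<And>x. x \<in> f ` C \<Longrightarrow> cmod x \<le> M" using compact_imp_bounded bounded_iff by metis
  have "p \<alpha> (smul (f z) (F z)) \<le> M * B" if "z \<in> C" for z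
    unfolding seminorm_scale using M[of "f z"] B[OF that] that p_nonneg[of \<alpha> "F z"]
    by (intro mult_mono) (auto intro: order_trans[OF norm_ge_zero])
  then show "\<exists>B. \<forall>z\<in>C. p \<alpha> (smul (f z) (F z)) \<le> B" by blast
qed

lemma lc_holomorphic_on_add:
  assumes "open \<Omega>" "lc_holomorphic_on smul p F \<Omega>" "lc_holomorphic_on smul p G \<Omega>"
  shows "lc_holomorphic_on smul p (\<lambda>z. F z + G z) \<Omega>"
proof (rule lc_holomorphic_onI[OF assms(1)])
  fix \<phi> assume \<phi>: "\<phi> \<in> lc_dual smul p"
  show "(\<lambda>z. \<phi> (F z + G z)) holomorphic_on \<Omega>"
    unfolding lc_dual_add[OF \<phi>] by (intro holomorphic_on_add lc_holomorphic_on_dual[OF assms(2) \<phi>] lc_holomorphic_on_dual[OF assms(3) \<phi>])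
next
  fix \<alpha> C assume C: "compact C" "C \<subseteq> \<Omega>"
  obtain B where B: "\<And>z. z \<in> C \<Longrightarrow> p \<alpha> (F z) \<le> B" using lc_holomorphic_on_bounded[OF assms(2) C] by blast
  obtain B' where B': "\<And>z. z \<in> C \<Longrightarrow> p \<alpha> (G z) \<le> B'" using lc_holomorphic_on_bounded[OF assms(3) C] by blast
  have "p \<alpha> (F z + G z) \<le> B + B'" if "z \<in> C" for z
    using seminorm_triangle[of \<alpha> "F z" "G z"] B[OF that] B'[OF that] by linarith
  then show "\<exists>B. \<forall>z\<in>C. p \<alpha> (F z + G z) \<le> B" by blast
qed

lemma lc_holomorphic_on_cong:
  assumes "open \<Omega>" "lc_holomorphic_on smul p F \<Omega>" "\<And>z. z \<in> \<Omega> \<Longrightarrow> F z = G z"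
  shows "lc_holomorphic_on smul p G \<Omega>"
proof (rule lc_holomorphic_onI[OF assms(1)])
  fix \<phi> assume \<phi>: "\<phi> \<in> lc_dual smul p"
  show "(\<lambda>z. \<phi> (G z)) holomorphic_on \<Omega>"
    by (rule holomorphic_transform[OF lc_holomorphic_on_dual[OF assms(2) \<phi>]]) (simp add: assms(3))
next
  fix \<alpha> C assume C: "compact C" "C \<subseteq> \<Omega>"
  obtain B where B: "\<And>z. z \<in> C \<Longrightarrow> p \<alpha> (F z) \<le> B" using lc_holomorphic_on_bounded[OF assms(2) C] by blast
  then show "\<exists>B. \<forall>z\<in>C. p \<alpha> (G z) \<le> B" using assms(3) C(2) by (metis subsetD)
qed

lemma weak_linepath_integral_exists:
  assumes "lc_holomorphic_on smul p F \<Omega>" "open \<Omega>" "closed_segment x y \<subseteq> \<Omega>"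
  shows "\<exists>e. \<forall>\<phi>\<in>lc_dual smul p. \<phi> e = contour_integral (linepath x y) (\<lambda>z. \<phi> (F z))"
proof -
  obtain e where e: "\<And>\<phi>. \<phi> \<in> lc_dual smul p \<Longrightarrow> \<phi> e = integral {0..1} (\<lambda>t. \<phi> (F (linepath x y t)) * (y - x))"
  proof (rule weak_integral_exists[OF assms(1,2), where g = "linepath x y" and g' = "\<lambda>_. y - x" and g'' = "\<lambda>_. 0"])
    show "linepath x y ` {0..1} \<subseteq> \<Omega>" using assms(3) path_image_linepath[of x y] by (simp add: path_image_def)
  qed (use has_vector_derivative_linepath_within in auto)
  then show ?thesis by (intro exI[of _ e]) (simp add: contour_integral_integral)
qed

lemma weak_part_circlepath_integral_exists:
  assumes "lc_holomorphic_on smul p F \<Omega>" "open \<Omega>" "path_image (part_circlepath z r s t) \<subseteq> \<Omega>"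
  shows "\<exists>e. \<forall>\<phi>\<in>lc_dual smul p. \<phi> e = contour_integral (part_circlepath z r s t) (\<lambda>z. \<phi> (F z))"
proof -
  define g' where "g' x = \<i> * r * (of_real t - of_real s) * exp (\<i> * linepath s t x)" for x
  define g'' where "g'' x = (\<i> * r * (of_real t - of_real s)) * ((\<i> * (of_real t - of_real s)) * exp (\<i> * linepath s t x))" for x
  obtain e where e: "\<And>\<phi>. \<phi> \<in> lc_dual smul p \<Longrightarrow> \<phi> e = integral {0..1} (\<lambda>x. \<phi> (F (part_circlepath z r s t x)) * g' x)"
  proof (rule weak_integral_exists[OF assms(1,2), where g = "part_circlepath z r s t" and g' = g' and g'' = g''
        and ?M1.0 = "\<bar>r\<bar> * \<bar>t - s\<bar>" and ?M2.0 = "\<bar>r\<bar> * \<bar>t - s\<bar> * \<bar>t - s\<bar>"])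
    show "part_circlepath z r s t ` {0..1} \<subseteq> \<Omega>" using assms(3) by (simp add: path_image_def)
    fix x :: real
    show "(part_circlepath z r s t has_vector_derivative g' x) (at x within {0..1})"
      unfolding g'_def by (rule has_vector_derivative_part_circlepath)
    show "(g' has_vector_derivative g'' x) (at x within {0..1})"
      unfolding g'_def g''_def linepath_def scaleR_conv_of_real
      by (rule has_vector_derivative_real_field derivative_eq_intros refl | simp add: algebra_simps)+
    show "cmod (g' x) \<le> \<bar>r\<bar> * \<bar>t - s\<bar>" "cmod (g'' x) \<le> \<bar>r\<bar> * \<bar>t - s\<bar> * \<bar>t - s\<bar>"
      unfolding g'_def g''_def by (simp_all add: norm_mult flip: of_real_diff)
  qed auto
  then show ?thesis
    by (intro exI[of _ e]) (simp add: contour_integral_integral vector_derivative_part_circlepath g'_def)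
qed

text \<open>\<open>weak_integral_exists\<close> wants a curve that is twice differentiable, which
  the whole contour is not at its joints; hence the four pieces are integrated separately and the
  vectors added.\<close>

lemma weak_gamma_path_integral_exists:
  assumes F: "lc_holomorphic_on smul p F \<Omega>" and "open \<Omega>" "path_image (gamma_path a b c) \<subseteq> \<Omega>" "a \<le> b" "0 < c"
  shows "\<exists>e. \<forall>\<phi>\<in>lc_dual smul p. \<phi> e = contour_integral (gamma_path a b c) (\<lambda>z. \<phi> (F z))"
proof -
  define g1 where "g1 = linepath (Complex a c) (Complex b c)"
  define g2 where "g2 = part_circlepath (complex_of_real b) c (pi / 2) (- pi / 2)"
  define g3 where "g3 = linepath (Complex b (- c)) (Complex a (- c))"
  define g4 where "g4 = part_circlepath (complex_of_real a) c (3 * pi / 2) (pi / 2)"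
  have g: "gamma_path a b c = g1 +++ g2 +++ g3 +++ g4" unfolding gamma_path_def g1_def g2_def g3_def g4_def ..
  have v: "valid_path g1" "valid_path g2" "valid_path g3" "valid_path g4" by (simp_all add: g1_def g2_def g3_def g4_def)
  have e: "pathfinish g3 = pathstart g4" "pathfinish g2 = pathstart (g3 +++ g4)" "pathfinish g1 = pathstart (g2 +++ g3 +++ g4)"
    using cos_3over2_pi sin_3over2_pi
    by (simp_all add: g1_def g2_def g3_def g4_def) (simp_all add: complex_eq_iff Re_exp Im_exp mult.commute[of pi])
  have v2: "valid_path (g3 +++ g4)" "valid_path (g2 +++ g3 +++ g4)" using v e by auto
  have im: "path_image (gamma_path a b c) = path_image g1 \<union> (path_image g2 \<union> (path_image g3 \<union> path_image g4))"
    unfolding g path_image_join[OF e(3)] path_image_join[OF e(2)] path_image_join[OF e(1)] ..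
  obtain e1 where e1: "\<And>\<phi>. \<phi> \<in> lc_dual smul p \<Longrightarrow> \<phi> e1 = contour_integral g1 (\<lambda>z. \<phi> (F z))"
    using weak_linepath_integral_exists[OF F assms(2)] assms(3) im unfolding g1_def by (metis le_sup_iff path_image_linepath)
  obtain e2 where e2: "\<And>\<phi>. \<phi> \<in> lc_dual smul p \<Longrightarrow> \<phi> e2 = contour_integral g2 (\<lambda>z. \<phi> (F z))"
    using weak_part_circlepath_integral_exists[OF F assms(2)] assms(3) im unfolding g2_def by (metis le_sup_iff)
  obtain e3 where e3: "\<And>\<phi>. \<phi> \<in> lc_dual smul p \<Longrightarrow> \<phi> e3 = contour_integral g3 (\<lambda>z. \<phi> (F z))"
    using weak_linepath_integral_exists[OF F assms(2)] assms(3) im unfolding g3_def by (metis le_sup_iff path_image_linepath)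
  obtain e4 where e4: "\<And>\<phi>. \<phi> \<in> lc_dual smul p \<Longrightarrow> \<phi> e4 = contour_integral g4 (\<lambda>z. \<phi> (F z))"
    using weak_part_circlepath_integral_exists[OF F assms(2)] assms(3) im unfolding g4_def by (metis le_sup_iff)
  have "\<phi> (e1 + (e2 + (e3 + e4))) = contour_integral (gamma_path a b c) (\<lambda>z. \<phi> (F z))" if \<phi>: "\<phi> \<in> lc_dual smul p" for \<phi>
  proof -
    have t: "tame_path (gamma_path a b c) (2 * (b - a) + 2 * pi * c)" using assms by (intro tame_gamma_path) auto
    have "continuous_on (path_image (gamma_path a b c)) (\<lambda>z. \<phi> (F z))"
      using holomorphic_on_imp_continuous_on[OF lc_holomorphic_on_dual[OF F \<phi>]] assms(3) by (rule continuous_on_subset)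
    then have i: "(\<lambda>z. \<phi> (F z)) contour_integrable_on gamma_path a b c" by (rule tame_path_integrable[OF t])
    show ?thesis using i v v2 unfolding g by (simp add: lc_dual_add[OF \<phi>] e1[OF \<phi>] e2[OF \<phi>] e3[OF \<phi>] e4[OF \<phi>])
  qed
  then show ?thesis by blast
qed

text \<open>For weakly continuous integrands the integrability clause is automatic, so being the
  Pettis integral reduces to the scalar identities.\<close>

lemma has_pettis_contour_integral_gamma_path:
  assumes "a \<le> b" "0 < c" and h: "\<And>\<phi>. \<phi> \<in> lc_dual smul p \<Longrightarrow> continuous_on (path_image (gamma_path a b c)) (\<lambda>z. \<phi> (h z))"
  shows "has_pettis_contour_integral smul p (gamma_path a b c) h e \<longleftrightarrow>
    (\<forall>\<phi>\<in>lc_dual smul p. \<phi> e = contour_integral (gamma_path a b c) (\<lambda>z. \<phi> (h z)))"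
  unfolding has_pettis_contour_integral_def has_pettis_integral_def
  using lebesgue_contour_integral_gamma_path[OF assms(1,2) h] by (simp add: lc_dual_scale)

end

section \<open>The Fourier transform on representatives\<close>

text \<open>A Lipschitz criterion phrased through differences. The seminorm laws are assumed only on
  \<open>X\<close> and \<open>Y\<close>, because the suprema that serve as seminorms are meaningful
  only for functions with bounded weights.\<close>

lemma continuous_map_seminorm_topology:
  fixes X :: "'v::ab_group_add set" and Y :: "'w::ab_group_add set"
  assumes A: "\<And>x. x \<in> X \<Longrightarrow> A x \<in> Y"
    and bound: "\<And>j. j \<in> J \<Longrightarrow> \<exists>i\<in>I. \<exists>C. \<forall>x\<in>X. \<forall>x'\<in>X. r j (A x' - A x) \<le> C * q i (x' - x)"
    and tri: "\<And>j u v w. j \<in> J \<Longrightarrow> u \<in> Y \<Longrightarrow> v \<in> Y \<Longrightarrow> w \<in> Y \<Longrightarrow> r j (u - w) \<le> r j (u - v) + r j (v - w)"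
    and q: "\<And>i x x'. i \<in> I \<Longrightarrow> x \<in> X \<Longrightarrow> x' \<in> X \<Longrightarrow> 0 \<le> q i (x' - x)" "\<And>i. i \<in> I \<Longrightarrow> q i 0 = 0"
    and r: "\<And>j. j \<in> J \<Longrightarrow> r j 0 = 0" and "I \<noteq> {}" "J \<noteq> {}"
  shows "continuous_map (seminorm_topology X I q) (seminorm_topology Y J r) A"
proof -
  have top: "topspace (seminorm_topology X I q) = X"
    by (rule topspace_seminorm_topology) (use q \<open>I \<noteq> {}\<close> in auto)
  show ?thesis
    unfolding seminorm_topology_def[of Y]
  proof (rule continuous_on_generated_topo)
    fix U assume "U \<in> {{y \<in> Y. r i (y - x) < \<epsilon>} |x i \<epsilon>. x \<in> Y \<and> i \<in> J \<and> 0 < \<epsilon>}"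
    then obtain y0 j \<epsilon> where U: "U = {y \<in> Y. r j (y - y0) < \<epsilon>}" "y0 \<in> Y" "j \<in> J" by blast
    obtain i C where i: "i \<in> I" and C: "\<And>x x'. x \<in> X \<Longrightarrow> x' \<in> X \<Longrightarrow> r j (A x' - A x) \<le> C * q i (x' - x)"
      using bound[OF U(3)] by blast
    define D where "D = max C 1"
    have "0 < D" by (simp add: D_def)
    have D: "r j (A x' - A x) \<le> D * q i (x' - x)" if "x \<in> X" "x' \<in> X" for x x'
      using C[OF that] mult_right_mono[of C D "q i (x' - x)"] q(1)[OF i that] by (simp add: D_def)
    show "openin (seminorm_topology X I q) (A -` U \<inter> topspace (seminorm_topology X I q))"
      unfolding top
    proof (subst openin_subopen, intro ballI)
      fix x assume x: "x \<in> A -` U \<inter> X"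
      define \<eta> where "\<eta> = (\<epsilon> - r j (A x - y0)) / D"
      have \<eta>: "0 < \<eta>" using x \<open>0 < D\<close> by (simp add: \<eta>_def U(1))
      define T where "T = {x' \<in> X. q i (x' - x) < \<eta>}"
      have "openin (seminorm_topology X I q) T"
        unfolding seminorm_topology_def T_def by (rule topology_generated_by_Basis) (use x i \<eta> in blast)
      moreover have "x \<in> T" using x \<eta> q(2)[OF i] by (simp add: T_def)
      moreover have "T \<subseteq> A -` U \<inter> X"
      proof
        fix x' assume x': "x' \<in> T"
        then have "D * q i (x' - x) < \<epsilon> - r j (A x - y0)" using \<open>0 < D\<close> by (simp add: T_def \<eta>_def field_simps)
        moreover have "r j (A x' - A x) \<le> D * q i (x' - x)" using x x' by (intro D) (auto simp: T_def)
        moreover have "r j (A x' - y0) \<le> r j (A x' - A x) + r j (A x - y0)"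
          using x x' U(2,3) A by (intro tri) (auto simp: T_def)
        ultimately have "r j (A x' - y0) < \<epsilon>" by linarith
        then show "x' \<in> A -` U \<inter> X" using x' A by (auto simp: U(1) T_def)
      qed
      ultimately show "\<exists>T. openin (seminorm_topology X I q) T \<and> x \<in> T \<and> T \<subseteq> A -` U \<inter> X" by blast
    qed
  next
    obtain j where "j \<in> J" using \<open>J \<noteq> {}\<close> by blast
    show "A ` topspace (seminorm_topology X I q) \<subseteq> \<Union> {{y \<in> Y. r i (y - x) < \<epsilon>} |x i \<epsilon>. x \<in> Y \<and> i \<in> J \<and> 0 < \<epsilon>}"
      unfolding top
    proof
      fix y assume "y \<in> A ` X"
      then have "y \<in> Y" using A by blast
      then have "y \<in> {y' \<in> Y. r j (y' - y) < 1}" using r[OF \<open>j \<in> J\<close>] by simp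
      then show "y \<in> \<Union> {{y \<in> Y. r i (y - x) < \<epsilon>} |x i \<epsilon>. x \<in> Y \<and> i \<in> J \<and> 0 < \<epsilon>}"
        using \<open>y \<in> Y\<close> \<open>j \<in> J\<close> zero_less_one[where 'a = real] by blast
    qed
  qed
qed

lemma cSUP_add_le:
  fixes f g h :: "'a \<Rightarrow> real"
  assumes "S \<noteq> {}" "bdd_above (f ` S)" "bdd_above (g ` S)" "\<And>z. z \<in> S \<Longrightarrow> h z \<le> f z + g z"
  shows "(SUP z\<in>S. h z) \<le> (SUP z\<in>S. f z) + (SUP z\<in>S. g z)"
proof (rule cSUP_least[OF assms(1)])
  fix z assume z: "z \<in> S"
  have "f z \<le> (SUP z\<in>S. f z)" "g z \<le> (SUP z\<in>S. g z)" by (rule cSUP_upper[OF z], fact)+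
  then show "h z \<le> (SUP z\<in>S. f z) + (SUP z\<in>S. g z)" using assms(4)[OF z] by linarith
qed

text \<open>The strip omits the closure of a neighbourhood, so a strict inequality is taken to enter
  it, while membership gives back the weak one. The gap is bridged by passing to the next
  index.\<close>

lemma S_stripI:
  assumes "a \<le> b" "1 / real n < infdist z (segment a b)" "\<bar>Im z\<bar> < real n"
  shows "z \<in> S_strip {a..b} n"
proof -
  have "closure (U_nbhd {a..b} (1 / real n)) \<subseteq> {z. infdist z (segment a b) \<le> 1 / real n}"
    using assms(1) by (intro closure_minimal closed_Collect_le continuous_intros) (auto simp: U_nbhd_def)
  then show ?thesis using assms(2,3) by (auto simp: S_strip_def)
qed

lemma S_strip_infdist:
  assumes "a \<le> b" "z \<in> S_strip {a..b} n"
  shows "1 / real n \<le> infdist z (segment a b)"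
proof -
  have "z \<notin> U_nbhd {a..b} (1 / real n)" using assms(2) closure_subset by (auto simp: S_strip_def)
  then show ?thesis using assms(1) by (simp add: U_nbhd_def)
qed

lemma S_strip_empty: "S_strip {} n = {z. \<bar>Im z\<bar> < real n}"
  by (simp add: S_strip_def U_nbhd_def)

lemma norm_le_if_infdist_le:
  assumes "a \<le> b"
  obtains y where "y \<in> segment a b" "dist w y = infdist w (segment a b)" "\<bar>Re w\<bar> \<le> \<bar>a\<bar> + \<bar>b\<bar> + infdist w (segment a b)" "\<bar>Im w\<bar> \<le> infdist w (segment a b)"
proof -
  obtain y where y: "y \<in> segment a b" "infdist w (segment a b) = dist w y"
    by (rule infdist_segment_attained[OF assms])
  obtain x where x: "a \<le> x" "x \<le> b" "y = of_real x" using y(1) by auto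
  have "\<bar>Re (w - y)\<bar> \<le> dist w y" "\<bar>Im (w - y)\<bar> \<le> dist w y"
    unfolding dist_norm by (rule abs_Re_le_cmod, rule abs_Im_le_cmod)
  then have "\<bar>Re w\<bar> \<le> \<bar>a\<bar> + \<bar>b\<bar> + dist w y" "\<bar>Im w\<bar> \<le> dist w y" using x by (auto simp: abs_le_iff)
  then show thesis using that[OF y(1)] y(2) by simp
qed

section \<open>Vector space operations and seminorm bounds in \<open>Oexp\<close> and
  \<open>FO\<close>\<close>

context locally_complete_space
begin

lemma Oexp_weighted_le:
  assumes "F \<in> Oexp smul p J" "1 \<le> n"
  shows "\<exists>B. \<forall>z\<in>S_strip J n. Oexp_weighted p F (n, \<alpha>) z \<le> B"
proof -
  have "bdd_above (Oexp_weighted p F (n, \<alpha>) ` S_strip J n)" using assms by (simp add: Oexp_def)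
  then show ?thesis by (simp add: bdd_above_def)
qed

lemma FO_weighted_le:
  assumes "f \<in> FO smul p a b" "1 \<le> k"
  shows "\<exists>B. \<forall>z. FO_weighted p a b f (k, \<alpha>) z \<le> B"
proof -
  have "bdd_above (range (FO_weighted p a b f (k, \<alpha>)))" using assms by (simp add: FO_def)
  then show ?thesis by (simp add: bdd_above_def)
qed

text \<open>Stated for general \<open>J\<close> since it is applied both to the segment and, for
  entire functions, to the empty set.\<close>

lemma Oexp_add:
  assumes J: "open (- complex_of_real ` J)" and F: "F \<in> Oexp smul p J" and G: "G \<in> Oexp smul p J"
  shows "F + G \<in> Oexp smul p J"
  unfolding Oexp_def mem_Collect_eq
proof (intro conjI ballI allI impI)
  fix z assume "z \<in> complex_of_real ` J"
  then have "F z = 0" "G z = 0" using F G unfolding Oexp_def by blast+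
  then show "(F + G) z = 0" by simp
next
  show "lc_holomorphic_on smul p (F + G) (- complex_of_real ` J)"
    unfolding plus_fun_def by (rule lc_holomorphic_on_add[OF J]) (use F G in \<open>simp_all add: Oexp_def\<close>)
next
  fix n \<alpha> assume "1 \<le> (n::nat)"
  then obtain B1 B2 where B: "\<forall>z\<in>S_strip J n. Oexp_weighted p F (n, \<alpha>) z \<le> B1"
    "\<forall>z\<in>S_strip J n. Oexp_weighted p G (n, \<alpha>) z \<le> B2"
    using Oexp_weighted_le[OF F] Oexp_weighted_le[OF G] by meson
  show "bdd_above (Oexp_weighted p (F + G) (n, \<alpha>) ` S_strip J n)"
  proof (rule bdd_aboveI2)
    fix z assume z: "z \<in> S_strip J n"
    have "Oexp_weighted p (F + G) (n, \<alpha>) z \<le> (p \<alpha> (F z) + p \<alpha> (G z)) * exp (- (1 / real n) * \<bar>Re z\<bar>)"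
      unfolding Oexp_weighted_def prod.case plus_fun_apply by (intro mult_right_mono seminorm_triangle) simp
    then show "Oexp_weighted p (F + G) (n, \<alpha>) z \<le> B1 + B2"
      using bspec[OF B(1) z] bspec[OF B(2) z] by (simp add: Oexp_weighted_def distrib_right)
  qed
qed

lemma Oexp_scale:
  assumes J: "open (- complex_of_real ` J)" and F: "F \<in> Oexp smul p J"
  shows "(\<lambda>z. smul c (F z)) \<in> Oexp smul p J"
  unfolding Oexp_def mem_Collect_eq
proof (intro conjI ballI allI impI)
  fix z assume "z \<in> complex_of_real ` J"
  then have "F z = 0" using F unfolding Oexp_def by blast
  then show "smul c (F z) = 0" by simp
next
  show "lc_holomorphic_on smul p (\<lambda>z. smul c (F z)) (- complex_of_real ` J)"
    by (rule lc_holomorphic_on_scale[OF J]) (use F in \<open>simp_all add: Oexp_def\<close>)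
next
  fix n \<alpha> assume "1 \<le> (n::nat)"
  then obtain B where B: "\<forall>z\<in>S_strip J n. Oexp_weighted p F (n, \<alpha>) z \<le> B"
    using Oexp_weighted_le[OF F] by meson
  show "bdd_above (Oexp_weighted p (\<lambda>z. smul c (F z)) (n, \<alpha>) ` S_strip J n)"
  proof (rule bdd_aboveI2)
    fix z assume z: "z \<in> S_strip J n"
    have "Oexp_weighted p (\<lambda>z. smul c (F z)) (n, \<alpha>) z = cmod c * Oexp_weighted p F (n, \<alpha>) z"
      by (simp add: Oexp_weighted_def seminorm_scale)
    also have "\<dots> \<le> cmod c * B" using bspec[OF B z] by (intro mult_left_mono) auto
    finally show "Oexp_weighted p (\<lambda>z. smul c (F z)) (n, \<alpha>) z \<le> cmod c * B" .
  qed
qed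

lemma Oexp_diff:
  assumes J: "open (- complex_of_real ` J)" and F: "F \<in> Oexp smul p J" and G: "G \<in> Oexp smul p J"
  shows "F - G \<in> Oexp smul p J"
proof -
  have "F - G = F + (\<lambda>z. smul (-1) (G z))" by (simp add: fun_eq_iff)
  then show ?thesis using Oexp_add[OF J F Oexp_scale[OF J G, of "-1"]] by (simp only:)
qed

lemma FO_add:
  assumes f: "f \<in> FO smul p a b" and g: "g \<in> FO smul p a b"
  shows "f + g \<in> FO smul p a b"
  unfolding FO_def mem_Collect_eq
proof (intro conjI allI impI)
  show "lc_holomorphic_on smul p (f + g) UNIV"
    unfolding plus_fun_def by (rule lc_holomorphic_on_add[OF open_UNIV]) (use f g in \<open>simp_all add: FO_def\<close>)
  fix k \<alpha> assume "1 \<le> (k::nat)"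
  then obtain B1 B2 where B: "\<forall>z. FO_weighted p a b f (k, \<alpha>) z \<le> B1" "\<forall>z. FO_weighted p a b g (k, \<alpha>) z \<le> B2"
    using FO_weighted_le[OF f] FO_weighted_le[OF g] by meson
  show "bdd_above (range (FO_weighted p a b (f + g) (k, \<alpha>)))"
  proof (rule bdd_aboveI2)
    fix z
    have "FO_weighted p a b (f + g) (k, \<alpha>) z \<le> (p \<alpha> (f z) + p \<alpha> (g z)) * exp (- (1 / real k) * cmod z - H_fun a b (Im z))"
      unfolding FO_weighted_def prod.case plus_fun_apply by (intro mult_right_mono seminorm_triangle) simp
    then show "FO_weighted p a b (f + g) (k, \<alpha>) z \<le> B1 + B2"
      using spec[OF B(1), of z] spec[OF B(2), of z] by (simp add: FO_weighted_def distrib_right)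
  qed
qed

lemma FO_scale:
  assumes f: "f \<in> FO smul p a b"
  shows "(\<lambda>z. smul c (f z)) \<in> FO smul p a b"
  unfolding FO_def mem_Collect_eq
proof (intro conjI allI impI)
  show "lc_holomorphic_on smul p (\<lambda>z. smul c (f z)) UNIV"
    by (rule lc_holomorphic_on_scale[OF open_UNIV]) (use f in \<open>simp_all add: FO_def\<close>)
  fix k \<alpha> assume "1 \<le> (k::nat)"
  then obtain B where B: "\<forall>z. FO_weighted p a b f (k, \<alpha>) z \<le> B"
    using FO_weighted_le[OF f] by meson
  show "bdd_above (range (FO_weighted p a b (\<lambda>z. smul c (f z)) (k, \<alpha>)))"
  proof (rule bdd_aboveI2)
    fix z
    have "FO_weighted p a b (\<lambda>z. smul c (f z)) (k, \<alpha>) z = cmod c * FO_weighted p a b f (k, \<alpha>) z"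
      by (simp add: FO_weighted_def seminorm_scale)
    also have "\<dots> \<le> cmod c * B" using spec[OF B, of z] by (intro mult_left_mono) auto
    finally show "FO_weighted p a b (\<lambda>z. smul c (f z)) (k, \<alpha>) z \<le> cmod c * B" .
  qed
qed

lemma FO_diff:
  assumes "f \<in> FO smul p a b" "g \<in> FO smul p a b"
  shows "f - g \<in> FO smul p a b"
proof -
  have "f - g = f + (\<lambda>z. smul (-1) (g z))" by (simp add: fun_eq_iff)
  then show ?thesis using FO_add[OF assms(1) FO_scale[OF assms(2), of "-1"]] by (simp only:)
qed

lemma FO_seminorm_bound:
  assumes "f \<in> FO smul p a b" "1 \<le> k"
  shows "p \<alpha> (f z) \<le> FO_seminorm p a b (k, \<alpha>) f * exp (1 / real k * cmod z + H_fun a b (Im z))"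
proof -
  have "FO_weighted p a b f (k, \<alpha>) z \<le> FO_seminorm p a b (k, \<alpha>) f"
    unfolding FO_seminorm_def by (rule cSUP_upper) (use assms in \<open>auto simp: FO_def\<close>)
  then have "p \<alpha> (f z) * exp (- (1 / real k * cmod z + H_fun a b (Im z))) \<le> FO_seminorm p a b (k, \<alpha>) f"
    by (simp add: FO_weighted_def)
  then show ?thesis unfolding exp_minus by (simp add: field_simps)
qed

lemma FO_seminorm_nonneg:
  assumes "f \<in> FO smul p a b" "1 \<le> k"
  shows "0 \<le> FO_seminorm p a b (k, \<alpha>) f"
  using order_trans[OF p_nonneg FO_seminorm_bound[OF assms, of \<alpha> 0]] by (simp add: zero_le_mult_iff)

lemma Oexp_seminorm_bound:
  assumes "F \<in> Oexp smul p J" "1 \<le> n" "z \<in> S_strip J n"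
  shows "p \<alpha> (F z) \<le> Oexp_seminorm p J (n, \<alpha>) F * exp (1 / real n * \<bar>Re z\<bar>)"
proof -
  have "Oexp_weighted p F (n, \<alpha>) z \<le> Oexp_seminorm p J (n, \<alpha>) F"
    unfolding Oexp_seminorm_def fst_conv by (rule cSUP_upper) (use assms in \<open>auto simp: Oexp_def\<close>)
  then have "p \<alpha> (F z) * exp (- (1 / real n * \<bar>Re z\<bar>)) \<le> Oexp_seminorm p J (n, \<alpha>) F"
    by (simp add: Oexp_weighted_def)
  then show ?thesis unfolding exp_minus by (simp add: field_simps)
qed

lemma Oexp_seminorm_nonneg:
  assumes "F \<in> Oexp smul p J" "1 \<le> n" "bounded J"
  shows "0 \<le> Oexp_seminorm p J (n, \<alpha>) F"
proof -
  obtain z where "z \<in> S_strip J n" using S_strip_nonempty[OF assms(3,2)] by blast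
  from order_trans[OF p_nonneg Oexp_seminorm_bound[OF assms(1,2) this, of \<alpha>]] show ?thesis by (simp add: zero_le_mult_iff)
qed

end

section \<open>The Fourier transform of a representative\<close>

locale fourier_setting = locally_complete_space smul p
  for smul :: "complex \<Rightarrow> 'e::ab_group_add \<Rightarrow> 'e" and p :: "'i \<Rightarrow> 'e \<Rightarrow> real" +
  fixes a b :: real
  assumes ab: "a \<le> b"
begin

text \<open>The transform before passing to classes, specified by its values under the dual. Radius
  1 is an arbitrary choice, removed in \<open>fourier_rep_dual\<close>.\<close>

definition fourier_rep :: "(complex \<Rightarrow> 'e) \<Rightarrow> complex \<Rightarrow> 'e" where
  "fourier_rep F \<zeta> = (SOME e. \<forall>\<phi>\<in>lc_dual smul p.
     \<phi> e = contour_integral (gamma_path a b 1) (\<lambda>z. \<phi> (F z) * exp (- \<i> * z * \<zeta>)))"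

lemma fourier_rep_dual:
  assumes F: "lc_holomorphic_on smul p F (- segment a b)" and \<phi>: "\<phi> \<in> lc_dual smul p" and "0 < c"
  shows "\<phi> (fourier_rep F \<zeta>) = contour_integral (gamma_path a b c) (\<lambda>z. \<phi> (F z) * exp (- \<i> * z * \<zeta>))"
proof -
  have "lc_holomorphic_on smul p (\<lambda>z. smul (exp (- \<i> * z * \<zeta>)) (F z)) (- segment a b)"
    by (intro lc_holomorphic_on_scale[OF open_Compl_segment _ F] holomorphic_intros)
  then have "\<exists>e. \<forall>\<phi>\<in>lc_dual smul p. \<phi> e = contour_integral (gamma_path a b 1) (\<lambda>z. \<phi> (smul (exp (- \<i> * z * \<zeta>)) (F z)))"
    by (rule weak_gamma_path_integral_exists[OF _ open_Compl_segment path_image_gamma_path_subset[OF ab]]) (simp_all add: ab)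
  then have "\<exists>e. \<forall>\<phi>\<in>lc_dual smul p. \<phi> e = contour_integral (gamma_path a b 1) (\<lambda>z. \<phi> (F z) * exp (- \<i> * z * \<zeta>))"
    by (simp add: lc_dual_scale mult.commute)
  from someI_ex[OF this] have "\<phi> (fourier_rep F \<zeta>) = contour_integral (gamma_path a b 1) (\<lambda>z. \<phi> (F z) * exp (- \<i> * z * \<zeta>))"
    using \<phi> unfolding fourier_rep_def by blast
  also have "\<dots> = contour_integral (gamma_path a b c) (\<lambda>z. \<phi> (F z) * exp (- \<i> * z * \<zeta>))"
    by (intro contour_integral_gamma_path_indep[OF _ ab] holomorphic_intros lc_holomorphic_on_dual[OF F \<phi>]) (use \<open>0 < c\<close> in auto)
  finally show ?thesis .
qed

text \<open>Existence comes from weak integration and uniqueness from separation by the dual, for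
  every radius at once. This justifies the definite description in \<open>fourier\<close>.\<close>

lemma has_fourier_value_iff:
  assumes F: "lc_holomorphic_on smul p F (- segment a b)" and "0 < c"
  shows "has_fourier_value smul p a b c F \<zeta> e \<longleftrightarrow> e = fourier_rep F \<zeta>"
proof -
  have "has_fourier_value smul p a b c F \<zeta> e \<longleftrightarrow> (\<forall>\<phi>\<in>lc_dual smul p. \<phi> e = contour_integral (gamma_path a b c) (\<lambda>z. \<phi> (smul (exp (- \<i> * z * \<zeta>)) (F z))))"
    unfolding has_fourier_value_def
  proof (rule has_pettis_contour_integral_gamma_path[OF ab \<open>0 < c\<close>])
    fix \<phi> assume \<phi>: "\<phi> \<in> lc_dual smul p"
    show "continuous_on (path_image (gamma_path a b c)) (\<lambda>z. \<phi> (smul (exp (- \<i> * z * \<zeta>)) (F z)))"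
      unfolding lc_dual_scale[OF \<phi>]
      by (intro continuous_intros continuous_on_gamma_path[OF lc_holomorphic_on_dual[OF F \<phi>] ab \<open>0 < c\<close>])
  qed
  also have "\<dots> \<longleftrightarrow> (\<forall>\<phi>\<in>lc_dual smul p. \<phi> e = \<phi> (fourier_rep F \<zeta>))"
    using fourier_rep_dual[OF F _ \<open>0 < c\<close>] by (simp add: lc_dual_scale mult.commute)
  also have "\<dots> \<longleftrightarrow> e = fourier_rep F \<zeta>" using dual_separates by blast
  finally show ?thesis .
qed

lemma contour_integral_gamma_path_add:
  assumes "F holomorphic_on - segment a b" "G holomorphic_on - segment a b" "0 < c"
  shows "contour_integral (gamma_path a b c) (\<lambda>z. F z + G z) = contour_integral (gamma_path a b c) F + contour_integral (gamma_path a b c) G"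
proof -
  have t: "tame_path (gamma_path a b c) (2 * (b - a) + 2 * pi * c)" using ab assms by (intro tame_gamma_path) auto
  show ?thesis
    by (intro contour_integral_add tame_path_integrable[OF t] continuous_on_gamma_path[OF _ ab] assms)
qed

lemma fourier_rep_add:
  assumes F: "lc_holomorphic_on smul p F (- segment a b)" and G: "lc_holomorphic_on smul p G (- segment a b)"
  shows "fourier_rep (F + G) \<zeta> = fourier_rep F \<zeta> + fourier_rep G \<zeta>"
proof (rule dual_separates)
  fix \<phi> assume \<phi>: "\<phi> \<in> lc_dual smul p"
  have FG: "lc_holomorphic_on smul p (F + G) (- segment a b)"
    unfolding plus_fun_def by (rule lc_holomorphic_on_add[OF open_Compl_segment F G])
  have "\<phi> (fourier_rep (F + G) \<zeta>) = contour_integral (gamma_path a b 1) (\<lambda>z. \<phi> (F z) * exp (- \<i> * z * \<zeta>) + \<phi> (G z) * exp (- \<i> * z * \<zeta>))"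
    using fourier_rep_dual[OF FG \<phi> zero_less_one] by (simp add: lc_dual_add[OF \<phi>] distrib_right)
  also have "\<dots> = \<phi> (fourier_rep F \<zeta>) + \<phi> (fourier_rep G \<zeta>)"
    unfolding fourier_rep_dual[OF F \<phi> zero_less_one] fourier_rep_dual[OF G \<phi> zero_less_one]
    by (intro contour_integral_gamma_path_add holomorphic_intros lc_holomorphic_on_dual[OF F \<phi>] lc_holomorphic_on_dual[OF G \<phi>]) simp
  finally show "\<phi> (fourier_rep (F + G) \<zeta>) = \<phi> (fourier_rep F \<zeta> + fourier_rep G \<zeta>)" by (simp add: lc_dual_add[OF \<phi>])
qed

lemma fourier_rep_scale:
  assumes F: "lc_holomorphic_on smul p F (- segment a b)"
  shows "fourier_rep (\<lambda>z. smul c (F z)) \<zeta> = smul c (fourier_rep F \<zeta>)"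
proof (rule dual_separates)
  fix \<phi> assume \<phi>: "\<phi> \<in> lc_dual smul p"
  have t: "tame_path (gamma_path a b 1) (2 * (b - a) + 2 * pi * 1)" using ab by (intro tame_gamma_path) auto
  have cF: "lc_holomorphic_on smul p (\<lambda>z. smul c (F z)) (- segment a b)"
    by (rule lc_holomorphic_on_scale[OF open_Compl_segment _ F]) simp
  have "\<phi> (fourier_rep (\<lambda>z. smul c (F z)) \<zeta>) = contour_integral (gamma_path a b 1) (\<lambda>z. c * (\<phi> (F z) * exp (- \<i> * z * \<zeta>)))"
    using fourier_rep_dual[OF cF \<phi> zero_less_one] by (simp add: lc_dual_scale[OF \<phi>] mult.assoc)
  also have "\<dots> = c * \<phi> (fourier_rep F \<zeta>)"
    unfolding fourier_rep_dual[OF F \<phi> zero_less_one]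
    by (intro contour_integral_lmul tame_path_integrable[OF t] continuous_on_gamma_path[OF _ ab] holomorphic_intros lc_holomorphic_on_dual[OF F \<phi>]) simp
  finally show "\<phi> (fourier_rep (\<lambda>z. smul c (F z)) \<zeta>) = \<phi> (smul c (fourier_rep F \<zeta>))" by (simp add: lc_dual_scale[OF \<phi>])
qed

lemma Oexp_holomorphic: "F \<in> Oexp smul p {a..b} \<Longrightarrow> lc_holomorphic_on smul p F (- segment a b)"
  by (simp add: Oexp_def)

lemma Oexp_empty_holomorphic: "F \<in> Oexp smul p {} \<Longrightarrow> lc_holomorphic_on smul p F UNIV"
  by (simp add: Oexp_def)

lemma Oexp_entire_zero: "0 \<in> Oexp_entire smul p {a..b}"
proof -
  have "(\<lambda>_. 0) \<in> Oexp smul p {}"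
    by (auto simp: Oexp_def lc_holomorphic_on_def limitin_lc_topology Oexp_weighted_def seminorm_zero intro!: exI[of _ 0])
  then show ?thesis unfolding Oexp_entire_def by (intro image_eqI[of _ _ "\<lambda>_. 0"]) auto
qed

lemma Oexp_entire_add:
  assumes "F \<in> Oexp_entire smul p {a..b}" "G \<in> Oexp_entire smul p {a..b}"
  shows "F + G \<in> Oexp_entire smul p {a..b}"
proof -
  obtain f g where f: "f \<in> Oexp smul p {}" "F = (\<lambda>z. if z \<in> segment a b then 0 else f z)"
    and g: "g \<in> Oexp smul p {}" "G = (\<lambda>z. if z \<in> segment a b then 0 else g z)"
    using assms unfolding Oexp_entire_def by blast
  have "f + g \<in> Oexp smul p {}" by (rule Oexp_add[OF _ f(1) g(1)]) simp
  moreover have "F + G = (\<lambda>z. if z \<in> segment a b then 0 else (f + g) z)" unfolding f(2) g(2) by (simp add: fun_eq_iff)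
  ultimately show ?thesis unfolding Oexp_entire_def by blast
qed

lemma Oexp_entire_scale:
  assumes "F \<in> Oexp_entire smul p {a..b}"
  shows "(\<lambda>z. smul c (F z)) \<in> Oexp_entire smul p {a..b}"
proof -
  obtain f where f: "f \<in> Oexp smul p {}" "F = (\<lambda>z. if z \<in> segment a b then 0 else f z)"
    using assms unfolding Oexp_entire_def by blast
  have "(\<lambda>z. smul c (f z)) \<in> Oexp smul p {}" by (rule Oexp_scale[OF _ f(1)]) simp
  moreover have "(\<lambda>z. smul c (F z)) = (\<lambda>z. if z \<in> segment a b then 0 else smul c (f z))" unfolding f(2) by (simp add: fun_eq_iff)
  ultimately show ?thesis unfolding Oexp_entire_def by (intro image_eqI[of _ _ "\<lambda>z. smul c (f z)"])
qed

lemma Oexp_entire_uminus: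
  assumes "F \<in> Oexp_entire smul p {a..b}"
  shows "- F \<in> Oexp_entire smul p {a..b}"
proof -
  have "- F = (\<lambda>z. smul (-1) (F z))" by (simp add: fun_eq_iff)
  then show ?thesis using Oexp_entire_scale[OF assms, of "-1"] by (simp only:)
qed

lemma Oexp_entire_subset: "Oexp_entire smul p {a..b} \<subseteq> Oexp smul p {a..b}"
proof
  fix F assume "F \<in> Oexp_entire smul p {a..b}"
  then obtain f where f: "f \<in> Oexp smul p {}" "F = (\<lambda>z. if z \<in> segment a b then 0 else f z)"
    unfolding Oexp_entire_def by blast
  show "F \<in> Oexp smul p {a..b}"
    unfolding Oexp_def mem_Collect_eq
  proof (intro conjI ballI allI impI)
    fix z assume "z \<in> segment a b" then show "F z = 0" by (simp add: f(2))
  next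
    have "lc_holomorphic_on smul p f (- segment a b)"
      using Oexp_empty_holomorphic[OF f(1)] by (simp add: lc_holomorphic_on_def)
    then show "lc_holomorphic_on smul p F (- segment a b)"
      by (rule lc_holomorphic_on_cong[OF open_Compl_segment]) (simp add: f(2))
  next
    fix n \<alpha> assume "1 \<le> (n::nat)"
    then obtain B where B: "\<forall>z\<in>S_strip {} n. Oexp_weighted p f (n, \<alpha>) z \<le> B"
      using Oexp_weighted_le[OF f(1)] by meson
    show "bdd_above (Oexp_weighted p F (n, \<alpha>) ` S_strip {a..b} n)"
    proof (rule bdd_aboveI2)
      fix z assume z: "z \<in> S_strip {a..b} n"
      then have "z \<notin> segment a b" using S_strip_infdist[OF ab z] \<open>1 \<le> n\<close> by auto
      then have "Oexp_weighted p F (n, \<alpha>) z = Oexp_weighted p f (n, \<alpha>) z" by (simp add: Oexp_weighted_def f(2))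
      also have "\<dots> \<le> B" using z by (intro bspec[OF B]) (simp add: S_strip_def U_nbhd_def)
      finally show "Oexp_weighted p F (n, \<alpha>) z \<le> B" .
    qed
  qed
qed

text \<open>Setting \<open>g\<close> to zero on the segment does not alter it on the contour, where
  Cauchy's theorem for entire functions applies.\<close>

lemma fourier_rep_entire:
  assumes "G \<in> Oexp_entire smul p {a..b}"
  shows "fourier_rep G \<zeta> = 0"
proof (rule dual_separates)
  obtain g where g: "g \<in> Oexp smul p {}" "G = (\<lambda>z. if z \<in> segment a b then 0 else g z)"
    using assms unfolding Oexp_entire_def by blast
  fix \<phi> assume \<phi>: "\<phi> \<in> lc_dual smul p"
  have "lc_holomorphic_on smul p G (- segment a b)" using assms Oexp_entire_subset Oexp_holomorphic by blast
  then have "\<phi> (fourier_rep G \<zeta>) = contour_integral (gamma_path a b 1) (\<lambda>z. \<phi> (G z) * exp (- \<i> * z * \<zeta>))"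
    by (rule fourier_rep_dual[OF _ \<phi> zero_less_one])
  also have "\<dots> = contour_integral (gamma_path a b 1) (\<lambda>z. \<phi> (g z) * exp (- \<i> * z * \<zeta>))"
    by (rule contour_integral_cong) (use path_image_gamma_path_subset[OF ab zero_less_one] g(2) in auto)
  also have "\<dots> = 0"
    by (rule contour_integral_gamma_path_entire)
      (intro holomorphic_intros lc_holomorphic_on_dual[OF Oexp_empty_holomorphic[OF g(1)] \<phi>])
  finally show "\<phi> (fourier_rep G \<zeta>) = \<phi> 0" by (simp add: lc_dual_zero[OF \<phi>])
qed

section \<open>Cosets modulo entire functions\<close>

lemma bv_class_iff: "G \<in> bv_class smul p {a..b} F \<longleftrightarrow> G - F \<in> Oexp_entire smul p {a..b}"
proof
  assume "G \<in> bv_class smul p {a..b} F"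
  then obtain s where "s \<in> Oexp_entire smul p {a..b}" "G = F + s" unfolding bv_class_def elt_set_plus_def by blast
  then show "G - F \<in> Oexp_entire smul p {a..b}" by simp
next
  assume "G - F \<in> Oexp_entire smul p {a..b}"
  moreover have "G = F + (G - F)" by simp
  ultimately show "G \<in> bv_class smul p {a..b} F" unfolding bv_class_def elt_set_plus_def by blast
qed

lemma bv_class_eq_iff: "bv_class smul p {a..b} F = bv_class smul p {a..b} G \<longleftrightarrow> F - G \<in> Oexp_entire smul p {a..b}"
proof
  assume "bv_class smul p {a..b} F = bv_class smul p {a..b} G"
  moreover have "F \<in> bv_class smul p {a..b} F" by (simp add: bv_class_iff Oexp_entire_zero)
  ultimately show "F - G \<in> Oexp_entire smul p {a..b}" using bv_class_iff by blast
next
  assume FG: "F - G \<in> Oexp_entire smul p {a..b}"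
  have "H - F \<in> Oexp_entire smul p {a..b} \<longleftrightarrow> H - G \<in> Oexp_entire smul p {a..b}" for H
  proof
    assume "H - F \<in> Oexp_entire smul p {a..b}"
    from Oexp_entire_add[OF this FG] show "H - G \<in> Oexp_entire smul p {a..b}" by simp
  next
    assume "H - G \<in> Oexp_entire smul p {a..b}"
    from Oexp_entire_add[OF this Oexp_entire_uminus[OF FG]] show "H - F \<in> Oexp_entire smul p {a..b}" by simp
  qed
  then show "bv_class smul p {a..b} F = bv_class smul p {a..b} G" by (intro set_eqI) (simp only: bv_class_iff)
qed

lemma bv_class_add: "bv_class smul p {a..b} F + bv_class smul p {a..b} G = bv_class smul p {a..b} (F + G)"
proof (intro set_eqI iffI)
  fix H assume "H \<in> bv_class smul p {a..b} F + bv_class smul p {a..b} G"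
  then obtain u v where uv: "u \<in> bv_class smul p {a..b} F" "v \<in> bv_class smul p {a..b} G" "H = u + v" unfolding set_plus_def by blast
  have "(u - F) + (v - G) \<in> Oexp_entire smul p {a..b}" using uv by (intro Oexp_entire_add) (simp_all add: bv_class_iff)
  then show "H \<in> bv_class smul p {a..b} (F + G)" unfolding bv_class_iff uv(3) by (simp add: algebra_simps)
next
  fix H assume "H \<in> bv_class smul p {a..b} (F + G)"
  moreover have "F + (H - (F + G)) - F = H - (F + G)" by (simp add: algebra_simps)
  ultimately have "F + (H - (F + G)) \<in> bv_class smul p {a..b} F" by (simp only: bv_class_iff)
  moreover have "G \<in> bv_class smul p {a..b} G" by (simp add: bv_class_iff Oexp_entire_zero)
  moreover have "H = (F + (H - (F + G))) + G" by (simp add: algebra_simps)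
  ultimately show "H \<in> bv_class smul p {a..b} F + bv_class smul p {a..b} G" unfolding set_plus_def by blast
qed

lemma bv_scale_class: "bv_scale smul p {a..b} c (bv_class smul p {a..b} F) = bv_class smul p {a..b} (\<lambda>z. smul c (F z))"
proof (intro set_eqI iffI)
  fix H assume "H \<in> bv_scale smul p {a..b} c (bv_class smul p {a..b} F)"
  then obtain u s where us: "u \<in> bv_class smul p {a..b} F" "s \<in> Oexp_entire smul p {a..b}" "H = (\<lambda>z. smul c (u z)) + s"
    unfolding bv_scale_def set_plus_def by blast
  have "u - F \<in> Oexp_entire smul p {a..b}" using us(1) by (simp only: bv_class_iff)
  from Oexp_entire_add[OF Oexp_entire_scale[OF this] us(2)]
  have "(\<lambda>z. smul c ((u - F) z)) + s \<in> Oexp_entire smul p {a..b}" .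
  moreover have "H - (\<lambda>z. smul c (F z)) = (\<lambda>z. smul c ((u - F) z)) + s"
    unfolding us(3) by (simp add: fun_eq_iff scale_right_diff_distrib)
  ultimately show "H \<in> bv_class smul p {a..b} (\<lambda>z. smul c (F z))" by (simp only: bv_class_iff)
next
  fix H assume "H \<in> bv_class smul p {a..b} (\<lambda>z. smul c (F z))"
  then have "H - (\<lambda>z. smul c (F z)) \<in> Oexp_entire smul p {a..b}" by (simp only: bv_class_iff)
  moreover have "F \<in> bv_class smul p {a..b} F" by (simp add: bv_class_iff Oexp_entire_zero)
  moreover have "H = (\<lambda>z. smul c (F z)) + (H - (\<lambda>z. smul c (F z)))" by simp
  ultimately show "H \<in> bv_scale smul p {a..b} c (bv_class smul p {a..b} F)" unfolding bv_scale_def set_plus_def by blast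
qed

text \<open>Two representatives differ by an entire function, whose transform vanishes, so all
  representatives and all radii determine the same value.\<close>

lemma fourier_class:
  assumes F: "F \<in> Oexp smul p {a..b}"
  shows "fourier smul p a b (bv_class smul p {a..b} F) = fourier_rep F"
proof
  fix \<zeta>
  have rep: "has_fourier_value smul p a b c G \<zeta> e \<longleftrightarrow> e = fourier_rep F \<zeta>"
    if G: "G \<in> bv_class smul p {a..b} F" and "0 < c" for G c e
  proof -
    have GF: "G - F \<in> Oexp_entire smul p {a..b}" using G by (simp add: bv_class_iff)
    then have hol: "lc_holomorphic_on smul p (G - F) (- segment a b)" using Oexp_entire_subset Oexp_holomorphic by blast
    have "G = F + (G - F)" by simp
    then have "lc_holomorphic_on smul p G (- segment a b)"
      using lc_holomorphic_on_add[OF open_Compl_segment Oexp_holomorphic[OF F] hol] by (simp add: plus_fun_def)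
    moreover have "fourier_rep G \<zeta> = fourier_rep F \<zeta>"
      using fourier_rep_add[OF Oexp_holomorphic[OF F] hol, of \<zeta>] fourier_rep_entire[OF GF, of \<zeta>] by simp
    ultimately show ?thesis using has_fourier_value_iff[OF _ \<open>0 < c\<close>] by metis
  qed
  have "F \<in> bv_class smul p {a..b} F" by (simp add: bv_class_iff Oexp_entire_zero)
  then show "fourier smul p a b (bv_class smul p {a..b} F) \<zeta> = fourier_rep F \<zeta>"
    unfolding fourier_def by (intro the_equality) (use rep zero_less_one in blast)+
qed

text \<open>The contour has radius 1 / k, so the kernel exceeds the indicator by exp(|\<zeta>| / k)
  at most. It lies in the strip of index k + 1, where the weight is at most exp(|a| + |b| + 1). The
  first factor is the length of the contour.\<close>

lemma fourier_rep_bound: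
  assumes F: "F \<in> Oexp smul p {a..b}" and "1 \<le> k"
  shows "p \<alpha> (fourier_rep F \<zeta>) \<le> (2 * (b - a) + 2 * pi * (1 / real k)) * exp (\<bar>a\<bar> + \<bar>b\<bar> + 1) *
    Oexp_seminorm p {a..b} (Suc k, \<alpha>) F * exp (1 / real k * cmod \<zeta> + H_fun a b (Im \<zeta>))"
proof (rule p_le_if_dual_le)
  fix \<phi> assume \<phi>: "\<phi> \<in> lc_dual smul p" "\<And>x. cmod (\<phi> x) \<le> p \<alpha> x"
  define c where "c = 1 / real k"
  define Q where "Q = Oexp_seminorm p {a..b} (Suc k, \<alpha>) F"
  have c: "0 < c" "c \<le> 1" "1 / real (Suc k) < c" using \<open>1 \<le> k\<close> by (auto simp: c_def field_simps)
  have Q: "0 \<le> Q" unfolding Q_def by (rule Oexp_seminorm_nonneg[OF F]) simp_all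
  note holF = Oexp_holomorphic[OF F]
  have t: "tame_path (gamma_path a b c) (2 * (b - a) + 2 * pi * c)" using ab c by (intro tame_gamma_path) auto
  have "cmod (\<phi> (fourier_rep F \<zeta>)) = cmod (contour_integral (gamma_path a b c) (\<lambda>z. \<phi> (F z) * exp (- \<i> * z * \<zeta>)))"
    by (simp only: fourier_rep_dual[OF holF \<phi>(1) c(1)])
  also have "\<dots> \<le> (2 * (b - a) + 2 * pi * c) * (Q * exp (\<bar>a\<bar> + \<bar>b\<bar> + 1) * exp (c * cmod \<zeta> + H_fun a b (Im \<zeta>)))"
  proof (rule tame_path_bound[OF t])
    show "continuous_on (path_image (gamma_path a b c)) (\<lambda>z. \<phi> (F z) * exp (- \<i> * z * \<zeta>))"
      by (intro continuous_on_gamma_path[OF _ ab c(1)] holomorphic_intros lc_holomorphic_on_dual[OF holF \<phi>(1)])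
    fix w assume w: "w \<in> path_image (gamma_path a b c)"
    have inf: "infdist w (segment a b) = c" using ab c w by (intro infdist_gamma_path) auto
    obtain y where y: "y \<in> segment a b" "dist w y = c" "\<bar>Re w\<bar> \<le> \<bar>a\<bar> + \<bar>b\<bar> + c" "\<bar>Im w\<bar> \<le> c"
      by (rule norm_le_if_infdist_le[OF ab, of w]) (simp add: inf)
    have "w \<in> S_strip {a..b} (Suc k)" using y c inf \<open>1 \<le> k\<close> by (intro S_stripI[OF ab]) auto
    then have "p \<alpha> (F w) \<le> Q * exp (1 / real (Suc k) * \<bar>Re w\<bar>)"
      unfolding Q_def by (intro Oexp_seminorm_bound[OF F]) auto
    also have "\<dots> \<le> Q * exp (\<bar>a\<bar> + \<bar>b\<bar> + 1)"
    proof -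
      have "1 / real (Suc k) * \<bar>Re w\<bar> \<le> 1 * \<bar>Re w\<bar>" by (intro mult_right_mono) auto
      then show ?thesis using y(3) c Q by (intro mult_left_mono) auto
    qed
    finally have 1: "cmod (\<phi> (F w)) \<le> Q * exp (\<bar>a\<bar> + \<bar>b\<bar> + 1)" using \<phi>(2) order_trans by blast
    \<comment> \<open>Comparison with the nearest point of the segment: the displacement costs c
      |\<zeta>|, and the point itself is controlled by \<open>H_fun\<close>.\<close>
    have "Im ((w - y) * \<zeta>) \<le> cmod ((w - y) * \<zeta>)" using abs_Im_le_cmod[of "(w - y) * \<zeta>"] by linarith
    also have "\<dots> = c * cmod \<zeta>" using y(2) by (simp add: norm_mult dist_norm)
    finally have "Im (w * \<zeta>) \<le> c * cmod \<zeta> + H_fun a b (Im \<zeta>)"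
      using Im_mult_real_le_H_fun[OF y(1), of \<zeta>] by (simp add: algebra_simps)
    moreover have "cmod (exp (- \<i> * w * \<zeta>)) = exp (Im (w * \<zeta>))" by (simp add: mult.assoc)
    ultimately have "cmod (exp (- \<i> * w * \<zeta>)) \<le> exp (c * cmod \<zeta> + H_fun a b (Im \<zeta>))" by simp
    then show "cmod (\<phi> (F w) * exp (- \<i> * w * \<zeta>)) \<le> Q * exp (\<bar>a\<bar> + \<bar>b\<bar> + 1) * exp (c * cmod \<zeta> + H_fun a b (Im \<zeta>))"
      unfolding norm_mult using 1 Q by (intro mult_mono) auto
  qed
  finally show "cmod (\<phi> (fourier_rep F \<zeta>)) \<le> (2 * (b - a) + 2 * pi * (1 / real k)) * exp (\<bar>a\<bar> + \<bar>b\<bar> + 1) *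
    Oexp_seminorm p {a..b} (Suc k, \<alpha>) F * exp (1 / real k * cmod \<zeta> + H_fun a b (Im \<zeta>))"
    unfolding c_def Q_def by (simp only: mult_ac)
qed

lemma fourier_rep_weighted_bound:
  assumes F: "F \<in> Oexp smul p {a..b}" and "1 \<le> k"
  shows "FO_weighted p a b (fourier_rep F) (k, \<alpha>) \<zeta> \<le> (2 * (b - a) + 2 * pi * (1 / real k)) * exp (\<bar>a\<bar> + \<bar>b\<bar> + 1) *
    Oexp_seminorm p {a..b} (Suc k, \<alpha>) F"
proof -
  let ?M = "(2 * (b - a) + 2 * pi * (1 / real k)) * exp (\<bar>a\<bar> + \<bar>b\<bar> + 1) * Oexp_seminorm p {a..b} (Suc k, \<alpha>) F"
  let ?w = "1 / real k * cmod \<zeta> + H_fun a b (Im \<zeta>)"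
  have "FO_weighted p a b (fourier_rep F) (k, \<alpha>) \<zeta> = p \<alpha> (fourier_rep F \<zeta>) * exp (- ?w)"
    by (simp add: FO_weighted_def)
  also have "\<dots> \<le> ?M * exp ?w * exp (- ?w)" by (intro mult_right_mono fourier_rep_bound[OF assms]) simp
  also have "\<dots> = ?M" unfolding mult.assoc[of _ "exp ?w"] by (simp flip: exp_add)
  finally show ?thesis .
qed

lemma fourier_rep_in_FO:
  assumes F: "F \<in> Oexp smul p {a..b}"
  shows "fourier_rep F \<in> FO smul p a b"
  unfolding FO_def mem_Collect_eq
proof (intro conjI allI impI)
  note holF = Oexp_holomorphic[OF F]
  show "lc_holomorphic_on smul p (fourier_rep F) UNIV"
  proof (rule lc_holomorphic_onI[OF open_UNIV])
    fix \<phi> assume \<phi>: "\<phi> \<in> lc_dual smul p"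
    have t: "tame_path (gamma_path a b 1) (2 * (b - a) + 2 * pi * 1)" using ab by (intro tame_gamma_path) auto
    have "(\<lambda>\<zeta>. contour_integral (gamma_path a b 1) (\<lambda>w. \<phi> (F w) * exp (- \<i> * w * \<zeta>))) holomorphic_on UNIV"
      using contour_integral_exp_has_field_derivative[OF t continuous_on_gamma_path[OF lc_holomorphic_on_dual[OF holF \<phi>] ab zero_less_one], of "- \<i>"]
      by (intro holomorphic_onI) (auto simp: field_differentiable_def)
    then show "(\<lambda>\<zeta>. \<phi> (fourier_rep F \<zeta>)) holomorphic_on UNIV"
      by (simp only: fourier_rep_dual[OF holF \<phi> zero_less_one])
  next
    fix \<alpha> and C :: "complex set" assume C: "compact C"
    obtain R where R: "\<And>\<zeta>. \<zeta> \<in> C \<Longrightarrow> cmod \<zeta> \<le> R" using compact_imp_bounded[OF C] unfolding bounded_iff by blast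
    let ?M = "(2 * (b - a) + 2 * pi * (1 / real 1)) * exp (\<bar>a\<bar> + \<bar>b\<bar> + 1) * Oexp_seminorm p {a..b} (Suc 1, \<alpha>) F"
    have M: "0 \<le> ?M" using ab Oexp_seminorm_nonneg[OF F, of "Suc 1"] by (intro mult_nonneg_nonneg) auto
    have "p \<alpha> (fourier_rep F \<zeta>) \<le> ?M * exp (R + (\<bar>a\<bar> + \<bar>b\<bar>) * R)" if "\<zeta> \<in> C" for \<zeta>
    proof -
      have "H_fun a b (0 + Im \<zeta>) \<le> H_fun a b 0 + (\<bar>a\<bar> + \<bar>b\<bar>) * \<bar>Im \<zeta>\<bar>" by (rule H_fun_add_le[OF ab])
      moreover have "H_fun a b 0 = 0" by (simp add: H_fun_eq_max[OF ab])
      moreover have "(\<bar>a\<bar> + \<bar>b\<bar>) * \<bar>Im \<zeta>\<bar> \<le> (\<bar>a\<bar> + \<bar>b\<bar>) * R"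
        using abs_Im_le_cmod[of \<zeta>] R[OF that] by (intro mult_left_mono) auto
      ultimately have "1 / real 1 * cmod \<zeta> + H_fun a b (Im \<zeta>) \<le> R + (\<bar>a\<bar> + \<bar>b\<bar>) * R" using R[OF that] by simp
      then have "?M * exp (1 / real 1 * cmod \<zeta> + H_fun a b (Im \<zeta>)) \<le> ?M * exp (R + (\<bar>a\<bar> + \<bar>b\<bar>) * R)"
        using M by (intro mult_left_mono) auto
      then show ?thesis using fourier_rep_bound[OF F order_refl, of \<alpha> \<zeta>] by linarith
    qed
    then show "\<exists>B. \<forall>\<zeta>\<in>C. p \<alpha> (fourier_rep F \<zeta>) \<le> B" by blast
  qed
  fix k \<alpha> assume "1 \<le> (k::nat)"
  then show "bdd_above (range (FO_weighted p a b (fourier_rep F) (k, \<alpha>)))"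
    using fourier_rep_weighted_bound[OF F] by (intro bdd_aboveI2)
qed

lemma fourier_rep_seminorm_bound:
  assumes F: "F \<in> Oexp smul p {a..b}" and "1 \<le> k"
  shows "FO_seminorm p a b (k, \<alpha>) (fourier_rep F) \<le> (2 * (b - a) + 2 * pi * (1 / real k)) * exp (\<bar>a\<bar> + \<bar>b\<bar> + 1) *
    Oexp_seminorm p {a..b} (Suc k, \<alpha>) F"
  unfolding FO_seminorm_def by (rule cSUP_least) (simp_all only: fourier_rep_weighted_bound[OF assms] UNIV_not_empty not_False_eq_True)

end

section \<open>The inverse transform\<close>

context fourier_setting
begin

lemma dual_growth_bound:
  assumes f: "f \<in> FO smul p a b" and \<phi>: "\<And>x. cmod (\<phi> x) \<le> C * p \<alpha> x" and "0 \<le> C" "1 \<le> k"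
  shows "growth_bound a b (\<lambda>z. \<phi> (f z)) (C * FO_seminorm p a b (k, \<alpha>) f) (1 / real k)"
  unfolding growth_bound_def
proof
  fix \<zeta>
  have "cmod (\<phi> (f \<zeta>)) \<le> C * p \<alpha> (f \<zeta>)" by (rule \<phi>)
  also have "\<dots> \<le> C * (FO_seminorm p a b (k, \<alpha>) f * exp (1 / real k * cmod \<zeta> + H_fun a b (Im \<zeta>)))"
    by (intro mult_left_mono FO_seminorm_bound[OF f] assms)
  finally show "cmod (\<phi> (f \<zeta>)) \<le> C * FO_seminorm p a b (k, \<alpha>) f * exp (1 / real k * cmod \<zeta> + H_fun a b (Im \<zeta>))"
    by (simp only: mult.assoc)
qed

lemma dual_infra_growth:
  assumes f: "f \<in> FO smul p a b" and \<phi>: "\<phi> \<in> lc_dual smul p"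
  shows "infra_growth a b (\<lambda>z. \<phi> (f z))"
  unfolding infra_growth_def
proof (intro conjI allI impI)
  show "(\<lambda>z. \<phi> (f z)) holomorphic_on UNIV"
    by (rule lc_holomorphic_on_dual[OF _ \<phi>]) (use f in \<open>simp add: FO_def\<close>)
  fix \<epsilon> :: real assume "0 < \<epsilon>"
  \<comment> \<open>The weights of \<open>FO\<close> come with rates 1 / k only; one of them lies
    below the given \<epsilon>.\<close>
  then obtain n where n: "inverse (real (Suc n)) < \<epsilon>" using reals_Archimedean by blast
  obtain \<alpha> C where C: "0 < C" "\<And>x. cmod (\<phi> x) \<le> C * p \<alpha> x" using lc_dual_bounded[OF \<phi>] by blast
  define D where "D = C * FO_seminorm p a b (Suc n, \<alpha>) f"
  have gb: "growth_bound a b (\<lambda>z. \<phi> (f z)) D (1 / real (Suc n))"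
    unfolding D_def by (rule dual_growth_bound[OF f C(2)]) (use C(1) in simp_all)
  have "0 \<le> D" by (rule growth_bound_nonneg[OF gb])
  have "growth_bound a b (\<lambda>z. \<phi> (f z)) D \<epsilon>"
    unfolding growth_bound_def
  proof
    fix \<zeta>
    have "1 / real (Suc n) * cmod \<zeta> \<le> \<epsilon> * cmod \<zeta>" using n by (intro mult_right_mono) (simp_all add: inverse_eq_divide)
    then have "D * exp (1 / real (Suc n) * cmod \<zeta> + H_fun a b (Im \<zeta>)) \<le> D * exp (\<epsilon> * cmod \<zeta> + H_fun a b (Im \<zeta>))"
      using \<open>0 \<le> D\<close> by (intro mult_left_mono) auto
    then show "cmod (\<phi> (f \<zeta>)) \<le> D * exp (\<epsilon> * cmod \<zeta> + H_fun a b (Im \<zeta>))"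
      using gb unfolding growth_bound_def by (meson order_trans)
  qed
  then show "\<exists>C. growth_bound a b (\<lambda>z. \<phi> (f z)) C \<epsilon>" by blast
qed

text \<open>The index \<open>n\<close> is chosen from the distance of \<open>z\<close> alone. Hence
  the truncated integrals converge with the same ratio \<open>q\<close> for every seminorm, and only
  the constant varies.\<close>

lemma weak_laplace_exists:
  assumes f: "f \<in> FO smul p a b" and z: "z \<notin> segment a b"
  shows "\<exists>e. \<forall>\<phi>\<in>lc_dual smul p. \<phi> e = laplace a b (\<lambda>z. \<phi> (f z)) z"
proof -
  define d where "d = infdist z (segment a b)"
  define u where "u = sep_dir a b z"
  have d: "0 < d" unfolding d_def by (rule infdist_segment_pos[OF ab z])
  have u: "separates a b z u d" unfolding u_def d_def by (rule separates_sep_dir[OF ab z])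
  obtain n where "inverse (real (Suc n)) < d" using reals_Archimedean d by blast
  then have n: "1 / real (Suc n) < d" by (simp add: inverse_eq_divide)
  define q where "q = exp (- (d - 1 / real (Suc n)))"
  have holf: "lc_holomorphic_on smul p f UNIV" using f by (simp add: FO_def)
  have "lc_holomorphic_on smul p (\<lambda>\<zeta>. smul (exp (\<i> * z * \<zeta>)) (f \<zeta>)) UNIV"
    by (intro lc_holomorphic_on_scale[OF open_UNIV _ holf] holomorphic_intros)
  from weak_linepath_integral_exists[OF this open_UNIV subset_UNIV]
  have "\<exists>e. \<forall>\<phi>\<in>lc_dual smul p. \<phi> e = laplace_seq (\<lambda>z. \<phi> (f z)) z u N" for N
    unfolding laplace_seq_def by (simp add: lc_dual_scale mult.commute)
  then obtain e where e: "\<And>N \<phi>. \<phi> \<in> lc_dual smul p \<Longrightarrow> \<phi> (e N) = laplace_seq (\<lambda>z. \<phi> (f z)) z u N"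
    by metis
  obtain l where l: "\<And>\<phi>. \<phi> \<in> lc_dual smul p \<Longrightarrow> \<phi> l = laplace a b (\<lambda>z. \<phi> (f z)) z"
  proof (rule weak_limit_exists[of e "\<lambda>N. q ^ N"])
    fix \<alpha>
    show "\<exists>C. \<forall>\<phi>\<in>lc_dual smul p. (\<forall>x. cmod (\<phi> x) \<le> p \<alpha> x) \<longrightarrow>
        (\<forall>m n. n \<le> m \<longrightarrow> cmod (\<phi> (e m) - \<phi> (e n)) \<le> C * q ^ n)"
    proof (intro exI[of _ "FO_seminorm p a b (Suc n, \<alpha>) f / (d - 1 / real (Suc n))"] ballI impI allI)
      fix \<phi> and M N :: nat assume \<phi>: "\<phi> \<in> lc_dual smul p" "\<forall>x. cmod (\<phi> x) \<le> p \<alpha> x" and "N \<le> M"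
      have "growth_bound a b (\<lambda>z. \<phi> (f z)) (1 * FO_seminorm p a b (Suc n, \<alpha>) f) (1 / real (Suc n))"
        by (rule dual_growth_bound[OF f]) (use \<phi>(2) in auto)
      then have gb: "growth_bound a b (\<lambda>z. \<phi> (f z)) (FO_seminorm p a b (Suc n, \<alpha>) f) (1 / real (Suc n))" by simp
      show "cmod (\<phi> (e M) - \<phi> (e N)) \<le> FO_seminorm p a b (Suc n, \<alpha>) f / (d - 1 / real (Suc n)) * q ^ N"
        unfolding e[OF \<phi>(1)] q_def
        by (rule laplace_seq_diff[OF ab lc_holomorphic_on_dual[OF holf \<phi>(1)] gb _ n u \<open>N \<le> M\<close>]) simp
    qed
  next
    fix \<phi> assume \<phi>: "\<phi> \<in> lc_dual smul p"
    show "(\<lambda>N. \<phi> (e N)) \<longlonglongrightarrow> laplace a b (\<lambda>z. \<phi> (f z)) z"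
      unfolding e[OF \<phi>] by (rule laplace_tendsto[OF ab dual_infra_growth[OF f \<phi>] z u d])
  next
    show "(\<lambda>N. q ^ N) \<longlonglongrightarrow> 0" unfolding q_def using n by (intro LIMSEQ_power_zero) simp
  next
    fix l assume "\<And>\<phi>. \<phi> \<in> lc_dual smul p \<Longrightarrow> \<phi> l = laplace a b (\<lambda>z. \<phi> (f z)) z"
    then show thesis by (rule that)
  qed (simp add: q_def)
  then show ?thesis by blast
qed

text \<open>The factor 1 / (2 pi) offsets the one in \<open>fourier_laplace\<close>; the value zero
  on the segment follows the convention of \<open>Oexp\<close>.\<close>

definition laplace_rep :: "(complex \<Rightarrow> 'e) \<Rightarrow> complex \<Rightarrow> 'e" where
  "laplace_rep f z = (if z \<in> segment a b then 0 else
     SOME e. \<forall>\<phi>\<in>lc_dual smul p. \<phi> e = laplace a b (\<lambda>z. \<phi> (f z)) z / (2 * pi))"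

lemma laplace_rep_dual:
  assumes f: "f \<in> FO smul p a b" and z: "z \<notin> segment a b" and \<phi>: "\<phi> \<in> lc_dual smul p"
  shows "\<phi> (laplace_rep f z) = laplace a b (\<lambda>z. \<phi> (f z)) z / (2 * pi)"
proof -
  obtain e where "\<And>\<phi>. \<phi> \<in> lc_dual smul p \<Longrightarrow> \<phi> e = laplace a b (\<lambda>z. \<phi> (f z)) z"
    using weak_laplace_exists[OF f z] by blast
  then have "\<forall>\<phi>\<in>lc_dual smul p. \<phi> (smul (1 / (2 * pi)) e) = laplace a b (\<lambda>z. \<phi> (f z)) z / (2 * pi)"
    by (simp add: lc_dual_scale)
  then have "\<exists>e. \<forall>\<phi>\<in>lc_dual smul p. \<phi> e = laplace a b (\<lambda>z. \<phi> (f z)) z / (2 * pi)" by blast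
  from someI_ex[OF this] show ?thesis using z \<phi> by (simp add: laplace_rep_def)
qed

lemma laplace_rep_bound:
  assumes f: "f \<in> FO smul p a b" and "1 \<le> k" "1 / real k < m" "m \<le> infdist z (segment a b)"
  shows "p \<alpha> (laplace_rep f z) \<le> FO_seminorm p a b (k, \<alpha>) f / (m - 1 / real k)"
proof (rule p_le_if_dual_le)
  fix \<phi> assume \<phi>: "\<phi> \<in> lc_dual smul p" "\<And>x. cmod (\<phi> x) \<le> p \<alpha> x"
  have "0 < m" using assms(2,3) by (meson divide_nonneg_nonneg of_nat_0_le_iff order_le_less_trans zero_le_one)
  then have z: "z \<notin> segment a b" using assms(4) by auto
  have "growth_bound a b (\<lambda>z. \<phi> (f z)) (1 * FO_seminorm p a b (k, \<alpha>) f) (1 / real k)"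
    by (rule dual_growth_bound[OF f]) (use \<phi>(2) assms(2) in auto)
  then have gb: "growth_bound a b (\<lambda>z. \<phi> (f z)) (FO_seminorm p a b (k, \<alpha>) f) (1 / real k)" by simp
  have "cmod (\<phi> (laplace_rep f z)) = cmod (laplace a b (\<lambda>z. \<phi> (f z)) z) / (2 * pi)"
    unfolding laplace_rep_dual[OF f z \<phi>(1)] by (simp add: norm_divide norm_mult)
  also have "\<dots> \<le> cmod (laplace a b (\<lambda>z. \<phi> (f z)) z) / 1" using pi_ge_two by (intro divide_left_mono) auto
  also have "\<dots> \<le> FO_seminorm p a b (k, \<alpha>) f / (m - 1 / real k)"
    using laplace_bound[OF ab dual_infra_growth[OF f \<phi>(1)] gb _ assms(3,4)] by simp
  finally show "cmod (\<phi> (laplace_rep f z)) \<le> FO_seminorm p a b (k, \<alpha>) f / (m - 1 / real k)" .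
qed

text \<open>On the strip of index n the distance is at least 1 / n. Spending 1 / (2 n) on the growth
  of \<open>f\<close> leaves a margin of 1 / (2 n), whose reciprocal is the constant; the weight
  itself is at most 1.\<close>

lemma laplace_rep_weighted_bound:
  assumes f: "f \<in> FO smul p a b" and "1 \<le> n" "z \<in> S_strip {a..b} n"
  shows "Oexp_weighted p (laplace_rep f) (n, \<alpha>) z \<le> 2 * real n * FO_seminorm p a b (2 * n, \<alpha>) f"
proof -
  have "p \<alpha> (laplace_rep f z) \<le> FO_seminorm p a b (2 * n, \<alpha>) f / (1 / real n - 1 / real (2 * n))"
    using S_strip_infdist[OF ab assms(3)] assms(2) by (intro laplace_rep_bound[OF f]) (auto simp: field_simps)
  also have "1 / real n - 1 / real (2 * n) = 1 / (2 * real n)" using assms(2) by (simp add: field_simps)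
  finally have 1: "p \<alpha> (laplace_rep f z) \<le> 2 * real n * FO_seminorm p a b (2 * n, \<alpha>) f" by (simp add: mult.commute)
  have "Oexp_weighted p (laplace_rep f) (n, \<alpha>) z \<le> p \<alpha> (laplace_rep f z) * 1"
    unfolding Oexp_weighted_def prod.case by (intro mult_left_mono p_nonneg) simp
  then show ?thesis using 1 by simp
qed

lemma laplace_rep_in_Oexp:
  assumes f: "f \<in> FO smul p a b"
  shows "laplace_rep f \<in> Oexp smul p {a..b}"
  unfolding Oexp_def mem_Collect_eq
proof (intro conjI ballI allI impI)
  fix z assume "z \<in> segment a b" then show "laplace_rep f z = 0" by (simp add: laplace_rep_def)
next
  show "lc_holomorphic_on smul p (laplace_rep f) (- segment a b)"
  proof (rule lc_holomorphic_onI[OF open_Compl_segment])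
    fix \<phi> assume \<phi>: "\<phi> \<in> lc_dual smul p"
    have "(\<lambda>z. laplace a b (\<lambda>z. \<phi> (f z)) z / (2 * pi)) holomorphic_on - segment a b"
      by (intro holomorphic_intros laplace_holomorphic[OF ab dual_infra_growth[OF f \<phi>]]) simp
    then show "(\<lambda>z. \<phi> (laplace_rep f z)) holomorphic_on - segment a b"
      by (rule holomorphic_transform) (simp add: laplace_rep_dual[OF f _ \<phi>])
  next
    fix \<alpha> C assume C: "compact C" "C \<subseteq> - segment a b"
    show "\<exists>B. \<forall>z\<in>C. p \<alpha> (laplace_rep f z) \<le> B"
    proof (cases "C = {}")
      case False
      have "continuous_on C (\<lambda>z. infdist z (segment a b))" by (intro continuous_intros)
      from continuous_attains_inf[OF C(1) False this]
      obtain z0 where z0: "z0 \<in> C" "\<And>z. z \<in> C \<Longrightarrow> infdist z0 (segment a b) \<le> infdist z (segment a b)" by blast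
      have "0 < infdist z0 (segment a b)" using z0(1) C(2) by (intro infdist_segment_pos[OF ab]) auto
      then obtain n where "inverse (real (Suc n)) < infdist z0 (segment a b)" using reals_Archimedean by blast
      then have n: "1 / real (Suc n) < infdist z0 (segment a b)" by (simp add: inverse_eq_divide)
      show ?thesis using laplace_rep_bound[OF f _ n z0(2)] by (metis le_add1 plus_1_eq_Suc)
    qed simp
  qed
next
  fix n \<alpha> assume n: "1 \<le> (n::nat)"
  show "bdd_above (Oexp_weighted p (laplace_rep f) (n, \<alpha>) ` S_strip {a..b} n)"
    by (rule bdd_aboveI2) (rule laplace_rep_weighted_bound[OF f n])
qed

lemma laplace_rep_seminorm_bound:
  assumes f: "f \<in> FO smul p a b" and "1 \<le> n"
  shows "Oexp_seminorm p {a..b} (n, \<alpha>) (laplace_rep f) \<le> 2 * real n * FO_seminorm p a b (2 * n, \<alpha>) f"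
  unfolding Oexp_seminorm_def fst_conv
  by (rule cSUP_least[OF S_strip_nonempty]) (use assms(2) laplace_rep_weighted_bound[OF f] in auto)

text \<open>The continuity criterion is phrased with differences. Linearity is read off from
  truncated integrals along one ray shared by all three functions.\<close>

lemma laplace_rep_diff:
  assumes f: "f \<in> FO smul p a b" and g: "g \<in> FO smul p a b"
  shows "laplace_rep (f - g) = laplace_rep f - laplace_rep g"
proof
  fix z
  show "laplace_rep (f - g) z = (laplace_rep f - laplace_rep g) z"
  proof (cases "z \<in> segment a b")
    case False
    have fg: "f - g \<in> FO smul p a b" by (rule FO_diff[OF f g])
    have "\<phi> (laplace_rep (f - g) z) = \<phi> (laplace_rep f z - laplace_rep g z)" if \<phi>: "\<phi> \<in> lc_dual smul p" for \<phi>
    proof -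
      define d where "d = infdist z (segment a b)"
      define u where "u = sep_dir a b z"
      have d: "0 < d" unfolding d_def by (rule infdist_segment_pos[OF ab False])
      have u: "separates a b z u d" unfolding u_def d_def by (rule separates_sep_dir[OF ab False])
      note lim = laplace_tendsto[OF ab dual_infra_growth[OF _ \<phi>] False u d]
      have hol: "(\<lambda>z. \<phi> (h z)) holomorphic_on UNIV" if "h \<in> FO smul p a b" for h
        using dual_infra_growth[OF that \<phi>] by (simp add: infra_growth_def)
      have i: "(\<lambda>\<zeta>. \<phi> (h \<zeta>) * exp (\<i> * z * \<zeta>)) contour_integrable_on linepath 0 (of_nat N * u)" if "h \<in> FO smul p a b" for h N
        by (rule contour_integrable_holomorphic_simple[where S = UNIV]) (intro holomorphic_intros hol[OF that] | simp)+
      have "laplace_seq (\<lambda>z. \<phi> ((f - g) z)) z u N = laplace_seq (\<lambda>z. \<phi> (f z)) z u N - laplace_seq (\<lambda>z. \<phi> (g z)) z u N" for N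
        unfolding laplace_seq_def contour_integral_diff[OF i[OF f] i[OF g], symmetric]
        by (simp add: lc_dual_diff[OF \<phi>] left_diff_distrib)
      then have "(\<lambda>N. laplace_seq (\<lambda>z. \<phi> (f z)) z u N - laplace_seq (\<lambda>z. \<phi> (g z)) z u N) = laplace_seq (\<lambda>z. \<phi> ((f - g) z)) z u"
        by (intro ext) (rule sym)
      then have "(\<lambda>N. laplace_seq (\<lambda>z. \<phi> (f z)) z u N - laplace_seq (\<lambda>z. \<phi> (g z)) z u N) \<longlonglongrightarrow> laplace a b (\<lambda>z. \<phi> ((f - g) z)) z"
        using lim[OF fg] by (simp only:)
      moreover have "(\<lambda>N. laplace_seq (\<lambda>z. \<phi> (f z)) z u N - laplace_seq (\<lambda>z. \<phi> (g z)) z u N) \<longlonglongrightarrow> laplace a b (\<lambda>z. \<phi> (f z)) z - laplace a b (\<lambda>z. \<phi> (g z)) z"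
        by (intro tendsto_diff lim f g)
      ultimately have "laplace a b (\<lambda>z. \<phi> ((f - g) z)) z = laplace a b (\<lambda>z. \<phi> (f z)) z - laplace a b (\<lambda>z. \<phi> (g z)) z"
        by (rule LIMSEQ_unique)
      then show ?thesis
        by (simp only: lc_dual_diff[OF \<phi>] laplace_rep_dual[OF fg False \<phi>] laplace_rep_dual[OF f False \<phi>] laplace_rep_dual[OF g False \<phi>] diff_divide_distrib)
    qed
    then have "laplace_rep (f - g) z = laplace_rep f z - laplace_rep g z" by (rule dual_separates)
    then show ?thesis by simp
  qed (simp add: laplace_rep_def)
qed

lemma fourier_rep_laplace_rep:
  assumes f: "f \<in> FO smul p a b"
  shows "fourier_rep (laplace_rep f) = f"
proof
  fix \<zeta>
  show "fourier_rep (laplace_rep f) \<zeta> = f \<zeta>"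
  proof (rule dual_separates)
    fix \<phi> assume \<phi>: "\<phi> \<in> lc_dual smul p"
    have t: "tame_path (gamma_path a b 1) (2 * (b - a) + 2 * pi * 1)" using ab by (intro tame_gamma_path) auto
    have "\<phi> (fourier_rep (laplace_rep f) \<zeta>) = contour_integral (gamma_path a b 1) (\<lambda>z. \<phi> (laplace_rep f z) * exp (- \<i> * z * \<zeta>))"
      by (rule fourier_rep_dual[OF Oexp_holomorphic[OF laplace_rep_in_Oexp[OF f]] \<phi> zero_less_one])
    also have "\<dots> = contour_integral (gamma_path a b 1) (\<lambda>z. (1 / (2 * pi)) * (laplace a b (\<lambda>z. \<phi> (f z)) z * exp (- \<i> * z * \<zeta>)))"
    proof (rule contour_integral_cong)
      fix z assume "z \<in> path_image (gamma_path a b 1)"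
      then have "z \<notin> segment a b" using path_image_gamma_path_subset[OF ab zero_less_one] by blast
      then show "\<phi> (laplace_rep f z) * exp (- \<i> * z * \<zeta>) = (1 / (2 * pi)) * (laplace a b (\<lambda>z. \<phi> (f z)) z * exp (- \<i> * z * \<zeta>))"
        by (simp add: laplace_rep_dual[OF f _ \<phi>])
    qed simp
    also have "\<dots> = (1 / (2 * pi)) * contour_integral (gamma_path a b 1) (\<lambda>z. laplace a b (\<lambda>z. \<phi> (f z)) z * exp (- \<i> * z * \<zeta>))"
      by (intro contour_integral_lmul tame_path_integrable[OF t] continuous_on_gamma_path[OF _ ab zero_less_one]
        holomorphic_intros laplace_holomorphic[OF ab dual_infra_growth[OF f \<phi>]])
    also have "\<dots> = \<phi> (f \<zeta>)"
      unfolding fourier_laplace[OF ab dual_infra_growth[OF f \<phi>] zero_less_one] by simp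
    finally show "\<phi> (fourier_rep (laplace_rep f) \<zeta>) = \<phi> (f \<zeta>)" .
  qed
qed

text \<open>
  The integral over a large contour in Cauchy's formula defines the entire part of \<open>F\<close>.
\<close>

definition entire_part :: "(complex \<Rightarrow> 'e) \<Rightarrow> complex \<Rightarrow> 'e" where
  "entire_part F z = (SOME e. \<forall>\<phi>\<in>lc_dual smul p.
     \<phi> e = - contour_integral (gamma_path a b (infdist z (segment a b) + 1)) (\<lambda>w. \<phi> (F w) / (w - z)) / (2 * pi * \<i>))"

text \<open>In the definition the radius moves with \<open>z\<close>. Freeing it lets one contour
  serve a whole neighbourhood of points, which differentiation and uniform bounds require.\<close>

lemma entire_part_dual:
  assumes F: "lc_holomorphic_on smul p F (- segment a b)" and \<phi>: "\<phi> \<in> lc_dual smul p" and c: "infdist z (segment a b) < c"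
  shows "\<phi> (entire_part F z) = - contour_integral (gamma_path a b c) (\<lambda>w. \<phi> (F w) / (w - z)) / (2 * pi * \<i>)"
proof -
  define d where "d = infdist z (segment a b)"
  have d: "0 \<le> d" "d < c" using c by (auto simp: d_def infdist_nonneg)
  \<comment> \<open>Outside the level of \<open>z\<close> the Cauchy integrand has no singularity,
    and all contours of radius greater than \<open>d\<close> lie there.\<close>
  define S where "S = {w. d < infdist w (segment a b)}"
  have S: "open S" unfolding S_def by (intro open_Collect_less continuous_intros)
  have Sz: "w \<noteq> z" "w \<notin> segment a b" if "w \<in> S" for w using that d by (auto simp: S_def d_def)
  have Sseg: "S \<subseteq> - segment a b" using Sz(2) by blast
  have hS: "(\<lambda>w. 1 / (w - z)) holomorphic_on S" by (intro holomorphic_intros) (use Sz in auto)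
  have FS: "lc_holomorphic_on smul p F S" using F Sseg by (auto simp: lc_holomorphic_on_def)
  have "path_image (gamma_path a b (d + 1)) \<subseteq> S"
    using infdist_gamma_path[OF ab, of "d + 1"] d by (auto simp: S_def)
  then have "\<exists>e. \<forall>\<phi>\<in>lc_dual smul p. \<phi> e = contour_integral (gamma_path a b (d + 1)) (\<lambda>w. \<phi> (smul (1 / (w - z)) (F w)))"
    by (rule weak_gamma_path_integral_exists[OF lc_holomorphic_on_scale[OF S hS FS] S _ ab]) (use d in simp)
  then obtain e where "\<And>\<phi>. \<phi> \<in> lc_dual smul p \<Longrightarrow> \<phi> e = contour_integral (gamma_path a b (d + 1)) (\<lambda>w. \<phi> (F w) / (w - z))"
    by (auto simp: lc_dual_scale)
  then have "\<forall>\<phi>\<in>lc_dual smul p. \<phi> (smul (- 1 / (2 * pi * \<i>)) e) = - contour_integral (gamma_path a b (d + 1)) (\<lambda>w. \<phi> (F w) / (w - z)) / (2 * pi * \<i>)"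
    by (simp add: lc_dual_scale del: scale_minus_left)
  then have "\<exists>e. \<forall>\<phi>\<in>lc_dual smul p. \<phi> e = - contour_integral (gamma_path a b (d + 1)) (\<lambda>w. \<phi> (F w) / (w - z)) / (2 * pi * \<i>)" by blast
  from someI_ex[OF this] have 1: "\<phi> (entire_part F z) = - contour_integral (gamma_path a b (d + 1)) (\<lambda>w. \<phi> (F w) / (w - z)) / (2 * pi * \<i>)"
    using \<phi> unfolding entire_part_def d_def by blast
  have hol: "(\<lambda>w. \<phi> (F w) / (w - z)) holomorphic_on S"
    by (intro holomorphic_on_divide lc_holomorphic_on_dual[OF FS \<phi>] holomorphic_intros) (use Sz in auto)
  have eq: "contour_integral (gamma_path a b c1) (\<lambda>w. \<phi> (F w) / (w - z)) = contour_integral (gamma_path a b c2) (\<lambda>w. \<phi> (F w) / (w - z))"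
    if "d < c1" "c1 \<le> c2" for c1 c2
    by (rule contour_integral_gamma_path_eq[OF ab _ that(2) S _ hol]) (use that d in \<open>auto simp: S_def\<close>)
  have "contour_integral (gamma_path a b (d + 1)) (\<lambda>w. \<phi> (F w) / (w - z)) = contour_integral (gamma_path a b c) (\<lambda>w. \<phi> (F w) / (w - z))"
  proof (cases "d + 1 \<le> c")
    case True then show ?thesis by (intro eq) auto
  next
    case False then show ?thesis using d by (intro eq[symmetric]) auto
  qed
  then show ?thesis using 1 by simp
qed

text \<open>A contour of radius |R| + 1 keeps distance at least 1 from all points concerned, so the
  Cauchy kernel is at most 1 on it.\<close>

lemma entire_part_bound:
  assumes F: "lc_holomorphic_on smul p F (- segment a b)"
  shows "\<exists>B. \<forall>z. infdist z (segment a b) \<le> R \<longrightarrow> p \<alpha> (entire_part F z) \<le> B"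
proof -
  define c where "c = \<bar>R\<bar> + 1"
  have c: "0 < c" by (simp add: c_def)
  have t: "tame_path (gamma_path a b c) (2 * (b - a) + 2 * pi * c)" using ab c by (intro tame_gamma_path) auto
  obtain B where B: "\<And>w. w \<in> path_image (gamma_path a b c) \<Longrightarrow> p \<alpha> (F w) \<le> B"
    using lc_holomorphic_on_bounded[OF F tame_path_compact[OF t] path_image_gamma_path_subset[OF ab c]] by blast
  have "p \<alpha> (entire_part F z) \<le> (2 * (b - a) + 2 * pi * c) * B" if z: "infdist z (segment a b) \<le> R" for z
  proof (rule p_le_if_dual_le)
    fix \<phi> assume \<phi>: "\<phi> \<in> lc_dual smul p" "\<And>x. cmod (\<phi> x) \<le> p \<alpha> x"
    have zc: "infdist z (segment a b) < c" using z by (simp add: c_def)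
    have w: "1 \<le> cmod (w - z)" if "w \<in> path_image (gamma_path a b c)" for w
    proof -
      have "infdist w (segment a b) = c" using ab c that by (intro infdist_gamma_path) auto
      moreover have "infdist w (segment a b) \<le> infdist z (segment a b) + dist w z" by (rule infdist_triangle)
      ultimately show ?thesis using z by (simp add: c_def dist_norm)
    qed
    then have wz: "w - z \<noteq> 0" if "w \<in> path_image (gamma_path a b c)" for w using that by force
    have "cmod (\<phi> (entire_part F z)) = cmod (contour_integral (gamma_path a b c) (\<lambda>w. \<phi> (F w) / (w - z))) / (2 * pi)"
      unfolding entire_part_dual[OF F \<phi>(1) zc] by (simp add: norm_divide norm_mult)
    also have "\<dots> \<le> cmod (contour_integral (gamma_path a b c) (\<lambda>w. \<phi> (F w) / (w - z))) / 1"
      using pi_ge_two by (intro divide_left_mono) auto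
    also have "\<dots> \<le> (2 * (b - a) + 2 * pi * c) * B"
      unfolding div_by_1
    proof (rule tame_path_bound[OF t])
      show "continuous_on (path_image (gamma_path a b c)) (\<lambda>w. \<phi> (F w) / (w - z))"
        by (intro continuous_intros continuous_on_gamma_path[OF lc_holomorphic_on_dual[OF F \<phi>(1)] ab c]) (use wz in blast)
      fix w assume "w \<in> path_image (gamma_path a b c)"
      then have "cmod (\<phi> (F w)) \<le> B" "1 \<le> cmod (w - z)" using B \<phi>(2) w order_trans by blast+
      then have "cmod (\<phi> (F w)) / cmod (w - z) \<le> B / 1" by (intro frac_le) (auto intro: order_trans[OF norm_ge_zero])
      then show "cmod (\<phi> (F w) / (w - z)) \<le> B" by (simp add: norm_divide)
    qed
    finally show "cmod (\<phi> (entire_part F z)) \<le> (2 * (b - a) + 2 * pi * c) * B" .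
  qed
  then show ?thesis by blast
qed

lemma entire_part_holomorphic:
  assumes F: "lc_holomorphic_on smul p F (- segment a b)"
  shows "lc_holomorphic_on smul p (entire_part F) UNIV"
proof (rule lc_holomorphic_onI[OF open_UNIV])
  fix \<phi> assume \<phi>: "\<phi> \<in> lc_dual smul p"
  show "(\<lambda>z. \<phi> (entire_part F z)) holomorphic_on UNIV"
  proof (rule holomorphic_onI)
    fix z0
    define c where "c = infdist z0 (segment a b) + 1"
    define U where "U = {z. infdist z (segment a b) < c}"
    have c: "0 < c" unfolding c_def by (simp add: add_nonneg_pos infdist_nonneg)
    have U: "open U" "z0 \<in> U" unfolding U_def by (auto intro!: open_Collect_less continuous_intros simp: c_def)
    have t: "tame_path (gamma_path a b c) (2 * (b - a) + 2 * pi * c)" using ab c by (intro tame_gamma_path) auto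
    have "z0 \<notin> path_image (gamma_path a b c)" using infdist_gamma_path[OF ab less_imp_le[OF c]] by (force simp: c_def)
    note der = contour_integral_cauchy_has_field_derivative[OF t continuous_on_gamma_path[OF lc_holomorphic_on_dual[OF F \<phi>] ab c] this]
    have "(\<lambda>z. - contour_integral (gamma_path a b c) (\<lambda>w. \<phi> (F w) / (w - z)) / (2 * pi * \<i>)) field_differentiable at z0"
      by (intro field_differentiable_divide field_differentiable_minus field_differentiable_const)
        (use der in \<open>auto simp: field_differentiable_def\<close>)
    then obtain D where "((\<lambda>z. - contour_integral (gamma_path a b c) (\<lambda>w. \<phi> (F w) / (w - z)) / (2 * pi * \<i>)) has_field_derivative D) (at z0)"
      by (auto simp: field_differentiable_def)
    then have "((\<lambda>z. \<phi> (entire_part F z)) has_field_derivative D) (at z0)"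
      by (rule has_field_derivative_transform_within_open[OF _ U]) (simp add: entire_part_dual[OF F \<phi>] U_def)
    then show "(\<lambda>z. \<phi> (entire_part F z)) field_differentiable at z0 within UNIV"
      by (auto simp: field_differentiable_def)
  qed
next
  fix \<alpha> and C :: "complex set" assume C: "compact C"
  have "compact ((\<lambda>z. infdist z (segment a b)) ` C)" by (intro compact_continuous_image C continuous_intros)
  then have "bdd_above ((\<lambda>z. infdist z (segment a b)) ` C)" by (intro bounded_imp_bdd_above compact_imp_bounded)
  then obtain R where "\<And>z. z \<in> C \<Longrightarrow> infdist z (segment a b) \<le> R" by (auto simp: bdd_above_def)
  then show "\<exists>B. \<forall>z\<in>C. p \<alpha> (entire_part F z) \<le> B" using entire_part_bound[OF F, of R \<alpha>] by meson
qed

text \<open>The inner integral of the Cauchy decomposition vanishes, so off the segment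
  \<open>F\<close> equals its entire part. The growth of the latter is inherited from
  \<open>F\<close> away from the segment.\<close>

lemma fourier_rep_injective:
  assumes F: "F \<in> Oexp smul p {a..b}" and zero: "\<And>\<zeta>. fourier_rep F \<zeta> = 0"
  shows "F \<in> Oexp_entire smul p {a..b}"
proof -
  note holF = Oexp_holomorphic[OF F]
  have eq: "F z = entire_part F z" if z: "z \<notin> segment a b" for z
  proof (rule dual_separates)
    fix \<phi> assume \<phi>: "\<phi> \<in> lc_dual smul p"
    define d where "d = infdist z (segment a b)"
    have d: "0 < d" unfolding d_def by (rule infdist_segment_pos[OF ab z])
    have h: "0 < d / 2" "d / 2 < d" "d < d + 1" using d by auto
    note holp = lc_holomorphic_on_dual[OF holF \<phi>]
    have "contour_integral (gamma_path a b (d / 2)) (\<lambda>w. \<phi> (F w) / (w - z)) = 0"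
    proof (rule fourier_zero_imp_cauchy_zero[OF holp ab h(1)])
      show "d / 2 < infdist z (segment a b)" using h(2) by (simp add: d_def)
      show "contour_integral (gamma_path a b (d / 2)) (\<lambda>w. \<phi> (F w) * exp (- \<i> * w * \<zeta>)) = 0" for \<zeta>
        using fourier_rep_dual[OF holF \<phi> h(1), of \<zeta>] zero[of \<zeta>] by (simp add: lc_dual_zero[OF \<phi>])
    qed
    moreover have "2 * pi * \<i> * \<phi> (F z) = contour_integral (gamma_path a b (d / 2)) (\<lambda>w. \<phi> (F w) / (w - z)) - contour_integral (gamma_path a b (d + 1)) (\<lambda>w. \<phi> (F w) / (w - z))"
      by (rule cauchy_decomposition[OF holp ab h(1)]) (use h in \<open>simp_all add: d_def\<close>)
    ultimately have "2 * pi * \<i> * \<phi> (F z) = - contour_integral (gamma_path a b (d + 1)) (\<lambda>w. \<phi> (F w) / (w - z))" by simp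
    moreover have "\<phi> (entire_part F z) = - contour_integral (gamma_path a b (d + 1)) (\<lambda>w. \<phi> (F w) / (w - z)) / (2 * pi * \<i>)"
      by (rule entire_part_dual[OF holF \<phi>]) (simp add: d_def)
    ultimately show "\<phi> (F z) = \<phi> (entire_part F z)" by (metis nonzero_mult_div_cancel_left mult_eq_0_iff i_squared complex_i_not_zero of_real_eq_0_iff pi_neq_zero zero_neq_numeral)
  qed
  have "entire_part F \<in> Oexp smul p {}"
    unfolding Oexp_def mem_Collect_eq
  proof (intro conjI ballI allI impI)
    show "lc_holomorphic_on smul p (entire_part F) (- complex_of_real ` {})"
      using entire_part_holomorphic[OF holF] by simp
    fix n \<alpha> assume n: "1 \<le> (n::nat)"
    obtain B1 where B1: "\<forall>z\<in>S_strip {a..b} n. Oexp_weighted p F (n, \<alpha>) z \<le> B1" using Oexp_weighted_le[OF F n] by meson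
    obtain B2 where B2: "\<And>z. infdist z (segment a b) \<le> 1 / real n \<Longrightarrow> p \<alpha> (entire_part F z) \<le> B2"
      using entire_part_bound[OF holF] by meson
    show "bdd_above (Oexp_weighted p (entire_part F) (n, \<alpha>) ` S_strip {} n)"
    proof (rule bdd_aboveI2)
      fix z assume z: "z \<in> S_strip {} n"
      show "Oexp_weighted p (entire_part F) (n, \<alpha>) z \<le> max B1 B2"
      \<comment> \<open>Near the segment the growth of \<open>F\<close> says nothing, but there the
        entire part is bounded; elsewhere in the strip it coincides with \<open>F\<close>.\<close>
      proof (cases "infdist z (segment a b) \<le> 1 / real n")
        case True
        have "Oexp_weighted p (entire_part F) (n, \<alpha>) z \<le> p \<alpha> (entire_part F z) * 1"
          unfolding Oexp_weighted_def prod.case by (intro mult_left_mono p_nonneg) simp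
        then show ?thesis using B2[OF True] by simp
      next
        case False
        then have zS: "z \<in> S_strip {a..b} n" using z by (intro S_stripI[OF ab]) (auto simp: S_strip_empty)
        then have "z \<notin> segment a b" using S_strip_infdist[OF ab zS] n by auto
        then have "Oexp_weighted p (entire_part F) (n, \<alpha>) z = Oexp_weighted p F (n, \<alpha>) z"
          using eq by (simp add: Oexp_weighted_def)
        then show ?thesis using bspec[OF B1 zS] by simp
      qed
    qed
  qed simp
  moreover have "F = (\<lambda>z. if z \<in> segment a b then 0 else entire_part F z)"
  proof
    fix z
    have "F z = 0" if "z \<in> segment a b" using F that unfolding Oexp_def by blast
    then show "F z = (if z \<in> segment a b then 0 else entire_part F z)"
      using eq by (cases "z \<in> segment a b") simp_all
  qed
  ultimately show ?thesis unfolding Oexp_entire_def by (intro image_eqI[of _ _ "entire_part F"])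
qed

section \<open>Continuity of both transforms and passage to the quotient\<close>

lemma FO_seminorm_triangle:
  assumes "1 \<le> k" and "u \<in> FO smul p a b" "v \<in> FO smul p a b" "w \<in> FO smul p a b"
  shows "FO_seminorm p a b (k, \<alpha>) (u - w) \<le> FO_seminorm p a b (k, \<alpha>) (u - v) + FO_seminorm p a b (k, \<alpha>) (v - w)"
  unfolding FO_seminorm_def
proof (rule cSUP_add_le)
  have "u - v \<in> FO smul p a b" "v - w \<in> FO smul p a b" by (intro FO_diff assms)+
  then show "bdd_above (range (FO_weighted p a b (u - v) (k, \<alpha>)))" "bdd_above (range (FO_weighted p a b (v - w) (k, \<alpha>)))"
    using assms(1) by (simp_all add: FO_def)
  fix z
  show "FO_weighted p a b (u - w) (k, \<alpha>) z \<le> FO_weighted p a b (u - v) (k, \<alpha>) z + FO_weighted p a b (v - w) (k, \<alpha>) z"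
    using p_diff_triangle[of \<alpha> "u z" "w z" "v z"]
    by (simp add: FO_weighted_def flip: distrib_right)
qed simp

lemma Oexp_seminorm_triangle:
  assumes "1 \<le> n" and "u \<in> Oexp smul p {a..b}" "v \<in> Oexp smul p {a..b}" "w \<in> Oexp smul p {a..b}"
  shows "Oexp_seminorm p {a..b} (n, \<alpha>) (u - w) \<le> Oexp_seminorm p {a..b} (n, \<alpha>) (u - v) + Oexp_seminorm p {a..b} (n, \<alpha>) (v - w)"
  unfolding Oexp_seminorm_def fst_conv
proof (rule cSUP_add_le)
  show "S_strip {a..b} n \<noteq> {}" using assms(1) by (intro S_strip_nonempty) auto
  have "u - v \<in> Oexp smul p {a..b}" "v - w \<in> Oexp smul p {a..b}" by (intro Oexp_diff[OF open_Compl_segment] assms)+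
  then show "bdd_above (Oexp_weighted p (u - v) (n, \<alpha>) ` S_strip {a..b} n)" "bdd_above (Oexp_weighted p (v - w) (n, \<alpha>) ` S_strip {a..b} n)"
    using assms(1) by (simp_all add: Oexp_def)
  fix z
  show "Oexp_weighted p (u - w) (n, \<alpha>) z \<le> Oexp_weighted p (u - v) (n, \<alpha>) z + Oexp_weighted p (v - w) (n, \<alpha>) z"
    using p_diff_triangle[of \<alpha> "u z" "w z" "v z"]
    by (simp add: Oexp_weighted_def flip: distrib_right)
qed

lemma FO_seminorm_zero: "FO_seminorm p a b i 0 = 0"
  by (cases i) (simp add: FO_seminorm_def FO_weighted_def seminorm_zero)

lemma Oexp_seminorm_zero:
  assumes "1 \<le> fst i"
  shows "Oexp_seminorm p {a..b} i 0 = 0"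
  using S_strip_nonempty[of "{a..b}" "fst i"] assms
  by (cases i) (simp add: Oexp_seminorm_def Oexp_weighted_def seminorm_zero)

lemma fourier_rep_diff:
  assumes F: "F \<in> Oexp smul p {a..b}" and G: "G \<in> Oexp smul p {a..b}"
  shows "fourier_rep (F - G) = fourier_rep F - fourier_rep G"
proof
  fix \<zeta>
  have "fourier_rep ((F - G) + G) \<zeta> = fourier_rep (F - G) \<zeta> + fourier_rep G \<zeta>"
    by (intro fourier_rep_add Oexp_holomorphic Oexp_diff[OF open_Compl_segment] F G)
  then show "fourier_rep (F - G) \<zeta> = (fourier_rep F - fourier_rep G) \<zeta>" by (simp add: algebra_simps)
qed

lemma continuous_map_fourier_rep:
  "continuous_map (Oexp_topology smul p {a..b}) (FO_topology smul p a b) fourier_rep"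
  unfolding Oexp_topology_def FO_topology_def
proof (rule continuous_map_seminorm_topology)
  fix j :: "nat \<times> 'i" assume "j \<in> {1..} \<times> UNIV"
  then obtain k \<alpha> where j: "j = (k, \<alpha>)" "1 \<le> k" by auto
  show "\<exists>i\<in>{1..} \<times> UNIV. \<exists>C. \<forall>x\<in>Oexp smul p {a..b}. \<forall>x'\<in>Oexp smul p {a..b}.
      FO_seminorm p a b j (fourier_rep x' - fourier_rep x) \<le> C * Oexp_seminorm p {a..b} i (x' - x)"
  proof (intro bexI exI ballI)
    fix x x' assume x: "x \<in> Oexp smul p {a..b}" "x' \<in> Oexp smul p {a..b}"
    show "FO_seminorm p a b j (fourier_rep x' - fourier_rep x) \<le>
        (2 * (b - a) + 2 * pi * (1 / real k)) * exp (\<bar>a\<bar> + \<bar>b\<bar> + 1) * Oexp_seminorm p {a..b} (Suc k, \<alpha>) (x' - x)"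
      unfolding j(1) fourier_rep_diff[OF x(2,1), symmetric]
      by (rule fourier_rep_seminorm_bound[OF Oexp_diff[OF open_Compl_segment x(2,1)] j(2)])
  qed simp
  fix u v w assume "u \<in> FO smul p a b" "v \<in> FO smul p a b" "w \<in> FO smul p a b"
  then show "FO_seminorm p a b j (u - w) \<le> FO_seminorm p a b j (u - v) + FO_seminorm p a b j (v - w)"
    unfolding j(1) by (rule FO_seminorm_triangle[OF j(2)])
next
  fix i :: "nat \<times> 'i" and x x' assume i: "i \<in> {1..} \<times> UNIV" and x: "x \<in> Oexp smul p {a..b}" "x' \<in> Oexp smul p {a..b}"
  then show "0 \<le> Oexp_seminorm p {a..b} i (x' - x)"
    using Oexp_seminorm_nonneg[OF Oexp_diff[OF open_Compl_segment x(2,1)]] by (cases i) simp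
qed (auto simp: fourier_rep_in_FO FO_seminorm_zero Oexp_seminorm_zero)

lemma continuous_map_laplace_rep:
  "continuous_map (FO_topology smul p a b) (Oexp_topology smul p {a..b}) laplace_rep"
  unfolding Oexp_topology_def FO_topology_def
proof (rule continuous_map_seminorm_topology)
  fix j :: "nat \<times> 'i" assume "j \<in> {1..} \<times> UNIV"
  then obtain n \<alpha> where j: "j = (n, \<alpha>)" "1 \<le> n" by auto
  show "\<exists>i\<in>{1..} \<times> UNIV. \<exists>C. \<forall>x\<in>FO smul p a b. \<forall>x'\<in>FO smul p a b.
      Oexp_seminorm p {a..b} j (laplace_rep x' - laplace_rep x) \<le> C * FO_seminorm p a b i (x' - x)"
  proof (intro bexI exI ballI)
    fix x x' assume x: "x \<in> FO smul p a b" "x' \<in> FO smul p a b"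
    show "Oexp_seminorm p {a..b} j (laplace_rep x' - laplace_rep x) \<le> 2 * real n * FO_seminorm p a b (2 * n, \<alpha>) (x' - x)"
      unfolding j(1) laplace_rep_diff[OF x(2,1), symmetric]
      by (rule laplace_rep_seminorm_bound[OF FO_diff[OF x(2,1)] j(2)])
  qed (use j(2) in simp)
  fix u v w assume "u \<in> Oexp smul p {a..b}" "v \<in> Oexp smul p {a..b}" "w \<in> Oexp smul p {a..b}"
  then show "Oexp_seminorm p {a..b} j (u - w) \<le> Oexp_seminorm p {a..b} j (u - v) + Oexp_seminorm p {a..b} j (v - w)"
    unfolding j(1) by (rule Oexp_seminorm_triangle[OF j(2)])
next
  fix i :: "nat \<times> 'i" and x x' assume i: "i \<in> {1..} \<times> UNIV" and x: "x \<in> FO smul p a b" "x' \<in> FO smul p a b"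
  then show "0 \<le> FO_seminorm p a b i (x' - x)"
    using FO_seminorm_nonneg[OF FO_diff[OF x(2,1)]] by (cases i) simp
qed (auto simp: laplace_rep_in_Oexp FO_seminorm_zero Oexp_seminorm_zero)

lemma fourier_inj_on: "inj_on (fourier smul p a b) (bv smul p {a..b})"
proof (rule inj_onI)
  fix X Y assume X: "X \<in> bv smul p {a..b}" and Y: "Y \<in> bv smul p {a..b}" and eq: "fourier smul p a b X = fourier smul p a b Y"
  obtain F where F: "F \<in> Oexp smul p {a..b}" "X = bv_class smul p {a..b} F" using X unfolding bv_def by blast
  obtain G where G: "G \<in> Oexp smul p {a..b}" "Y = bv_class smul p {a..b} G" using Y unfolding bv_def by blast
  have "fourier_rep F = fourier_rep G" using eq unfolding F(2) G(2) fourier_class[OF F(1)] fourier_class[OF G(1)] .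
  then have "fourier_rep (F - G) \<zeta> = 0" for \<zeta> by (simp add: fourier_rep_diff[OF F(1) G(1)])
  then have "F - G \<in> Oexp_entire smul p {a..b}"
    by (rule fourier_rep_injective[OF Oexp_diff[OF open_Compl_segment F(1) G(1)]])
  then show "X = Y" unfolding F(2) G(2) by (simp only: bv_class_eq_iff)
qed

lemma bv_class_laplace_rep:
  assumes "f \<in> FO smul p a b"
  shows "bv_class smul p {a..b} (laplace_rep f) \<in> bv smul p {a..b}"
    and "fourier smul p a b (bv_class smul p {a..b} (laplace_rep f)) = f"
  using laplace_rep_in_Oexp[OF assms] fourier_class[OF laplace_rep_in_Oexp[OF assms]] fourier_rep_laplace_rep[OF assms]
  by (simp_all add: bv_def)

lemma fourier_in_FO: "X \<in> bv smul p {a..b} \<Longrightarrow> fourier smul p a b X \<in> FO smul p a b"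
  unfolding bv_def using fourier_class fourier_rep_in_FO by auto

text \<open>Continuity of \<open>fourier\<close> descends from representatives through the quotient
  map. The inverse is continuous as the composite of \<open>laplace_rep\<close> with the quotient
  map.\<close>

lemma homeomorphic_map_fourier:
  "homeomorphic_map (bv_topology smul p {a..b}) (FO_topology smul p a b) (fourier smul p a b)"
proof -
  let ?T = "fourier smul p a b" and ?S = "\<lambda>f. bv_class smul p {a..b} (laplace_rep f)"
  have bnd: "bounded {a..b}" by simp
  have q: "quotient_map (Oexp_topology smul p {a..b}) (bv_topology smul p {a..b}) (bv_class smul p {a..b})"
    unfolding bv_topology_def by (rule quotient_map_quotient_topology)
  have "continuous_map (Oexp_topology smul p {a..b}) (FO_topology smul p a b) (?T \<circ> bv_class smul p {a..b})"
    by (rule continuous_map_eq[OF continuous_map_fourier_rep])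
      (simp add: topspace_Oexp_topology[OF bnd] fourier_class)
  then have 1: "continuous_map (bv_topology smul p {a..b}) (FO_topology smul p a b) ?T"
    by (rule continuous_compose_quotient_map[OF q])
  have 2: "continuous_map (FO_topology smul p a b) (bv_topology smul p {a..b}) ?S"
    using continuous_map_compose[OF continuous_map_laplace_rep quotient_imp_continuous_map[OF q]] by (simp add: o_def)
  \<comment> \<open>Both classes have the same transform by the right inverse property, so
    injectivity identifies them.\<close>
  have "?S (?T X) = X" if "X \<in> bv smul p {a..b}" for X
    by (rule inj_onD[OF fourier_inj_on _ _ that]) (simp_all add: bv_class_laplace_rep fourier_in_FO that)
  then have "homeomorphic_maps (bv_topology smul p {a..b}) (FO_topology smul p a b) ?T ?S"
    unfolding homeomorphic_maps_def
    using 1 2 by (simp add: topspace_bv_topology[OF bnd] topspace_FO_topology bv_class_laplace_rep)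
  then show ?thesis unfolding homeomorphic_map_maps by blast
qed

lemma bij_betw_fourier: "bij_betw (fourier smul p a b) (bv smul p {a..b}) (FO smul p a b)"
  unfolding bij_betw_def
proof (intro conjI fourier_inj_on equalityI subsetI)
  fix f assume "f \<in> fourier smul p a b ` bv smul p {a..b}"
  then show "f \<in> FO smul p a b" using fourier_in_FO by blast
next
  fix f assume "f \<in> FO smul p a b"
  then show "f \<in> fourier smul p a b ` bv smul p {a..b}" using bv_class_laplace_rep by (metis imageI)
qed

lemma fourier_add:
  assumes "X \<in> bv smul p {a..b}" "Y \<in> bv smul p {a..b}"
  shows "fourier smul p a b (X + Y) = fourier smul p a b X + fourier smul p a b Y"
proof -
  obtain F where F: "F \<in> Oexp smul p {a..b}" "X = bv_class smul p {a..b} F" using assms(1) unfolding bv_def by blast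
  obtain G where G: "G \<in> Oexp smul p {a..b}" "Y = bv_class smul p {a..b} G" using assms(2) unfolding bv_def by blast
  have "fourier_rep (F + G) = fourier_rep F + fourier_rep G"
    using fourier_rep_add[OF Oexp_holomorphic[OF F(1)] Oexp_holomorphic[OF G(1)]] by (simp add: fun_eq_iff)
  then show ?thesis
    unfolding F(2) G(2) bv_class_add
    by (simp only: fourier_class[OF F(1)] fourier_class[OF G(1)] fourier_class[OF Oexp_add[OF open_Compl_segment F(1) G(1)]])
qed

lemma fourier_scale:
  assumes "X \<in> bv smul p {a..b}"
  shows "fourier smul p a b (bv_scale smul p {a..b} c X) = (\<lambda>\<zeta>. smul c (fourier smul p a b X \<zeta>))"
proof -
  obtain F where F: "F \<in> Oexp smul p {a..b}" "X = bv_class smul p {a..b} F" using assms unfolding bv_def by blast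
  show ?thesis
    unfolding F(2) bv_scale_class fourier_class[OF F(1)] fourier_class[OF Oexp_scale[OF open_Compl_segment F(1)]]
    by (rule ext) (rule fourier_rep_scale[OF Oexp_holomorphic[OF F(1)]])
qed

end

text \<open>\<open>fourier\<close> is a definite description, so the first conjunct certifies that
  its value really is the Pettis integral, for every representative and every radius.\<close>

theorem theorem4p3:
  fixes smul :: "complex \<Rightarrow> 'e::ab_group_add \<Rightarrow> 'e"
    and p :: "'i \<Rightarrow> 'e \<Rightarrow> real"
    and a b :: real
  assumes "locally_convex_space smul p"
    and "Hausdorff_space (lc_topology p)"
    and "locally_complete smul p"
    and "a \<le> b"
  shows "(\<forall>F\<in>Oexp smul p {a..b}. \<forall>c>0. \<forall>\<zeta>.
            has_fourier_value smul p a b c F \<zeta>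
              (fourier smul p a b (bv_class smul p {a..b} F) \<zeta>)) \<and>
         bv_FO_topological_isomorphism smul p a b (fourier smul p a b)"
proof -
  interpret fourier_setting smul p a b
    using assms by (simp add: fourier_setting_def fourier_setting_axioms_def locally_complete_space_def locally_complete_space_axioms_def)
  have "has_fourier_value smul p a b c F \<zeta> (fourier smul p a b (bv_class smul p {a..b} F) \<zeta>)"
    if "F \<in> Oexp smul p {a..b}" "0 < c" for F c \<zeta>
    by (simp add: fourier_class[OF that(1)] has_fourier_value_iff[OF Oexp_holomorphic[OF that(1)] that(2)])
  then show ?thesis
    unfolding bv_FO_topological_isomorphism_def
    using fourier_add fourier_scale bij_betw_fourier homeomorphic_map_fourier by blast
qed

end
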